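(* Let $0<\beta'<1$, $\sigma=1-\frac{\beta'}2$, $r\ge1$, $\gamma\in\mathbb R$, and let $\lambda_1,\lambda_2\ge0$ be constants, at least one of which is positive. Consider quasi-graded temporal meshes with grading $r$ (see context) such that the coefficients $g_{n,k}$ of $\delta_t^{\beta',*}$ satisfy (P1): $g_{n,k+1}>g_{n,k}>0$ for $1\le k\le n-1\le N-1$. Suppose that $\tau=\max_n\tau_n$ is sufficiently small. Then for real sequences $\{v^j\}_{j=0}^N$, $$\left.\begin{array}{l}(\delta_t^{\beta',*}-\lambda_1)v^j-\lambda_2v^{j-1}\lesssim(\tau_1/t_j)^{\gamma+1}\quad\text{for all }j\ge1,\\ v^0=0\end{array}\right\}\ \Longrightarrow\ v^j\lesssim V(j,\gamma):=\mathcal M_\gamma(t_j)\,\tau_1t_j^{\beta'-1}(\tau_1/t_j)^{\min\{0,\gamma\}}\quad\text{for all }j\ge1,$$ where $(\delta_t^{\beta',*}-\lambda_1)v^j:=\delta_t^{\beta',*}v^j-\lambda_1v^j$, $\mathcal M_\gamma(t_j)=1+\ln(t_j/\tau_1)$ if $\gamma=0$, and $\mathcal M_\gamma(t_j)=1$ if $\gamma\ne0$. Here $a\lesssim b$ means $a\le Cb$ with a positive constant $C$ independent of $j$ and of the mesh sizes (of $N$); i.e. for every constant in the hypothesis there is a constant in the conclusion, independent of $j$ and $N$, and the smallness threshold for $\tau$ is also independent of $j$, $N$.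
   Context: Fix $T>0$. For each $N$ let $0=t_0<t_1<\dots<t_N=T$ and $\tau_n=t_n-t_{n-1}$. The meshes are quasi-graded: $\tau_1\simeq N^{-r}$, $t_n\simeq\tau_1n^r$, $\tau_n\simeq\tau_1^{1/r}t_n^{1-1/r}$ for $1\le n\le N$, where $a\simeq b$ means that $a/b$ is bounded above and below by positive constants independent of $n$ and $N$. Put $t_n^*=t_n-(1-\sigma)\tau_n$. Alikhanov discrete derivative of order $\beta'$: $\delta_t^{\beta',*}v^n=\frac1{\Gamma(1-\beta')}\Bigl[\sum_{k=1}^{n-1}\int_{t_{k-1}}^{t_k}(t_n^*-s)^{-\beta'}\partial_s\Pi_{2,k}v(s)\,ds+\int_{t_{n-1}}^{t_n^*}(t_n^*-s)^{-\beta'}\partial_s\Pi_{1,n}v(s)\,ds\Bigr]$, where $\Pi_{2,k}v$ is the quadratic polynomial with values $v^{k-1},v^k,v^{k+1}$ at $t_{k-1},t_k,t_{k+1}$ and $\Pi_{1,n}v$ is the linear polynomial with values $v^{n-1},v^n$ at $t_{n-1},t_n$. Writing $\delta_t^{\beta',*}v^n=\sum_{k=1}^ng_{n,k}(v^k-v^{k-1})$ defines the coefficients $g_{n,k}$. *)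

theory Defs
  imports "HOL-Analysis.Analysis" "HOL-Computational_Algebra.Polynomial"
begin

section \<open>Interpolating polynomials\<close>

text \<open>The polynomial of degree less than \<open>card I\<close> with value \<open>v i\<close> at the node \<open>t i\<close> for
  all \<open>i\<close> in \<open>I\<close>. It is uniquely determined when the nodes are distinct; see
  \<open>ex1_interp_poly\<close>.\<close>

definition interp_poly :: "(nat \<Rightarrow> real) \<Rightarrow> (nat \<Rightarrow> real) \<Rightarrow> nat set \<Rightarrow> real poly" where
  "interp_poly t v I = (THE p. degree p < card I \<and> (\<forall>i\<in>I. poly p (t i) = v i))"

lemma interp_poly_unique:
  fixes p q :: "real poly"
  assumes "finite I" "inj_on t I"
    and "degree p < card I" "\<And>i. i \<in> I \<Longrightarrow> poly p (t i) = v i"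
    and "degree q < card I" "\<And>i. i \<in> I \<Longrightarrow> poly q (t i) = v i"
  shows "p = q"
  by (rule poly_eqI_degree[of "t ` I"]) (use assms in \<open>auto simp: card_image\<close>)

lemma ex1_interp_poly:
  assumes "finite I" "inj_on t I" "I \<noteq> {}"
  shows "\<exists>!p :: real poly. degree p < card I \<and> (\<forall>i\<in>I. poly p (t i) = v i)"
proof (rule ex_ex1I)
  define L where "L i = (\<Prod>j\<in>I - {i}. [:- t j, 1:])" for i
  define p where "p = (\<Sum>i\<in>I. smult (v i / poly (L i) (t i)) (L i))"
  have card_pos: "card I > 0"
    using assms by (simp add: card_gt_0_iff)
  have degL: "degree (L i) \<le> card I - 1" if "i \<in> I" for i
  proof -
    have "degree (L i) \<le> sum (degree \<circ> (\<lambda>j. [:- t j, 1:])) (I - {i})"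
      unfolding L_def by (rule degree_prod_sum_le) (use assms in auto)
    also have "\<dots> = card I - 1"
      using that assms by simp
    finally show ?thesis .
  qed
  have "degree p \<le> card I - 1"
    unfolding p_def
    by (rule degree_sum_le) (use assms degL in \<open>auto intro: order_trans[OF degree_smult_le]\<close>)
  hence "degree p < card I"
    using card_pos by linarith
  moreover have "poly p (t k) = v k" if k: "k \<in> I" for k
  proof -
    have nz: "poly (L k) (t k) \<noteq> 0"
      using assms k by (auto simp: L_def poly_prod inj_on_def)
    have z: "poly (L i) (t k) = 0" if "i \<in> I - {k}" for i
      using assms k that by (auto simp: L_def poly_prod)
    have "poly p (t k) = (\<Sum>i\<in>I. v i / poly (L i) (t i) * poly (L i) (t k))"
      by (simp add: p_def poly_sum)
    also have "\<dots> = v k / poly (L k) (t k) * poly (L k) (t k)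
                    + (\<Sum>i\<in>I - {k}. v i / poly (L i) (t i) * poly (L i) (t k))"
      using assms k by (simp add: sum.remove)
    also have "(\<Sum>i\<in>I - {k}. v i / poly (L i) (t i) * poly (L i) (t k)) = 0"
      using z by (intro sum.neutral) auto
    finally show ?thesis
      using nz by simp
  qed
  ultimately show "\<exists>p :: real poly. degree p < card I \<and> (\<forall>i\<in>I. poly p (t i) = v i)"
    by blast
qed (use interp_poly_unique[OF assms(1,2)] in blast)

lemma
  assumes "finite I" "inj_on t I" "I \<noteq> {}"
  shows degree_interp_poly: "degree (interp_poly t v I) < card I"
    and poly_interp_poly: "i \<in> I \<Longrightarrow> poly (interp_poly t v I) (t i) = v i"
  using theI'[OF ex1_interp_poly[OF assms, of v]] unfolding interp_poly_def by blast+

lemma interp_poly_eqI: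
  assumes "finite I" "inj_on t I" "I \<noteq> {}"
    and "degree p < card I" "\<And>i. i \<in> I \<Longrightarrow> poly p (t i) = v i"
  shows "interp_poly t v I = p"
  by (rule interp_poly_unique[of I t _ v])
    (use assms degree_interp_poly[of I t v] poly_interp_poly[of I t] in auto)


lemma pderiv_sum': "pderiv (\<Sum>x\<in>A. f x) = (\<Sum>x\<in>A. pderiv (f x))"
  by (induction A rule: infinite_finite_induct) (auto simp: pderiv_add)


section \<open>The Alikhanov discrete derivative\<close>

definition t_star :: "real \<Rightarrow> (nat \<Rightarrow> real) \<Rightarrow> nat \<Rightarrow> real" where
  "t_star \<sigma> t n = t n - (1 - \<sigma>) * (t n - t (n - 1))"

text \<open>At the singular endpoint \<open>s = t_star \<sigma> t n\<close> the kernel \<open>powr\<close> evaluates to \<open>0\<close>,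
  which does not affect the integral.\<close>

definition alikhanov_deriv ::
    "real \<Rightarrow> real \<Rightarrow> (nat \<Rightarrow> real) \<Rightarrow> (nat \<Rightarrow> real) \<Rightarrow> nat \<Rightarrow> real" where
  "alikhanov_deriv \<beta> \<sigma> t v n = 1 / Gamma (1 - \<beta>) *
     ((\<Sum>k=1..n-1. integral {t (k - 1)..t k}
          (\<lambda>s. (t_star \<sigma> t n - s) powr (-\<beta>) * poly (pderiv (interp_poly t v {k-1, k, k+1})) s))
      + integral {t (n - 1)..t_star \<sigma> t n}
          (\<lambda>s. (t_star \<sigma> t n - s) powr (-\<beta>) * poly (pderiv (interp_poly t v {n-1, n})) s))"

text \<open>The identity that defines the coefficients; only \<open>g n k\<close> with \<open>1 \<le> k \<le> n \<le> N\<close> matter,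
  and these exist and are unique on a strictly increasing mesh
  (\<open>ex_alikhanov_coeffs\<close>, \<open>alikhanov_coeffs_unique\<close>).\<close>

definition alikhanov_coeffs ::
    "real \<Rightarrow> real \<Rightarrow> (nat \<Rightarrow> real) \<Rightarrow> nat \<Rightarrow> (nat \<Rightarrow> nat \<Rightarrow> real) \<Rightarrow> bool" where
  "alikhanov_coeffs \<beta> \<sigma> t N g \<longleftrightarrow>
     (\<forall>n\<in>{1..N}. \<forall>v. alikhanov_deriv \<beta> \<sigma> t v n = (\<Sum>k=1..n. g n k * (v k - v (k - 1))))"

definition property_P1 :: "nat \<Rightarrow> (nat \<Rightarrow> nat \<Rightarrow> real) \<Rightarrow> bool" where
  "property_P1 N g \<longleftrightarrow>
     (\<forall>n k. 1 \<le> k \<and> k \<le> n - 1 \<and> n - 1 \<le> N - 1 \<longrightarrow> g n (k + 1) > g n k \<and> g n k > 0)"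

lemma alikhanov_coeffs_unique:
  assumes "alikhanov_coeffs \<beta> \<sigma> t N g" "alikhanov_coeffs \<beta> \<sigma> t N h"
    and "1 \<le> k" "k \<le> n" "n \<le> N"
  shows "g n k = h n k"
proof -
  define v :: "nat \<Rightarrow> real" where "v j = (if k \<le> j then 1 else 0)" for j
  have *: "(\<Sum>i=1..n. f n i * (v i - v (i - 1))) = f n k" for f :: "nat \<Rightarrow> nat \<Rightarrow> real"
  proof -
    have "(\<Sum>i=1..n. f n i * (v i - v (i - 1))) = (\<Sum>i=1..n. if i = k then f n k else 0)"
      by (rule sum.cong) (use assms(3) in \<open>auto simp: v_def\<close>)
    thus ?thesis using assms by simp
  qed
  have "n \<in> {1..N}" using assms by auto
  thus ?thesis
    using assms(1,2) *[of g] *[of h] unfolding alikhanov_coeffs_def by metis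
qed

lemma ex_alikhanov_coeffs:
  assumes \<beta>: "0 < \<beta>" "\<beta> < 1" and \<sigma>: "0 < \<sigma>" "\<sigma> \<le> 1"
    and mono: "\<And>i j. i < j \<Longrightarrow> j \<le> N \<Longrightarrow> t i < t j"
  shows "\<exists>g. alikhanov_coeffs \<beta> \<sigma> t N g"
proof
  define S :: "nat \<Rightarrow> nat \<Rightarrow> real" where "S k j = (if k \<le> j then 1 else 0)" for k j
  show "alikhanov_coeffs \<beta> \<sigma> t N (\<lambda>n k. alikhanov_deriv \<beta> \<sigma> t (S k) n)"
    unfolding alikhanov_coeffs_def
  proof (intro ballI allI)
    fix n :: nat and v :: "nat \<Rightarrow> real"
    assume n: "n \<in> {1..N}"
    define d where "d k = v k - v (k - 1)" for k
    define K where "K s = (t_star \<sigma> t n - s) powr (-\<beta>)" for s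
    have inj: "inj_on t {..N}"
      using mono by (intro linorder_inj_onI) (auto, metis less_irrefl)
    have v_eq: "v j = v 0 + (\<Sum>k=1..n. d k * S k j)" if "j \<le> n" for j
    proof -
      have "(\<Sum>k=1..n. d k * S k j) = (\<Sum>k=1..j. d k)"
        by (rule sum.mono_neutral_cong_right) (use that in \<open>auto simp: S_def\<close>)
      also have "\<dots> = v j - v 0"
        by (induction j) (auto simp: d_def)
      finally show ?thesis by simp
    qed
    have pd: "pderiv (interp_poly t v I) = (\<Sum>k=1..n. smult (d k) (pderiv (interp_poly t (S k) I)))"
      if I: "I \<subseteq> {..n}" "I \<noteq> {}" for I
    proof -
      have fin: "finite I" using I finite_subset by blast
      have injI: "inj_on t I" using I n by (intro inj_on_subset[OF inj]) auto
      note A = fin injI I(2)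
      have "interp_poly t v I = [:v 0:] + (\<Sum>k=1..n. smult (d k) (interp_poly t (S k) I))"
      proof (rule interp_poly_eqI[OF A])
        have "degree (\<Sum>k=1..n. smult (d k) (interp_poly t (S k) I)) < card I"
          by (rule degree_sum_less)
            (use degree_interp_poly[OF A] A in
              \<open>auto intro: le_less_trans[OF degree_smult_le] simp: card_gt_0_iff\<close>)
        thus "degree ([:v 0:] + (\<Sum>k=1..n. smult (d k) (interp_poly t (S k) I))) < card I"
          by (intro degree_add_less) (use A in \<open>auto simp: card_gt_0_iff\<close>)
      next
        fix i assume i: "i \<in> I"
        thus "poly ([:v 0:] + (\<Sum>k=1..n. smult (d k) (interp_poly t (S k) I))) (t i) = v i"
          using v_eq[of i] I by (auto simp: poly_sum poly_interp_poly[OF A])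
      qed
      thus ?thesis by (simp add: pderiv_add pderiv_sum' pderiv_smult pderiv_pCons)
    qed
    have lin: "integral {a..b} (\<lambda>s. K s * poly (pderiv (interp_poly t v I)) s) =
        (\<Sum>k=1..n. d k * integral {a..b} (\<lambda>s. K s * poly (pderiv (interp_poly t (S k) I)) s))"
      if I: "I \<subseteq> {..n}" "I \<noteq> {}"
        and int: "\<And>k. (\<lambda>s. K s * poly (pderiv (interp_poly t (S k) I)) s) integrable_on {a..b}"
      for a b I
    proof -
      have "(\<lambda>s. K s * poly (pderiv (interp_poly t v I)) s) =
          (\<lambda>s. \<Sum>k=1..n. d k * (K s * poly (pderiv (interp_poly t (S k) I)) s))"
        by (simp add: pd[OF I] poly_sum sum_distrib_left mult_ac)
      thus ?thesis
        using int by (simp add: integral_sum integrable_on_mult_right)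
    qed
    have step: "t (n - 1) < t n"
      using n by (intro mono) auto
    have star: "t (n - 1) < t_star \<sigma> t n"
    proof -
      have "t_star \<sigma> t n - t (n - 1) = \<sigma> * (t n - t (n - 1))"
        by (simp add: t_star_def algebra_simps)
      also have "\<dots> > 0" using \<sigma> step by simp
      finally show ?thesis by simp
    qed
    have int1: "(\<lambda>s. K s * poly q s) integrable_on {t (k - 1)..t k}"
      if k: "k \<in> {1..n-1}" for k q
    proof -
      have "t k \<le> t (n - 1)"
        using mono[of k "n - 1"] k n by (cases "k = n - 1") (auto intro!: less_imp_le)
      hence "continuous_on {t (k - 1)..t k} (\<lambda>s. K s * poly q s)"
        unfolding K_def using star by (intro continuous_intros) auto
      thus ?thesis by (rule integrable_continuous_real)
    qed
    have intK: "K integrable_on {t (n - 1)..t_star \<sigma> t n}"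
    proof -
      have "(\<lambda>x. x powr (-\<beta>)) integrable_on {0..t_star \<sigma> t n - t (n - 1)}"
        using \<beta> star by (intro integrable_on_powr_from_0) auto
      hence "(\<lambda>x. x powr (-\<beta>)) integrable_on cbox 0 (t_star \<sigma> t n - t (n - 1))"
        by simp
      from integrable_affinity[OF this, of "-1" "t_star \<sigma> t n"]
      show ?thesis unfolding K_def using star by simp
    qed
    have int2: "(\<lambda>s. K s * poly (pderiv (interp_poly t w {n-1, n})) s)
        integrable_on {t (n - 1)..t_star \<sigma> t n}" for w
    proof -
      have "inj_on t {n-1, n}" using n by (intro inj_on_subset[OF inj]) auto
      moreover have "card {n-1, n} = 2" using step by (subst card_2_iff) (metis less_irrefl)
      ultimately have "degree (interp_poly t w {n-1, n}) < 2"
        using degree_interp_poly[of "{n-1, n}" t w] by simp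
      hence "degree (pderiv (interp_poly t w {n-1, n})) = 0"
        by (simp add: degree_pderiv)
      then obtain c where "pderiv (interp_poly t w {n-1, n}) = [:c:]"
        using degree_eq_zeroE by blast
      thus ?thesis
        using intK by (simp add: integrable_on_mult_left)
    qed
    have sub: "{k-1, k, k+1} \<subseteq> {..n}" if "k \<in> {1..n-1}" for k using that by auto
    define J where "J k w = integral {t (k - 1)..t k}
          (\<lambda>s. K s * poly (pderiv (interp_poly t w {k-1, k, k+1})) s)" for k w
    define J' where "J' w = integral {t (n - 1)..t_star \<sigma> t n}
          (\<lambda>s. K s * poly (pderiv (interp_poly t w {n-1, n})) s)" for w
    have D: "alikhanov_deriv \<beta> \<sigma> t w n = 1 / Gamma (1 - \<beta>) * ((\<Sum>k=1..n-1. J k w) + J' w)" for w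
      unfolding alikhanov_deriv_def J_def J'_def K_def ..
    have J: "J k v = (\<Sum>i=1..n. d i * J k (S i))" if k: "k \<in> {1..n-1}" for k
      unfolding J_def by (rule lin) (use k sub int1 in auto)
    have J': "J' v = (\<Sum>i=1..n. d i * J' (S i))"
      unfolding J'_def by (rule lin) (use int2 in auto)
    have "(\<Sum>k=1..n-1. J k v) = (\<Sum>k=1..n-1. \<Sum>i=1..n. d i * J k (S i))"
      using J by (intro sum.cong) auto
    also have "\<dots> = (\<Sum>i=1..n. d i * (\<Sum>k=1..n-1. J k (S i)))"
      by (subst sum.swap) (simp add: sum_distrib_left)
    finally have "(\<Sum>k=1..n-1. J k v) + J' v = (\<Sum>i=1..n. d i * ((\<Sum>k=1..n-1. J k (S i)) + J' (S i)))"
      by (simp add: J' sum.distrib algebra_simps)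
    thus "alikhanov_deriv \<beta> \<sigma> t v n =
        (\<Sum>k=1..n. alikhanov_deriv \<beta> \<sigma> t (S k) n * (v k - v (k - 1)))"
      unfolding D by (simp add: sum_distrib_left d_def mult_ac)
  qed
qed


section \<open>Quasi-graded meshes\<close>

text \<open>In a family \<open>t\<close> of meshes, \<open>t N n\<close> is the \<open>n\<close>-th point of the mesh with \<open>N\<close> steps, and
  sequences attached to it are extended arbitrarily beyond index \<open>N\<close>.\<close>

definition unif_equiv :: "(nat \<Rightarrow> nat \<Rightarrow> real) \<Rightarrow> (nat \<Rightarrow> nat \<Rightarrow> real) \<Rightarrow> bool" where
  "unif_equiv a b \<longleftrightarrow>
     (\<exists>c>0. \<exists>C>0. \<forall>N\<ge>1. \<forall>n\<in>{1..N}. c \<le> a N n / b N n \<and> a N n / b N n \<le> C)"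

definition mesh_family :: "real \<Rightarrow> (nat \<Rightarrow> nat \<Rightarrow> real) \<Rightarrow> bool" where
  "mesh_family T t \<longleftrightarrow>
     (\<forall>N\<ge>1. t N 0 = 0 \<and> t N N = T \<and> (\<forall>n\<in>{1..N}. t N (n - 1) < t N n))"

definition quasi_graded :: "real \<Rightarrow> (nat \<Rightarrow> nat \<Rightarrow> real) \<Rightarrow> bool" where
  "quasi_graded r t \<longleftrightarrow>
     (let \<tau> = (\<lambda>N n. t N n - t N (n - 1)) in
        unif_equiv (\<lambda>N n. \<tau> N 1) (\<lambda>N n. real N powr (-r)) \<and>
        unif_equiv t (\<lambda>N n. \<tau> N 1 * real n powr r) \<and>
        unif_equiv \<tau> (\<lambda>N n. \<tau> N 1 powr (1 / r) * t N n powr (1 - 1 / r)))"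

definition max_step :: "(nat \<Rightarrow> real) \<Rightarrow> nat \<Rightarrow> real" where
  "max_step t N = Max ((\<lambda>n. t n - t (n - 1)) ` {1..N})"


section \<open>The majorant\<close>

definition M_fac :: "real \<Rightarrow> real \<Rightarrow> real \<Rightarrow> real" where
  "M_fac \<gamma> \<tau>\<^sub>1 s = (if \<gamma> = 0 then 1 + ln (s / \<tau>\<^sub>1) else 1)"

definition V_bound :: "real \<Rightarrow> (nat \<Rightarrow> real) \<Rightarrow> nat \<Rightarrow> real \<Rightarrow> real" where
  "V_bound \<beta> t j \<gamma> = (let \<tau>\<^sub>1 = t 1 - t 0 in
     M_fac \<gamma> \<tau>\<^sub>1 (t j) * \<tau>\<^sub>1 * t j powr (\<beta> - 1) * (\<tau>\<^sub>1 / t j) powr min 0 \<gamma>)"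

end

theory Submission
  imports Defs
begin

text \<open>Since the coefficients \<open>g n k\<close> are positive and increase with \<open>k\<close>, the equation
\<open>D w n = f n\<close>, \<open>w 0 = 0\<close> can be solved step by step, and its solution depends monotonically on
\<open>f\<close> (\<open>comparison\<close>). The theorem therefore reduces to the construction of supersolutions.

\<^emph>\<open>The operator without lower-order terms.\<close> For \<open>\<gamma> > 0\<close> the bound \<open>V\<close> decays like the power
\<open>s powr (\<beta> - 1)\<close>, which the Riemann-Liouville derivative of order \<open>\<beta>\<close> annihilates. If this power is replaced on
\<open>[0, a]\<close> by its secant through the origin, the Caputo derivative of the resulting function at a time
\<open>x > a\<close> is at least a multiple of \<open>a powr \<beta> * x powr (-\<beta> - 1)\<close> (\<open>capped_power_caputo_ge\<close>); this
follows from an explicit antiderivative of \<open>(x - s) powr (-\<beta>) * s powr (\<beta> - 2)\<close>. For the discrete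
operator the kink \<open>a\<close> is placed at a mesh point \<open>t p\<close>. To the right of the kink the function is
convex, so the quadratic correction terms of the discrete derivative are nonnegative there, and there
remain a consistency error of piecewise linear interpolation and one correction term at the kink. On
a quasi-graded mesh \<open>step k\<close> is comparable to \<open>t k / k\<close>, and with a small exponent \<open>\<kappa> > 0\<close> the two
together are at most a constant times \<open>p powr (\<beta> - 1) * (t p / t n) powr \<kappa> / t n\<close>
(\<open>D_barrier_after\<close>). This may decay more slowly in \<open>n\<close> than the positive main term, so the barrier
alone is no supersolution, but the factor \<open>p powr (\<beta> - 1)\<close> is small for large \<open>p\<close>.

Let \<open>green p\<close> be the discrete solution whose right-hand side is the main term
\<open>t p powr \<beta> * t n powr (-\<beta> - 1)\<close> for \<open>n \<ge> p\<close> and zero before. The error is dominated by a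
superposition of such right-hand sides with kinks \<open>q > p\<close> and summable weights. Hence the best
constant \<open>M\<close> in \<open>green p j \<le> M * t j powr (\<beta> - 1)\<close> for \<open>p\<close> beyond some index satisfies
\<open>M \<le> c + \<epsilon> * M\<close> with a small \<open>\<epsilon>\<close>, and so it is bounded independently of the mesh
(\<open>green_le_late\<close>); the finitely many smaller \<open>p\<close> are then covered by a single barrier
(\<open>green_le\<close>). Any slowly varying right-hand side \<open>f\<close> is dominated by a superposition of the
functions \<open>green q\<close> with weights proportional to \<open>step q * f q\<close> (\<open>D_superposition_ge\<close>). So the
solution at step \<open>j\<close> is at most a constant times \<open>(\<Sum>q=1..j. step q * f q) * t j powr (\<beta> - 1)\<close>, and
for \<open>f q = (t 1 / t q) powr (\<gamma> + 1)\<close> the sum produces the three cases of \<open>V\<close>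
(\<open>sum_source_le\<close>).

\<^emph>\<open>The lower-order terms.\<close> For a large \<open>\<mu>\<close> put
\<open>\<Phi> k = t k powr (\<beta> - 1) + \<mu> powr (1 - \<beta>) * exp (\<mu> * t k)\<close>. The discrete solution operator maps \<open>\<Phi>\<close>
to something below a constant times \<open>\<mu> powr (-\<beta>) * \<Phi>\<close>: up to time \<open>1 / \<mu>\<close> the function \<open>\<Phi>\<close> is
comparable to its first summand, and integrating a power over a short time gains \<open>\<mu> powr (-\<beta>)\<close>;
later it is comparable to its second summand, and \<open>D\<close> multiplies the exponential by at least
a constant times \<open>\<mu> powr \<beta>\<close> as soon as all steps are below \<open>1 / \<mu>\<close>. This is where the mesh has to be
fine. For large \<open>\<mu>\<close> the lower-order terms can thus be absorbed in the weighted norm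
\<open>max (v k / \<Phi> k)\<close> (\<open>stability\<close>), and on \<open>[0, T]\<close> the function \<open>\<Phi>\<close> is comparable to its first
summand.\<close>

section \<open>The discrete derivative in terms of slopes\<close>

lemma pderiv_newton_quadratic:
  fixes t v :: "nat \<Rightarrow> real"
  assumes "t i < t j" "t j < t l"
  shows "poly (pderiv (interp_poly t v {i, j, l})) s =
    (v j - v i) / (t j - t i)
    + ((v l - v j) / (t l - t j) - (v j - v i) / (t j - t i)) / (t l - t i) * (2 * s - t i - t j)"
proof -
  define a where "a = (v j - v i) / (t j - t i)"
  define c where "c = ((v l - v j) / (t l - t j) - a) / (t l - t i)"
  define p where "p = [:v i:] + smult a [:- t i, 1:] + smult c ([:- t i, 1:] * [:- t j, 1:])"
  have ne: "i \<noteq> j" "j \<noteq> l" "i \<noteq> l"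
    using assms by auto
  have "interp_poly t v {i, j, l} = p"
  proof (rule interp_poly_eqI)
    show "inj_on t {i, j, l}"
      using assms by (auto simp: inj_on_def)
    have "degree p \<le> 2"
      unfolding p_def
      by (intro degree_add_le order_trans[OF degree_smult_le] order_trans[OF degree_mult_le]) auto
    thus "degree p < card {i, j, l}"
      using ne by simp
  next
    fix m assume "m \<in> {i, j, l}"
    moreover have "c * (t l - t i) = (v l - v j) / (t l - t j) - a"
      using assms by (simp add: c_def)
    hence "c * (t l - t i) * (t l - t j) = v l - v j - a * (t l - t j)"
      using assms by (simp add: field_simps)
    moreover have "a * (t j - t i) = v j - v i"
      using assms by (simp add: a_def)
    ultimately show "poly p (t m) = v m"
      by (auto simp: p_def algebra_simps)
  qed auto
  thus ?thesis
    by (simp add: p_def a_def[symmetric] c_def[symmetric] pderiv_add pderiv_smult pderiv_mult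
        pderiv_pCons algebra_simps)
qed

lemma pderiv_newton_linear:
  fixes t v :: "nat \<Rightarrow> real"
  assumes "t i < t j"
  shows "poly (pderiv (interp_poly t v {i, j})) s = (v j - v i) / (t j - t i)"
proof -
  define a where "a = (v j - v i) / (t j - t i)"
  define p where "p = [:v i:] + smult a [:- t i, 1:]"
  have ne: "i \<noteq> j"
    using assms by auto
  have "interp_poly t v {i, j} = p"
  proof (rule interp_poly_eqI)
    show "inj_on t {i, j}"
      using assms by (auto simp: inj_on_def)
    have "degree p \<le> 1"
      unfolding p_def
      by (intro degree_add_le order_trans[OF degree_smult_le]) auto
    thus "degree p < card {i, j}"
      using ne by simp
  next
    fix m assume "m \<in> {i, j}"
    moreover have "a * (t j - t i) = v j - v i"
      using assms by (simp add: a_def)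
    ultimately show "poly p (t m) = v m"
      by (auto simp: p_def algebra_simps)
  qed auto
  thus ?thesis
    by (simp add: p_def a_def[symmetric] pderiv_add pderiv_smult pderiv_pCons)
qed

lemma has_integral_kernel:
  fixes \<beta> x a b :: real
  assumes "\<beta> < 1" "a \<le> b" "b \<le> x"
  shows "((\<lambda>s. (x - s) powr (-\<beta>)) has_integral
    ((x - a) powr (1 - \<beta>) - (x - b) powr (1 - \<beta>)) / (1 - \<beta>)) {a..b}"
proof -
  have "((\<lambda>s. (x - s) powr (-\<beta>)) has_integral
     (- ((x - b) powr (1 - \<beta>) / (1 - \<beta>)) - - ((x - a) powr (1 - \<beta>) / (1 - \<beta>)))) {a..b}"
  proof (rule fundamental_theorem_of_calculus_interior)
    show "continuous_on {a..b} (\<lambda>s. - ((x - s) powr (1 - \<beta>) / (1 - \<beta>)))"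
      using assms by (intro continuous_intros continuous_on_powr') auto
    fix s assume "s \<in> {a<..<b}"
    thus "((\<lambda>s. - ((x - s) powr (1 - \<beta>) / (1 - \<beta>))) has_vector_derivative (x - s) powr (- \<beta>)) (at s)"
      unfolding has_real_derivative_iff_has_vector_derivative[symmetric]
      using assms by (auto intro!: derivative_eq_intros)
  qed (use assms in auto)
  thus ?thesis
    by (simp add: diff_divide_distrib)
qed

lemma kernel_mono:
  fixes x :: real
  assumes "\<beta> > 0" "s \<le> s'" "s' < x"
  shows "(x - s) powr (-\<beta>) \<le> (x - s') powr (-\<beta>)"
  using assms by (intro powr_mono2') auto

text \<open>Subtracting the constant \<open>k a\<close> from the monotone weight does not change the integral, since \<open>\<phi>\<close>
has mean zero, and leaves a weight between \<open>0\<close> and \<open>k b - k a\<close>. The interpolation errors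
are estimated in this form because the weights \<open>k b - k a\<close> telescope over neighbouring intervals.\<close>

lemma integral_nondecreasing_mean_zero_abs_le:
  fixes k \<phi> :: "real \<Rightarrow> real"
  assumes "a \<le> b"
    and mono: "\<And>s. s \<in> {a..b} \<Longrightarrow> k a \<le> k s \<and> k s \<le> k b"
    and bd: "\<And>s. s \<in> {a..b} \<Longrightarrow> \<bar>\<phi> s\<bar> \<le> E"
    and zero: "(\<phi> has_integral 0) {a..b}"
    and int: "(\<lambda>s. k s * \<phi> s) integrable_on {a..b}"
  shows "\<bar>integral {a..b} (\<lambda>s. k s * \<phi> s)\<bar> \<le> (b - a) * E * (k b - k a)"
proof -
  have "((\<lambda>s. k s * \<phi> s - k a * \<phi> s) has_integral integral {a..b} (\<lambda>s. k s * \<phi> s) - k a * 0) {a..b}"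
    by (intro has_integral_diff has_integral_mult_right integrable_integral int zero)
  hence *: "((\<lambda>s. (k s - k a) * \<phi> s) has_integral integral {a..b} (\<lambda>s. k s * \<phi> s)) {a..b}"
    by (simp add: algebra_simps)
  have E: "0 \<le> E"
    using bd[of a] assms(1) by auto
  have "norm (integral {a..b} (\<lambda>s. (k s - k a) * \<phi> s)) \<le> integral {a..b} (\<lambda>s. (k b - k a) * E)"
  proof (rule integral_norm_bound_integral)
    fix s assume s: "s \<in> {a..b}"
    show "norm ((k s - k a) * \<phi> s) \<le> (k b - k a) * E"
      unfolding real_norm_def abs_mult
      by (rule mult_mono) (use mono[OF s] bd[OF s] E in auto)
  qed (use * in auto)
  thus ?thesis
    using integral_unique[OF *] assms(1) by (simp add: mult_ac)
qed

locale alikhanov_mesh =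
  fixes \<beta> \<sigma> :: real and N :: nat and t :: "nat \<Rightarrow> real" and g :: "nat \<Rightarrow> nat \<Rightarrow> real"
  assumes \<beta>_pos: "0 < \<beta>" and \<beta>_less_1: "\<beta> < 1"
    and \<sigma>_ge: "1 / 2 \<le> \<sigma>" and \<sigma>_le: "\<sigma> \<le> 1"
    and t_0 [simp]: "t 0 = 0"
    and t_incr: "\<And>n. n \<in> {1..N} \<Longrightarrow> t (n - 1) < t n"
    and coeffs: "alikhanov_coeffs \<beta> \<sigma> t N g"
    and P1: "property_P1 N g"
begin

abbreviation step :: "nat \<Rightarrow> real" where "step k \<equiv> t k - t (k - 1)"

abbreviation slope :: "(nat \<Rightarrow> real) \<Rightarrow> nat \<Rightarrow> real" where
  "slope v k \<equiv> (v k - v (k - 1)) / step k"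

abbreviation D :: "(nat \<Rightarrow> real) \<Rightarrow> nat \<Rightarrow> real" where
  "D v n \<equiv> alikhanov_deriv \<beta> \<sigma> t v n"

abbreviation ts :: "nat \<Rightarrow> real" where "ts n \<equiv> t_star \<sigma> t n"

abbreviation ker :: "nat \<Rightarrow> real \<Rightarrow> real" where "ker n s \<equiv> (ts n - s) powr (-\<beta>)"

text \<open>The last interval ends at \<open>ts n\<close> and not at \<open>t n\<close>.\<close>

definition ker_int :: "nat \<Rightarrow> nat \<Rightarrow> real" where
  "ker_int n k = integral {t (k - 1)..(if k = n then ts n else t k)} (ker n)"

text \<open>The weight with which a jump of the slope at \<open>t k\<close> enters the discrete derivative; it comes from
the second-order term of the quadratic interpolant in Newton form.\<close>

definition ker_moment :: "nat \<Rightarrow> nat \<Rightarrow> real" where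
  "ker_moment n k = integral {t (k - 1)..t k} (\<lambda>s. ker n s * (2 * s - t (k - 1) - t k))
     / (t (k + 1) - t (k - 1))"

lemma t_less: "i < j \<Longrightarrow> j \<le> N \<Longrightarrow> t i < t j"
proof (induction j)
  case (Suc j)
  thus ?case
    using t_incr[of "Suc j"] by (cases "i = j") auto
qed auto

lemma t_le: "i \<le> j \<Longrightarrow> j \<le> N \<Longrightarrow> t i \<le> t j"
  using t_less[of i j] by (cases "i = j") auto

lemma t_pos: "1 \<le> j \<Longrightarrow> j \<le> N \<Longrightarrow> 0 < t j"
  using t_less[of 0 j] by auto

lemma t_less_iff: "i \<le> N \<Longrightarrow> j \<le> N \<Longrightarrow> t i < t j \<longleftrightarrow> i < j"
  using t_less[of i j] t_le[of j i] by (cases "i < j") auto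

lemma step_pos: "n \<in> {1..N} \<Longrightarrow> 0 < step n"
  using t_incr by auto

lemma ts_eq: "ts n = t (n - 1) + \<sigma> * step n"
  by (simp add: t_star_def algebra_simps)

lemma ts_gt: "n \<in> {1..N} \<Longrightarrow> t (n - 1) < ts n"
  unfolding ts_eq using \<sigma>_ge step_pos[of n] by (simp add: mult_pos_pos)

lemma ts_le: "n \<in> {1..N} \<Longrightarrow> ts n \<le> t n"
proof -
  assume "n \<in> {1..N}"
  hence "\<sigma> * step n \<le> 1 * step n"
    using \<sigma>_le step_pos[of n] by (intro mult_right_mono) auto
  thus ?thesis
    unfolding ts_eq by simp
qed

lemma ts_ge_half: "n \<in> {1..N} \<Longrightarrow> t n / 2 \<le> ts n"
proof -
  assume n: "n \<in> {1..N}"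
  have "1 / 2 * step n \<le> \<sigma> * step n"
    using \<sigma>_ge step_pos[OF n] by (intro mult_right_mono) auto
  moreover have "0 \<le> t (n - 1)"
    using t_le[of 0 "n - 1"] n by auto
  ultimately show ?thesis
    unfolding ts_eq by simp
qed

lemma ker_integrable:
  assumes "n \<in> {1..N}" "a \<le> b" "b \<le> ts n"
  shows "ker n integrable_on {a..b}"
  using has_integral_kernel[of \<beta> a b "ts n"] assms \<beta>_less_1 by auto

lemma ker_times_continuous_integrable:
  assumes "n \<in> {1..N}" "b < ts n" "continuous_on {a..b} f"
  shows "(\<lambda>s. ker n s * f s) integrable_on {a..b}"
  using assms by (intro integrable_continuous_real continuous_intros) auto

lemma Gamma_pos: "0 < Gamma (1 - \<beta>)"
  using \<beta>_less_1 by (intro Gamma_real_pos) auto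

lemma t_before_ts: "n \<in> {1..N} \<Longrightarrow> k \<le> n - 1 \<Longrightarrow> t k < ts n"
  using t_le[of k "n - 1"] ts_gt[of n] by fastforce

text \<open>The discrete derivative is that of the piecewise linear interpolant plus corrections proportional to
the jumps of its slope. For convex data the corrections are nonnegative and can be dropped.\<close>

lemma D_eq:
  assumes n: "n \<in> {1..N}"
  shows "Gamma (1 - \<beta>) * D v n =
    (\<Sum>k=1..n. ker_int n k * slope v k)
    + (\<Sum>k=1..n-1. ker_moment n k * (slope v (k + 1) - slope v k))"
proof -
  have inner: "integral {t (k - 1)..t k}
      (\<lambda>s. ker n s * poly (pderiv (interp_poly t v {k-1, k, k+1})) s)
    = ker_int n k * slope v k + ker_moment n k * (slope v (k + 1) - slope v k)"
    if k: "k \<in> {1..n-1}" for k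
  proof -
    have less: "t (k - 1) < t k" "t k < t (k + 1)"
      using k n by (auto intro!: t_less)
    define c where "c = (slope v (k + 1) - slope v k) / (t (k + 1) - t (k - 1))"
    have "(\<lambda>s. ker n s * poly (pderiv (interp_poly t v {k-1, k, k+1})) s) =
        (\<lambda>s. ker n s * slope v k + ker n s * (2 * s - t (k - 1) - t k) * c)"
      using less k by (subst pderiv_newton_quadratic) (auto simp: c_def distrib_left mult_ac)
    moreover have "t k < ts n"
      using t_before_ts[OF n] k by auto
    hence "(\<lambda>s. ker n s * slope v k) integrable_on {t (k - 1)..t k}"
      "(\<lambda>s. ker n s * (2 * s - t (k - 1) - t k) * c) integrable_on {t (k - 1)..t k}"
      using n less by (intro integrable_on_mult_left ker_integrable
          ker_times_continuous_integrable continuous_intros; simp)+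
    ultimately have "integral {t (k - 1)..t k}
        (\<lambda>s. ker n s * poly (pderiv (interp_poly t v {k-1, k, k+1})) s)
      = integral {t (k - 1)..t k} (\<lambda>s. ker n s * slope v k)
        + integral {t (k - 1)..t k} (\<lambda>s. ker n s * (2 * s - t (k - 1) - t k) * c)"
      by (simp only: integral_add)
    also have "\<dots> = integral {t (k - 1)..t k} (ker n) * slope v k
        + integral {t (k - 1)..t k} (\<lambda>s. ker n s * (2 * s - t (k - 1) - t k)) * c"
      by (simp only: integral_mult_left)
    finally show ?thesis
      using k by (auto simp: c_def ker_int_def ker_moment_def)
  qed
  have "integral {t (n - 1)..ts n} (\<lambda>s. ker n s * poly (pderiv (interp_poly t v {n-1, n})) s)
      = ker_int n n * slope v n"
    using pderiv_newton_linear[of t "n-1" n v] t_incr[OF n] by (simp add: ker_int_def)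
  moreover have "(\<Sum>k=1..n. ker_int n k * slope v k)
      = (\<Sum>k=1..n-1. ker_int n k * slope v k) + ker_int n n * slope v n"
    using n by (cases n) auto
  ultimately show ?thesis
    unfolding alikhanov_deriv_def using inner Gamma_pos by (simp add: sum.distrib)
qed

text \<open>The kernel increases, and the moment is taken against a function that is odd about the midpoint of
the interval. The last bound says that the correction never outweighs the part of \<open>ker_int\<close> that
exceeds the value of the kernel at the left end, which makes a lower bound for \<open>g\<close> possible.\<close>

lemma ker_moment_bounds:
  assumes n: "n \<in> {1..N}" and k: "k \<in> {1..n-1}"
  shows "0 \<le> ker_moment n k" "ker_moment n k \<le> step k * (ker n (t k) - ker n (t (k - 1)))"
    "ker_moment n k \<le> ker_int n k - step k * ker n (t (k - 1))"
proof -
  define a b d where "a = t (k - 1)" and "b = t k" and "d = t (k + 1) - t (k - 1)"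
  have ab: "a < b" and d: "b - a \<le> d" and b: "b < ts n"
    using k n t_before_ts[OF n] t_less[of "k-1" k] t_le[of "k" "k+1"]
    by (auto simp: a_def b_def d_def)
  have mono: "ker n a \<le> ker n s \<and> ker n s \<le> ker n b" if "s \<in> {a..b}" for s
    using that b \<beta>_pos by (auto intro!: kernel_mono)
  have int: "(\<lambda>s. ker n s * (2 * s - a - b)) integrable_on {a..b}"
    by (rule ker_times_continuous_integrable[OF n b]) (intro continuous_intros)
  have "((\<lambda>s. 2 * s - a - b) has_integral ((b\<^sup>2 - a * b - b * b) - (a\<^sup>2 - a * a - b * a))) {a..b}"
    using ab
    by (intro fundamental_theorem_of_calculus)
       (auto intro!: derivative_eq_intros simp: has_real_derivative_iff_has_vector_derivative[symmetric])
  hence zero: "((\<lambda>s. 2 * s - a - b) has_integral 0) {a..b}"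
    by (simp add: algebra_simps power2_eq_square)
  define I where "I = integral {a..b} (\<lambda>s. ker n s * (2 * s - a - b))"
  have I: "ker_moment n k = I / d"
    by (simp add: ker_moment_def I_def a_def b_def d_def)
  have "((\<lambda>s. ker n s * (2 * s - a - b) - ker n ((a + b) / 2) * (2 * s - a - b))
      has_integral I - ker n ((a + b) / 2) * 0) {a..b}"
    unfolding I_def by (intro has_integral_diff has_integral_mult_right integrable_integral int zero)
  moreover have "0 \<le> ker n s * (2 * s - a - b) - ker n ((a + b) / 2) * (2 * s - a - b)"
    if "s \<in> {a..b}" for s
  proof -
    have "0 \<le> (ker n s - ker n ((a + b) / 2)) * (2 * s - a - b)"
    proof (cases "s \<le> (a + b) / 2")
      case True
      thus ?thesis
        using b ab \<beta>_pos that by (intro mult_nonpos_nonpos) (auto intro!: kernel_mono)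
    next
      case False
      thus ?thesis
        using b ab \<beta>_pos that by (intro mult_nonneg_nonneg) (auto intro!: kernel_mono)
    qed
    thus ?thesis by (simp add: algebra_simps)
  qed
  ultimately have I0: "0 \<le> I"
    by (auto dest: has_integral_nonneg)
  thus "0 \<le> ker_moment n k"
    using ab d by (simp add: I)
  have "\<bar>I\<bar> \<le> (b - a) * (b - a) * (ker n b - ker n a)"
    unfolding I_def
    by (rule integral_nondecreasing_mean_zero_abs_le) (use ab mono zero int in auto)
  hence "I / d \<le> (b - a) * (b - a) * (ker n b - ker n a) / (b - a)"
    using ab d I0 mono[of b]
    by (intro order_trans[OF divide_right_mono[of I] divide_left_mono]) (auto intro!: mult_nonneg_nonneg)
  thus "ker_moment n k \<le> step k * (ker n (t k) - ker n (t (k - 1)))"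
    using ab by (simp add: I a_def b_def)
  have "((\<lambda>s. ker n s * (1 - (2 * s - a - b) / (b - a))) has_integral
        integral {a..b} (ker n) - I / (b - a)) {a..b}"
  proof -
    have "((\<lambda>s. ker n s - ker n s * (2 * s - a - b) / (b - a)) has_integral
        integral {a..b} (ker n) - I / (b - a)) {a..b}"
      unfolding I_def
      by (intro has_integral_diff integrable_integral has_integral_divide int ker_integrable n)
         (use ab b in auto)
    thus ?thesis by (simp add: algebra_simps)
  qed
  moreover have "((\<lambda>s. ker n a * (1 - (2 * s - a - b) / (b - a))) has_integral
        ker n a * ((b - a) - 0 / (b - a))) {a..b}"
    using ab has_integral_const_real[of "1::real" a b]
    by (intro has_integral_mult_right has_integral_diff has_integral_divide zero) auto
  ultimately have "ker n a * (b - a) \<le> integral {a..b} (ker n) - I / (b - a)"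
  proof (rule_tac has_integral_le[rotated])
    fix s assume s: "s \<in> {a..b}"
    have "(2 * s - a - b) / (b - a) \<le> 1"
      using s ab by simp
    thus "ker n a * (1 - (2 * s - a - b) / (b - a)) \<le> ker n s * (1 - (2 * s - a - b) / (b - a))"
      using mono[OF s] by (intro mult_right_mono) auto
  qed auto
  moreover have "I / d \<le> I / (b - a)"
    using I0 ab d by (intro divide_left_mono) auto
  moreover have "k \<noteq> n"
    using k by auto
  ultimately show "ker_moment n k \<le> ker_int n k - step k * ker n (t (k - 1))"
    by (simp add: I ker_int_def a_def b_def mult.commute)
qed

lemma ker_int_last:
  assumes n: "n \<in> {1..N}"
  shows "ker_int n n = (\<sigma> * step n) powr (1 - \<beta>) / (1 - \<beta>)"
  using has_integral_kernel[of \<beta> "t (n-1)" "ts n" "ts n"] ts_gt[OF n] \<beta>_less_1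
  by (simp add: ker_int_def ts_eq integral_unique)

lemma D_eq_coeffs: "n \<in> {1..N} \<Longrightarrow> D v n = (\<Sum>k=1..n. g n k * (v k - v (k - 1)))"
  using coeffs unfolding alikhanov_coeffs_def by blast

text \<open>Read off from the derivative of the unit step at \<open>k\<close>, whose only nonzero slope is the one on the
\<open>k\<close>-th interval. The factor \<open>2\<close> is caused by the last interval, where \<open>t n\<close> is replaced by \<open>ts n\<close>.\<close>

lemma g_ge:
  assumes n: "n \<in> {1..N}" and k: "k \<in> {1..n}"
  shows "(t n - t (k - 1)) powr (-\<beta>) / (2 * Gamma (1 - \<beta>)) \<le> g n k"
proof -
  define v :: "nat \<Rightarrow> real" where "v j = (if k \<le> j then 1 else 0)" for j
  have v: "v j - v (j - 1) = (if j = k then 1 else 0)" if "1 \<le> j" for j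
    using that k by (auto simp: v_def)
  have "D v n = (\<Sum>j=1..n. if j = k then g n k else 0)"
    unfolding D_eq_coeffs[OF n] using v by (intro sum.cong) auto
  hence "D v n = g n k"
    using k by simp
  hence eq: "Gamma (1 - \<beta>) * g n k = (\<Sum>j=1..n. ker_int n j * slope v j)
    + (\<Sum>j=1..n-1. ker_moment n j * (slope v (j + 1) - slope v j))"
    using D_eq[OF n, of v] by simp
  have s1: "(\<Sum>j=1..n. ker_int n j * slope v j) = (\<Sum>j=1..n. if j = k then ker_int n k / step k else 0)"
    using v by (intro sum.cong) auto
  have pos: "0 < step k"
    using k n by (intro step_pos) auto
  have s2: "(\<Sum>j=1..n-1. ker_moment n j * (slope v (j + 1) - slope v j)) \<ge>
    (\<Sum>j=1..n-1. if j = k then - (ker_moment n k / step k) else 0)"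
  proof (rule sum_mono)
    fix j assume j: "j \<in> {1..n-1}"
    have "0 \<le> ker_moment n j" "0 < step (j + 1)"
      using ker_moment_bounds(1)[OF n j] j n t_less[of j "j + 1"] by auto
    thus "(if j = k then - (ker_moment n k / step k) else 0)
        \<le> ker_moment n j * (slope v (j + 1) - slope v j)"
      using v[of j] v[of "j + 1"] j by auto
  qed
  have st: "(step k) * (t n - t (k - 1)) powr (-\<beta>) / 2 \<le>
      ker_int n k - (if k \<le> n - 1 then ker_moment n k else 0)"
  proof (cases "k \<le> n - 1")
    case True
    hence k': "k \<in> {1..n-1}"
      using k by auto
    have "t (k - 1) < ts n"
      using t_before_ts[OF n, of "k-1"] k' by auto
    hence "(t n - t (k - 1)) powr (-\<beta>) \<le> ker n (t (k - 1))"
      using ts_le[OF n] \<beta>_pos by (intro powr_mono2') auto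
    hence "(step k) * (t n - t (k - 1)) powr (-\<beta>) \<le> step k * ker n (t (k - 1))"
      using pos by (intro mult_left_mono) auto
    moreover have "0 \<le> (step k) * (t n - t (k - 1)) powr (-\<beta>)"
      using pos by auto
    ultimately show ?thesis
      using ker_moment_bounds(3)[OF n k'] True by auto
  next
    case False
    hence [simp]: "k = n"
      using k by auto
    have "step n powr (1 - \<beta>) / 2 \<le> \<sigma> powr (1 - \<beta>) * step n powr (1 - \<beta>) / (1 - \<beta>)"
    proof -
      have "1 / 2 \<le> \<sigma> powr 1"
        using \<sigma>_ge by simp
      also have "\<dots> \<le> \<sigma> powr (1 - \<beta>)"
        using \<sigma>_ge \<sigma>_le \<beta>_pos by (intro powr_mono') auto
      also have "\<dots> \<le> \<sigma> powr (1 - \<beta>) / (1 - \<beta>)"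
        using \<beta>_pos \<beta>_less_1 by (simp add: field_simps mult_left_le)
      finally show ?thesis
        using mult_right_mono[of "1/2" "\<sigma> powr (1 - \<beta>) / (1 - \<beta>)" "step n powr (1 - \<beta>)"] by simp
    qed
    moreover have "step n * step n powr (-\<beta>) = step n powr (1 - \<beta>)"
      using pos powr_add[of "step n" 1 "-\<beta>"] by simp
    ultimately show ?thesis
      using False ker_int_last[OF n] pos \<sigma>_ge by (auto simp: powr_mult)
  qed
  have "Gamma (1 - \<beta>) * g n k \<ge> ker_int n k / step k - (if k \<le> n - 1 then ker_moment n k / step k else 0)"
    using s1 s2 eq k by (auto split: if_splits)
  also have "ker_int n k / step k - (if k \<le> n - 1 then ker_moment n k / step k else 0)
     = (ker_int n k - (if k \<le> n - 1 then ker_moment n k else 0)) / step k"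
    by (simp add: diff_divide_distrib)
  also have "\<dots> \<ge> (step k) * (t n - t (k - 1)) powr (-\<beta>) / 2 / step k"
    using st pos by (intro divide_right_mono) auto
  also have "(step k) * (t n - t (k - 1)) powr (-\<beta>) / 2 / step k = (t n - t (k - 1)) powr (-\<beta>) / 2"
  proof -
    have "x * y / 2 / x = y / 2" if "0 < x" for x y :: real
      using that by simp
    thus ?thesis
      using pos .
  qed
  finally show ?thesis
    using Gamma_pos by (simp add: divide_le_eq mult_ac)
qed

lemma g_pos: "n \<in> {1..N} \<Longrightarrow> k \<in> {1..n} \<Longrightarrow> 0 < g n k"
proof -
  assume n: "n \<in> {1..N}" and k: "k \<in> {1..n}"
  have "t (k - 1) < t n"
    using n k by (intro t_less) auto
  hence "0 < (t n - t (k - 1)) powr (-\<beta>) / (2 * Gamma (1 - \<beta>))"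
    using Gamma_pos by simp
  thus ?thesis
    using g_ge[OF n k] by linarith
qed

lemma g_mono:
  assumes n: "n \<in> {1..N}" and "1 \<le> k" "k \<le> l" "l \<le> n"
  shows "g n k \<le> g n l"
  using assms(3,4)
proof (induction l rule: dec_induct)
  case (step m)
  have "g n m < g n (m + 1)"
  proof -
    have "1 \<le> m \<and> m \<le> n - 1 \<and> n - 1 \<le> N - 1"
      using assms step by auto
    thus ?thesis
      using P1 unfolding property_P1_def by blast
  qed
  thus ?case
    using step by auto
qed auto

end

section \<open>Inequalities for powers\<close>

lemma powr_mean_value:
  fixes x y q :: real
  assumes "0 \<le> x" "x < y" "0 < x \<or> 0 < q"
  obtains z where "x < z" "z < y" "y powr q - x powr q = (y - x) * (q * z powr (q - 1))"
proof -
  have "continuous_on {x..y} (\<lambda>z. z powr q)"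
    using assms by (intro continuous_on_powr' continuous_intros) auto
  moreover have der: "((\<lambda>z. z powr q) has_real_derivative q * z powr (q - 1)) (at z)" if "x < z" for z
    using that assms by (intro has_real_derivative_powr) auto
  ultimately obtain l z where z: "x < z" "z < y" "((\<lambda>z. z powr q) has_real_derivative l) (at z)"
      "y powr q - x powr q = (y - x) * l"
    using MVT[OF assms(2), of "\<lambda>z. z powr q"] real_differentiable_def by blast
  have "l = q * z powr (q - 1)"
    using DERIV_unique[OF z(3) der[OF z(1)]] .
  thus ?thesis
    using that z by blast
qed

lemma powr_diff_ge:
  fixes x y q :: real
  assumes "0 \<le> x" "x < y" "0 < q" "q \<le> 1"
  shows "q * y powr (q - 1) * (y - x) \<le> y powr q - x powr q"
proof -
  obtain z where z: "x < z" "z < y" "y powr q - x powr q = (y - x) * (q * z powr (q - 1))"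
    using powr_mean_value[of x y q] assms by auto
  have "y powr (q - 1) \<le> z powr (q - 1)"
    using z assms by (intro powr_mono2') auto
  thus ?thesis
    unfolding z(3) using assms by (simp add: mult_ac)
qed

lemma powr_diff_neg_ge:
  fixes x y \<kappa> :: real
  assumes "0 < x" "x < y" "0 < \<kappa>"
  shows "\<kappa> * y powr (- \<kappa> - 1) * (y - x) \<le> x powr (-\<kappa>) - y powr (-\<kappa>)"
proof -
  obtain z where z: "x < z" "z < y" "y powr (-\<kappa>) - x powr (-\<kappa>) = (y - x) * (-\<kappa> * z powr (-\<kappa> - 1))"
    using powr_mean_value[of x y "-\<kappa>"] assms by auto
  have "\<kappa> * y powr (- \<kappa> - 1) * (y - x) \<le> \<kappa> * z powr (- \<kappa> - 1) * (y - x)"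
    using z assms by (intro mult_right_mono mult_left_mono powr_mono2') auto
  also have "\<dots> = x powr (-\<kappa>) - y powr (-\<kappa>)"
    using z(3) by (simp add: mult_ac)
  finally show ?thesis .
qed

lemma powr_diff_neg_le:
  fixes x y \<kappa> :: real
  assumes "0 < x" "x < y" "0 < \<kappa>"
  shows "x powr (-\<kappa>) - y powr (-\<kappa>) \<le> \<kappa> * x powr (- \<kappa> - 1) * (y - x)"
proof -
  obtain z where z: "x < z" "z < y" "y powr (-\<kappa>) - x powr (-\<kappa>) = (y - x) * (-\<kappa> * z powr (-\<kappa> - 1))"
    using powr_mean_value[of x y "-\<kappa>"] assms by auto
  have "x powr (-\<kappa>) - y powr (-\<kappa>) = \<kappa> * z powr (- \<kappa> - 1) * (y - x)"
    using z(3) by (simp add: mult_ac)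
  also have "\<dots> \<le> \<kappa> * x powr (- \<kappa> - 1) * (y - x)"
    using z assms by (intro mult_right_mono mult_left_mono powr_mono2') auto
  finally show ?thesis .
qed

lemma diff_div_le_ln:
  fixes x y :: real
  assumes "0 < x" "x < y"
  shows "(y - x) / y \<le> ln y - ln x"
proof -
  have "ln (x / y) \<le> x / y - 1"
    using assms by (intro ln_le_minus_one) auto
  thus ?thesis
    using assms by (simp add: ln_div diff_divide_distrib)
qed

text \<open>The antiderivative is \<open>(x - s) powr (1 - \<beta>) * s powr (\<beta> - 1) / x\<close>, which vanishes at \<open>s = x\<close>.\<close>

lemma has_integral_kernel_powr:
  fixes \<beta> a x :: real
  assumes "\<beta> < 1" "0 < a" "a \<le> x"
  shows "((\<lambda>s. (x - s) powr (-\<beta>) * ((\<beta> - 1) * s powr (\<beta> - 2))) has_integral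
    - (a powr (\<beta> - 1) * (x - a) powr (1 - \<beta>) / x)) {a..x}"
proof -
  have "((\<lambda>s. (x - s) powr (-\<beta>) * ((\<beta> - 1) * s powr (\<beta> - 2))) has_integral
     ((x - x) powr (1 - \<beta>) * x powr (\<beta> - 1) / x - (x - a) powr (1 - \<beta>) * a powr (\<beta> - 1) / x)) {a..x}"
  proof (rule fundamental_theorem_of_calculus_interior)
    show "continuous_on {a..x} (\<lambda>s. (x - s) powr (1 - \<beta>) * s powr (\<beta> - 1) / x)"
      using assms by (intro continuous_intros continuous_on_powr') auto
    fix s assume s: "s \<in> {a<..<x}"
    hence "0 < s" "0 < x - s"
      using assms by auto
    define u w where "u = (x - s) powr (-\<beta>)" and "w = s powr (\<beta> - 2)"
    have u: "(x - s) powr (1 - \<beta>) = u * (x - s)"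
      using powr_add[of "x - s" "-\<beta>" 1] s by (simp add: u_def)
    have w: "s powr (\<beta> - 1) = w * s"
      using powr_add[of s "\<beta> - 2" 1] \<open>0 < s\<close> by (simp add: w_def)
    have "((\<lambda>s. (x - s) powr (1 - \<beta>) * s powr (\<beta> - 1) / x) has_real_derivative
       (((1 - \<beta>) * (x - s) powr (-\<beta>) * - 1) * s powr (\<beta> - 1)
         + (x - s) powr (1 - \<beta>) * ((\<beta> - 1) * s powr (\<beta> - 2))) / x) (at s)"
      using s assms by (auto intro!: derivative_eq_intros)
    moreover have "(((1 - \<beta>) * (x - s) powr (-\<beta>) * - 1) * s powr (\<beta> - 1)
         + (x - s) powr (1 - \<beta>) * ((\<beta> - 1) * s powr (\<beta> - 2))) / x
       = (x - s) powr (-\<beta>) * ((\<beta> - 1) * s powr (\<beta> - 2))"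
      unfolding u w u_def[symmetric] w_def[symmetric]
      using assms by (simp add: field_simps)
    ultimately show "((\<lambda>s. (x - s) powr (1 - \<beta>) * s powr (\<beta> - 1) / x) has_vector_derivative
       (x - s) powr (-\<beta>) * ((\<beta> - 1) * s powr (\<beta> - 2))) (at s)"
      by (simp add: has_real_derivative_iff_has_vector_derivative)
  qed (use assms in auto)
  thus ?thesis
    by (simp add: mult.commute)
qed

text \<open>The right-hand side is, up to the factor \<open>Gamma (1 - \<beta>)\<close>, the Caputo derivative at \<open>x\<close> of the
function that equals \<open>s powr (\<beta> - 1)\<close> for \<open>s \<ge> a\<close> and is linear on \<open>[0, a]\<close> with value zero at
the origin. By concavity of \<open>s powr (1 - \<beta>)\<close> the linear piece contributes at least
\<open>a powr (\<beta> - 1) * x powr (1 - \<beta>) / x\<close>; the other piece cancels the leading part of this, and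
concavity once more bounds the rest.\<close>

lemma capped_power_caputo_ge:
  fixes \<beta> a x :: real
  assumes "0 < \<beta>" "\<beta> < 1" "0 < a" "a \<le> x"
  shows "(1 - \<beta>) * a powr \<beta> * x powr (- \<beta> - 1) \<le>
    a powr (\<beta> - 2) * ((x powr (1 - \<beta>) - (x - a) powr (1 - \<beta>)) / (1 - \<beta>))
    - a powr (\<beta> - 1) * (x - a) powr (1 - \<beta>) / x"
proof -
  define X Y where "X = (x - a) powr (1 - \<beta>)" and "Y = x powr (1 - \<beta>)"
  have x: "0 < x"
    using assms by auto
  have e1: "x powr ((1 - \<beta>) - 1) = Y / x"
    using x by (simp add: Y_def powr_diff powr_minus_divide)
  have e2: "x powr (- \<beta> - 1) = Y / x / x"
  proof -
    have "x powr ((1 - \<beta>) - 2) = Y / x powr 2"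
      unfolding Y_def by (rule powr_diff)
    moreover have "(1 - \<beta>) - 2 = - \<beta> - 1"
      by simp
    ultimately show ?thesis
      using x by (simp add: power2_eq_square)
  qed
  have a2: "a powr (\<beta> - 2) = a powr (\<beta> - 1) / a"
    using assms powr_diff[of a "\<beta> - 1" 1] by simp
  have a0: "a powr \<beta> = a powr (\<beta> - 1) * a"
    using assms powr_add[of a "\<beta> - 1" 1] by simp
  have "(1 - \<beta>) * x powr ((1 - \<beta>) - 1) * (x - (x - a)) \<le> Y - X"
    unfolding X_def Y_def using assms by (intro powr_diff_ge) auto
  hence diff: "(1 - \<beta>) * (a * Y / x) \<le> Y - X"
    unfolding e1 by (simp add: mult_ac)
  hence "(1 - \<beta>) * a * (Y / x) \<le> Y - X"
    by simp
  hence "Y / x \<le> (Y - X) / ((1 - \<beta>) * a)"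
    using assms by (simp add: pos_le_divide_eq mult_ac)
  moreover have "(1 - \<beta>) * a * Y / x / x \<le> (Y - X) / x"
    using divide_right_mono[OF diff, of x] x by simp
  ultimately have "(1 - \<beta>) * a * Y / x / x \<le> (Y - X) / ((1 - \<beta>) * a) - X / x"
    by (simp add: diff_divide_distrib)
  moreover have l: "A * ((1 - \<beta>) * a * Y / x / x) = (1 - \<beta>) * (A * a) * (Y / x / x)"
    and r: "A * ((Y - X) / ((1 - \<beta>) * a) - X / x) = A / a * ((Y - X) / (1 - \<beta>)) - A * X / x" for A
    by (simp_all only: right_diff_distrib[of A]) (simp_all add: mult_ac)
  ultimately have "a powr (\<beta> - 1) * ((1 - \<beta>) * a * Y / x / x) \<le> a powr (\<beta> - 1) * ((Y - X) / ((1 - \<beta>) * a) - X / x)"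
    by (intro mult_left_mono) auto
  thus ?thesis
    unfolding X_def[symmetric] Y_def[symmetric] a2 a0 e2
    by (simp only: l r)
qed

section \<open>Comparison principle and solvability\<close>

context alikhanov_mesh
begin

lemma D_cmult: "n \<in> {1..N} \<Longrightarrow> D (\<lambda>k. c * v k) n = c * D v n"
  by (simp add: D_eq_coeffs sum_distrib_left algebra_simps)

lemma D_add: "n \<in> {1..N} \<Longrightarrow> D (\<lambda>k. v k + w k) n = D v n + D w n"
  by (simp add: D_eq_coeffs sum.distrib[symmetric] algebra_simps)

lemma D_sum: "n \<in> {1..N} \<Longrightarrow> D (\<lambda>k. \<Sum>i\<in>I. v i k) n = (\<Sum>i\<in>I. D (v i) n)"
  unfolding D_eq_coeffs
  by (subst sum.swap) (simp add: sum_distrib_left sum_subtractf[symmetric])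

text \<open>Summation by parts turns \<open>D u n\<close> for the difference \<open>u = v - w\<close> into \<open>g n n * u n\<close> minus a
combination of earlier values of \<open>u\<close> with nonnegative weights, because the coefficients increase.
Hence \<open>u n\<close> cannot be the first positive value.\<close>

theorem comparison:
  assumes J: "J \<le> N" and le: "\<And>n. n \<in> {1..J} \<Longrightarrow> D v n \<le> D w n" and "v 0 \<le> w 0"
  shows "n \<le> J \<Longrightarrow> v n \<le> w n"
proof (induction n rule: less_induct)
  case (less n)
  define u where "u k = v k - w k" for k
  show ?case
  proof (cases "n = 0")
    case False
    hence n: "n \<in> {1..N}" "n \<in> {1..J}"
      using less J by auto
    have u: "u k \<le> 0" if "k < n" for k
      using less.IH[of k] less.prems that by (simp add: u_def)
    have "g n m * u m \<le> (\<Sum>k=1..m. g n k * (u k - u (k - 1)))" if "1 \<le> m" "m \<le> n" for m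
      using that
    proof (induction m rule: dec_induct)
      case base
      have "g n 1 * u 0 \<le> 0"
        using g_pos[OF n(1), of 1] u[of 0] n by (auto intro: mult_nonneg_nonpos)
      thus ?case
        by (simp add: algebra_simps)
    next
      case (step m)
      have "g n m \<le> g n (Suc m)"
        using step n by (intro g_mono) auto
      hence "(g n (Suc m) - g n m) * u m \<le> 0"
        using u[of m] step by (intro mult_nonneg_nonpos) auto
      thus ?case
        using step by (simp add: algebra_simps)
    qed
    from this[of n] have "g n n * u n \<le> D v n - D w n"
      unfolding D_eq_coeffs[OF n(1)] using n
      by (simp add: u_def sum_subtractf[symmetric] algebra_simps)
    hence "g n n * u n \<le> 0"
      using le[OF n(2)] by simp
    hence "u n \<le> 0"
      using g_pos[OF n(1), of n] n by (auto simp: mult_le_0_iff)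
    thus ?thesis
      by (simp add: u_def)
  qed (use assms in auto)
qed

text \<open>All increments and coefficients are nonnegative, so the steps up to \<open>m\<close> can be dropped; the
remaining coefficients are at least the first of them.\<close>

lemma D_nondecreasing_ge:
  assumes n: "n \<in> {1..N}" and "m < n" and mono: "\<And>k. k \<in> {1..n} \<Longrightarrow> v (k - 1) \<le> v k"
  shows "g n (m + 1) * (v n - v m) \<le> D v n"
proof -
  have "g n (m + 1) * (v n - v m) = (\<Sum>k=m+1..n. g n (m + 1) * (v k - v (k - 1)))"
    using sum_telescope''[of m n v] assms(2)
    by (simp add: sum_distrib_left[symmetric] atLeastSucAtMost_greaterThanAtMost)
  also have "\<dots> \<le> (\<Sum>k=m+1..n. g n k * (v k - v (k - 1)))"
    using n mono by (intro sum_mono mult_right_mono g_mono) auto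
  also have "\<dots> \<le> (\<Sum>k=1..n. g n k * (v k - v (k - 1)))"
    using n mono g_pos[OF n] by (intro sum_mono2 mult_nonneg_nonneg) (auto intro: less_imp_le)
  finally show ?thesis
    by (simp add: D_eq_coeffs[OF n])
qed

lemma ex_solution: "\<exists>w. w 0 = 0 \<and> (\<forall>n\<in>{1..N}. D w n = f n)"
proof -
  have "\<exists>w. w 0 = 0 \<and> (\<forall>n\<in>{1..m}. D w n = f n)" if "m \<le> N" for m
    using that
  proof (induction m)
    case 0
    show ?case by (rule exI[of _ "\<lambda>_. 0"]) auto
  next
    case (Suc m)
    then obtain w where w: "w 0 = 0" "\<And>n. n \<in> {1..m} \<Longrightarrow> D w n = f n"
      by auto
    define s where "s = (\<Sum>k=1..m. g (Suc m) k * (w k - w (k - 1)))"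
    define w' where "w' = w(Suc m := w m + (f (Suc m) - s) / g (Suc m) (Suc m))"
    have "D w' n = f n" if n: "n \<in> {1..Suc m}" for n
    proof (cases "n = Suc m")
      case True
      have "0 < g (Suc m) (Suc m)"
        using Suc by (intro g_pos) auto
      moreover have "(\<Sum>k=1..m. g (Suc m) k * (w' k - w' (k - 1))) = s"
        unfolding s_def by (intro sum.cong) (auto simp: w'_def)
      ultimately show ?thesis
        using True Suc.prems by (simp add: D_eq_coeffs w'_def)
    next
      case False
      have "D w' n = D w n"
        using n False Suc.prems by (auto simp: D_eq_coeffs w'_def intro!: sum.cong)
      thus ?thesis
        using w(2)[of n] n False by auto
    qed
    moreover have "w' 0 = 0"
      using w(1) by (simp add: w'_def)
    ultimately show ?case by blast
  qed
  thus ?thesis by blast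
qed

end

section \<open>The capped power as a barrier\<close>

text \<open>The consequences of quasi-grading that matter, with a single constant \<open>K\<close> and a small exponent \<open>\<kappa>\<close>:
steps are comparable to \<open>t k / k\<close>, powers of the index are controlled by powers of time, indices of
comparable times are comparable, and consecutive times are comparable. The constants \<open>trunc_const\<close>, \<open>green_const\<close> and \<open>growth_const\<close> below depend
on \<open>\<beta>\<close>, \<open>K\<close> and \<open>\<kappa>\<close> only, which makes them uniform over a family of meshes.\<close>

locale graded_mesh = alikhanov_mesh +
  fixes K \<kappa> :: real
  assumes \<kappa>_pos: "0 < \<kappa>" and \<kappa>_less: "\<kappa> < \<beta>" and K_ge: "1 \<le> K"
    and step_le: "\<And>k. k \<in> {1..N} \<Longrightarrow> real k * (t k - t (k - 1)) \<le> K * t k"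
    and step_ge: "\<And>k. k \<in> {1..N} \<Longrightarrow> t k \<le> K * (real k * (t k - t (k - 1)))"
    and index_ratio_le: "\<And>p k. 1 \<le> p \<Longrightarrow> p \<le> k \<Longrightarrow> k \<le> N \<Longrightarrow>
      real p / real k \<le> K * (t p / t k) powr \<kappa>"
    and index_le: "\<And>p k. 1 \<le> p \<Longrightarrow> p \<le> k \<Longrightarrow> k \<le> N \<Longrightarrow> t k \<le> 4 * t p \<Longrightarrow> real k \<le> K * real p"
    and t_le_prev: "\<And>n. n \<in> {2..N} \<Longrightarrow> t n \<le> K * t (n - 1)"

lemma sum_split_last:
  fixes f :: "nat \<Rightarrow> real"
  assumes "p + 1 \<le> n"
  shows "(\<Sum>k=1..n. f k) = (\<Sum>k=1..p. f k) + (\<Sum>k=p+1..n-1. f k) + f n"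
proof -
  obtain d where "n = Suc (p + d)"
    using assms by (metis add_Suc less_iff_Suc_add Suc_eq_plus1 Suc_le_eq add_Suc_right)
  thus ?thesis
    using sum.ub_add_nat[of 1 p f d] by simp
qed

lemma sum_le_telescope:
  fixes f h :: "nat \<Rightarrow> real"
  assumes "a \<le> b" "\<And>k. k \<in> {a+1..b} \<Longrightarrow> f k \<le> h k - h (k - 1)"
  shows "(\<Sum>k=a+1..b. f k) \<le> h b - h a"
  using assms
proof (induction b rule: dec_induct)
  case (step m)
  thus ?case
    using step.prems[of "Suc m"] by fastforce
qed auto

context alikhanov_mesh
begin

text \<open>The capped power with its kink at \<open>t p\<close>.\<close>

definition barrier :: "nat \<Rightarrow> nat \<Rightarrow> real" where
  "barrier p j = (if j \<le> p then t p powr (\<beta> - 2) * t j else t j powr (\<beta> - 1))"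

text \<open>A bound on the variation of the derivative of \<open>s powr (\<beta> - 1)\<close> over the \<open>k\<close>-th interval.\<close>

definition curv :: "nat \<Rightarrow> real" where
  "curv k = 2 * step k * t (k - 1) powr (\<beta> - 3)"

lemma barrier_nodes:
  assumes "p \<in> {1..N}" "p \<le> j"
  shows "barrier p j = t j powr (\<beta> - 1)"
proof (cases "j = p")
  case True
  have "0 < t p"
    using assms t_pos by auto
  thus ?thesis
    using True powr_add[of "t p" "\<beta> - 2" 1] by (simp add: barrier_def)
next
  case False
  thus ?thesis
    using assms by (simp add: barrier_def)
qed

lemma barrier_le:
  assumes "p \<in> {1..N}" "j \<in> {1..N}"
  shows "barrier p j \<le> t j powr (\<beta> - 1)"
proof (cases "j \<le> p")
  case True
  have "0 < t j" "t j \<le> t p"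
    using True assms t_pos[of j] t_le[of j p] by auto
  hence "t p powr (\<beta> - 2) * t j \<le> t j powr (\<beta> - 2) * t j"
    using \<beta>_less_1 by (intro mult_right_mono powr_mono2') auto
  also have "\<dots> = t j powr (\<beta> - 1)"
    using powr_add[of "t j" "\<beta> - 2" 1] \<open>0 < t j\<close> by simp
  finally show ?thesis
    using True by (simp add: barrier_def)
qed (simp add: barrier_def)

lemma barrier_nonneg: "p \<in> {1..N} \<Longrightarrow> j \<le> N \<Longrightarrow> 0 \<le> barrier p j"
  using t_le[of 0 j] by (simp add: barrier_def)

lemma barrier_0 [simp]: "barrier p 0 = 0"
  by (simp add: barrier_def)

lemma g_first_ge:
  assumes "n \<in> {1..N}"
  shows "t n powr (-\<beta>) / (2 * Gamma (1 - \<beta>)) \<le> g n 1"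
  using g_ge[OF assms, of 1] assms by simp

text \<open>Up to the kink the barrier increases, so one coefficient \<open>g j 1\<close> and its lower bound suffice.\<close>

lemma D_barrier_before:
  assumes p: "p \<in> {1..N}" and j: "j \<in> {1..p}"
  shows "t j powr (1 - \<beta>) * t p powr (\<beta> - 2) / (2 * Gamma (1 - \<beta>)) \<le> D (barrier p) j"
proof -
  have jN: "j \<in> {1..N}"
    using p j by auto
  have tj: "0 < t j"
    using jN t_pos by auto
  have pw: "t j powr (1 - \<beta>) = t j powr (-\<beta>) * t j"
    using powr_add[of "t j" "-\<beta>" 1] tj by simp
  have "t j powr (1 - \<beta>) * t p powr (\<beta> - 2) / (2 * Gamma (1 - \<beta>))
      = t j powr (-\<beta>) / (2 * Gamma (1 - \<beta>)) * barrier p j"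
    unfolding pw using j by (simp add: barrier_def)
  also have "\<dots> \<le> g j 1 * barrier p j"
    using g_first_ge[OF jN] barrier_nonneg p jN by (intro mult_right_mono) auto
  also have "\<dots> \<le> D (barrier p) j"
  proof -
    have "barrier p (k - 1) \<le> barrier p k" if "k \<in> {1..j}" for k
      using that j p t_le[of "k - 1" k] by (auto simp: barrier_def mult_left_mono)
    from D_nondecreasing_ge[OF jN, of 0 "barrier p", OF _ this] show ?thesis
      using j by simp
  qed
  finally show ?thesis .
qed

lemma slope_barrier_linear:
  assumes p: "p \<in> {1..N}" and k: "k \<in> {1..p}"
  shows "slope (barrier p) k = t p powr (\<beta> - 2)"
proof -
  have "t (k - 1) < t k"
    using p k by (intro t_less) auto
  thus ?thesis
    using k by (auto simp: barrier_def right_diff_distrib[symmetric])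
qed

lemma slope_barrier_mean_value:
  assumes p: "p \<in> {1..N}" and k: "k \<in> {p+1..N}"
  obtains z where "t (k - 1) < z" "z < t k" "slope (barrier p) k = (\<beta> - 1) * z powr (\<beta> - 2)"
proof -
  have tk: "0 < t (k - 1)" "t (k - 1) < t k"
    using p k by (auto intro!: t_pos t_less)
  obtain z where z: "t (k - 1) < z" "z < t k"
    "t k powr (\<beta> - 1) - t (k - 1) powr (\<beta> - 1) = step k * ((\<beta> - 1) * z powr (\<beta> - 1 - 1))"
    using powr_mean_value[of "t (k - 1)" "t k" "\<beta> - 1"] tk by auto
  have k': "p \<le> k" "p \<le> k - 1"
    using k by auto
  have "barrier p k - barrier p (k - 1) = step k * ((\<beta> - 1) * z powr (\<beta> - 2))"
  proof -
    have "\<beta> - 1 - 1 = \<beta> - 2"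
      by simp
    thus ?thesis
      using z(3) unfolding barrier_nodes[OF p k'(1)] barrier_nodes[OF p k'(2)] by metis
  qed
  hence "slope (barrier p) k = (\<beta> - 1) * z powr (\<beta> - 2)"
    using tk by simp
  thus ?thesis
    using that z by blast
qed

lemma slope_barrier_mono:
  assumes p: "p \<in> {1..N}" and k: "k \<in> {p+1..N-1}"
  shows "slope (barrier p) k \<le> slope (barrier p) (k + 1)"
proof -
  have k': "k \<in> {p+1..N}" "k + 1 \<in> {p+1..N}"
    using k by auto
  obtain z where z: "t (k - 1) < z" "z < t k" "slope (barrier p) k = (\<beta> - 1) * z powr (\<beta> - 2)"
    by (rule slope_barrier_mean_value[OF p k'(1)])
  obtain z' where "t (k + 1 - 1) < z'" "z' < t (k + 1)"
      "slope (barrier p) (k + 1) = (\<beta> - 1) * z' powr (\<beta> - 2)"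
    by (rule slope_barrier_mean_value[OF p k'(2)])
  hence z': "t k < z'" "slope (barrier p) (k + 1) = (\<beta> - 1) * z' powr (\<beta> - 2)"
    by simp_all
  have "0 \<le> t (k - 1)"
    using t_le[of 0 "k - 1"] k' by auto
  hence "z' powr (\<beta> - 2) \<le> z powr (\<beta> - 2)"
    using z z' \<beta>_less_1 by (intro powr_mono2') auto
  thus ?thesis
    unfolding z(3) z'(2) using \<beta>_less_1 by (intro mult_left_mono_neg) auto
qed

lemma slope_barrier_after_kink_ge:
  assumes p: "p \<in> {1..N}" and p': "p + 1 \<le> N"
  shows "- (t p powr (\<beta> - 2)) \<le> slope (barrier p) (p + 1)"
proof -
  obtain z where z: "t p < z" "slope (barrier p) (p + 1) = (\<beta> - 1) * z powr (\<beta> - 2)"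
    using slope_barrier_mean_value[OF p, of "p + 1"] p' by auto
  have "(1 - \<beta>) * z powr (\<beta> - 2) \<le> 1 * t p powr (\<beta> - 2)"
    using z \<beta>_less_1 \<beta>_pos t_pos[of p] p by (intro mult_mono powr_mono2') auto
  thus ?thesis
    unfolding z(2) by (simp add: algebra_simps)
qed

lemma slope_barrier_approx:
  assumes p: "p \<in> {1..N}" and k: "k \<in> {p+1..N}" and s: "s \<in> {t (k - 1)..t k}"
  shows "\<bar>slope (barrier p) k - (\<beta> - 1) * s powr (\<beta> - 2)\<bar> \<le> curv k"
proof -
  obtain z where z: "t (k - 1) < z" "z < t k" "slope (barrier p) k = (\<beta> - 1) * z powr (\<beta> - 2)"
    using slope_barrier_mean_value[OF p k] by auto
  have tk: "0 < t (k - 1)" "t (k - 1) < t k"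
    using p k by (auto intro!: t_pos t_less)
  have *: "t k powr (\<beta> - 2) \<le> x powr (\<beta> - 2) \<and> x powr (\<beta> - 2) \<le> t (k - 1) powr (\<beta> - 2)"
    if "x \<in> {t (k - 1)..t k}" for x
    using that tk \<beta>_less_1 by (auto intro!: powr_mono2')
  have "\<bar>slope (barrier p) k - (\<beta> - 1) * s powr (\<beta> - 2)\<bar> = (1 - \<beta>) * \<bar>z powr (\<beta> - 2) - s powr (\<beta> - 2)\<bar>"
    unfolding z(3) using \<beta>_less_1 by (simp add: right_diff_distrib[symmetric] abs_mult)
  also have "\<dots> \<le> 1 * (t (k - 1) powr (\<beta> - 2) - t k powr (\<beta> - 2))"
    using *[of z] *[of s] z s \<beta>_pos \<beta>_less_1 by (intro mult_mono) (auto simp: abs_le_iff)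
  also have "\<dots> \<le> (2 - \<beta>) * t (k - 1) powr (-(2 - \<beta>) - 1) * step k"
    using powr_diff_neg_le[of "t (k-1)" "t k" "2 - \<beta>"] tk \<beta>_less_1 by simp
  also have "\<dots> \<le> 2 * t (k - 1) powr (-(2 - \<beta>) - 1) * step k"
    using tk \<beta>_pos by (intro mult_right_mono) auto
  also have "\<dots> = curv k"
  proof -
    have "- (2 - \<beta>) - 1 = \<beta> - 3"
      by simp
    thus ?thesis
      unfolding curv_def by (simp only: mult_ac)
  qed
  finally show ?thesis .
qed

text \<open>The left part of the sum is the exact Caputo derivative of the capped power at \<open>ts n\<close>, bounded
below by \<open>capped_power_caputo_ge\<close>. The errors come from replacing the derivative of
\<open>s powr (\<beta> - 1)\<close> by its mean on each interval: on full intervals the difference has mean zero and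
only the variation of the kernel counts, on the last, incomplete one it is estimated directly.\<close>

lemma sum_ker_int_barrier_ge:
  assumes p: "p \<in> {1..N}" and n: "n \<in> {p+1..N}"
  shows "(1 - \<beta>) * t p powr \<beta> * t n powr (- \<beta> - 1)
     - (\<Sum>k=p+1..n-1. step k * curv k * (ker n (t k) - ker n (t (k - 1))))
     - curv n * ker_int n n
    \<le> (\<Sum>k=1..n. ker_int n k * slope (barrier p) k)"
proof -
  have nN: "n \<in> {1..N}"
    using n by auto
  define x where "x = ts n"
  define \<phi> where "\<phi> s = (x - s) powr (-\<beta>) * ((\<beta> - 1) * s powr (\<beta> - 2))" for s
  have tp: "0 < t p"
    using p t_pos by auto
  have px: "t p < x" and lastx: "t (n - 1) < x"
    using t_before_ts[OF nN] n by (auto simp: x_def)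
  have int\<phi>: "(\<phi> has_integral - (t p powr (\<beta> - 1) * (x - t p) powr (1 - \<beta>) / x)) {t p..x}"
    unfolding \<phi>_def using has_integral_kernel_powr[of \<beta> "t p" x] tp px \<beta>_less_1 by auto
  have sub: "\<phi> integrable_on {a..b}" if "t p \<le> a" "b \<le> x" for a b
    by (rule integrable_subinterval_real[of _ "t p" x]) (use int\<phi> that in auto)
  have tel: "(\<Sum>k=p+1..m. integral {t (k - 1)..t k} \<phi>) = integral {t p..t m} \<phi>" if "p \<le> m" "m \<le> n - 1" for m
    using that
  proof (induction m rule: dec_induct)
    case (step m)
    have "t p \<le> t m" "t m \<le> t (Suc m)" "t (Suc m) \<le> x"
      using step n t_before_ts[OF nN, of "Suc m"] by (auto intro!: t_le simp: x_def)
    hence "integral {t p..t m} \<phi> + integral {t m..t (Suc m)} \<phi> = integral {t p..t (Suc m)} \<phi>"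
      by (intro Henstock_Kurzweil_Integration.integral_combine sub) auto
    thus ?case
      using step by simp
  qed auto
  have "(\<Sum>k=p+1..n-1. integral {t (k - 1)..t k} \<phi>) + integral {t (n - 1)..x} \<phi> = integral {t p..x} \<phi>"
    using tel[of "n - 1"] n lastx
    by (auto intro!: Henstock_Kurzweil_Integration.integral_combine sub t_le)
  also have "\<dots> = - (t p powr (\<beta> - 1) * (x - t p) powr (1 - \<beta>) / x)"
    using int\<phi> by (rule integral_unique)
  finally have tail: "(\<Sum>k=p+1..n-1. integral {t (k - 1)..t k} \<phi>) + integral {t (n - 1)..x} \<phi>
    = - (t p powr (\<beta> - 1) * (x - t p) powr (1 - \<beta>) / x)" .
  have head: "(\<Sum>k=1..p. ker_int n k * slope (barrier p) k)
    = t p powr (\<beta> - 2) * ((x powr (1 - \<beta>) - (x - t p) powr (1 - \<beta>)) / (1 - \<beta>))"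
  proof -
    have "(\<Sum>k=1..m. ker_int n k) = (x powr (1 - \<beta>) - (x - t m) powr (1 - \<beta>)) / (1 - \<beta>)"
      if "m \<le> p" for m
      using that
    proof (induction m)
      case (Suc m)
      have "Suc m \<le> n - 1"
        using Suc n by auto
      hence "t m \<le> t (Suc m)" "t (Suc m) \<le> x"
        using Suc n t_before_ts[OF nN, of "Suc m"] by (auto intro!: t_le simp: x_def)
      hence "integral {t m..t (Suc m)} (ker n) =
         ((x - t m) powr (1 - \<beta>) - (x - t (Suc m)) powr (1 - \<beta>)) / (1 - \<beta>)"
        using has_integral_kernel[of \<beta> "t m" "t (Suc m)" x] \<beta>_less_1 by (auto simp: x_def integral_unique)
      thus ?case
        using Suc n by (simp add: ker_int_def diff_divide_distrib)
    qed auto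
    moreover have "(\<Sum>k=1..p. ker_int n k * slope (barrier p) k) = (\<Sum>k=1..p. ker_int n k * t p powr (\<beta> - 2))"
      using slope_barrier_linear[OF p] by (intro sum.cong refl) (metis)
    ultimately show ?thesis
      by (simp add: sum_distrib_right[symmetric])
  qed
  have mid: "integral {t (k - 1)..t k} \<phi> - step k * curv k * (ker n (t k) - ker n (t (k - 1)))
      \<le> ker_int n k * slope (barrier p) k" if k: "k \<in> {p+1..n-1}" for k
  proof -
    define s0 where "s0 = slope (barrier p) k"
    have tk: "0 < t (k - 1)" "t (k - 1) < t k" "t k < x" "t p \<le> t (k - 1)"
      using p k n t_before_ts[OF nN, of k] by (auto intro!: t_pos t_less t_le simp: x_def)
    have k': "p \<le> k" "p \<le> k - 1"
      using k by auto
    have kN: "k \<in> {p+1..N}"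
      using k n by auto
    have int1: "((\<lambda>s. (\<beta> - 1) * s powr (\<beta> - 2)) has_integral (t k powr (\<beta> - 1) - t (k - 1) powr (\<beta> - 1))) {t (k - 1)..t k}"
      using tk
      by (intro fundamental_theorem_of_calculus)
         (auto intro!: derivative_eq_intros simp: has_real_derivative_iff_has_vector_derivative[symmetric])
    have int2: "((\<lambda>s. s0) has_integral s0 * step k) {t (k - 1)..t k}"
      using has_integral_const_real[of s0 "t (k - 1)" "t k"] tk by (simp add: mult.commute)
    have "s0 * step k = barrier p k - barrier p (k - 1)"
      using tk(2) by (simp add: s0_def)
    hence "s0 * step k = t k powr (\<beta> - 1) - t (k - 1) powr (\<beta> - 1)"
      unfolding barrier_nodes[OF p k'(1)] barrier_nodes[OF p k'(2)] .
    hence zero: "((\<lambda>s. s0 - (\<beta> - 1) * s powr (\<beta> - 2)) has_integral 0) {t (k - 1)..t k}"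
      using has_integral_diff[OF int2 int1] by simp
    have i1: "(\<lambda>s. ker n s * s0) integrable_on {t (k - 1)..t k}"
      using tk nN by (intro integrable_on_mult_left ker_integrable) (auto simp: x_def)
    have i2: "\<phi> integrable_on {t (k - 1)..t k}"
      using tk by (intro sub) auto
    have eq: "(\<lambda>s. ker n s * (s0 - (\<beta> - 1) * s powr (\<beta> - 2))) = (\<lambda>s. ker n s * s0 - \<phi> s)"
      by (simp add: \<phi>_def x_def right_diff_distrib)
    have "\<bar>integral {t (k - 1)..t k} (\<lambda>s. ker n s * (s0 - (\<beta> - 1) * s powr (\<beta> - 2)))\<bar>
        \<le> step k * curv k * (ker n (t k) - ker n (t (k - 1)))"
    proof (rule integral_nondecreasing_mean_zero_abs_le[OF _ _ _ zero])
      show "(\<lambda>s. ker n s * (s0 - (\<beta> - 1) * s powr (\<beta> - 2))) integrable_on {t (k - 1)..t k}"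
        unfolding eq by (rule integrable_diff[OF i1 i2])
    qed (use tk slope_barrier_approx[OF p kN] \<beta>_pos in \<open>auto simp: s0_def x_def intro!: kernel_mono\<close>)
    moreover have "integral {t (k - 1)..t k} (\<lambda>s. ker n s * (s0 - (\<beta> - 1) * s powr (\<beta> - 2)))
        = ker_int n k * s0 - integral {t (k - 1)..t k} \<phi>"
      unfolding eq integral_diff[OF i1 i2] integral_mult_left using k by (auto simp: ker_int_def)
    ultimately show ?thesis
      unfolding s0_def by linarith
  qed
  have last: "integral {t (n - 1)..x} \<phi> - curv n * ker_int n n \<le> ker_int n n * slope (barrier p) n"
  proof -
    have i1: "ker n integrable_on {t (n - 1)..x}"
      using lastx nN by (intro ker_integrable) (auto simp: x_def)
    have i2: "\<phi> integrable_on {t (n - 1)..x}"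
      using n by (intro sub) (auto intro!: t_le)
    have "integral {t (n - 1)..x} \<phi> \<le> integral {t (n - 1)..x} (\<lambda>s. ker n s * (slope (barrier p) n + curv n))"
    proof (rule integral_le[OF i2 integrable_on_mult_left[OF i1]])
      fix s assume s: "s \<in> {t (n - 1)..x}"
      have "s \<in> {t (n - 1)..t n}"
        using s ts_le[OF nN] by (auto simp: x_def)
      hence "(\<beta> - 1) * s powr (\<beta> - 2) \<le> slope (barrier p) n + curv n"
        using slope_barrier_approx[OF p, of n s] n by auto
      thus "\<phi> s \<le> ker n s * (slope (barrier p) n + curv n)"
        unfolding \<phi>_def x_def by (intro mult_left_mono) auto
    qed
    also have "\<dots> = ker_int n n * (slope (barrier p) n + curv n)"
      by (simp add: ker_int_def x_def)
    finally show ?thesis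
      by (simp add: algebra_simps)
  qed
  have "x \<le> t n" "0 < x"
    using ts_le[OF nN] px tp by (auto simp: x_def)
  hence "(1 - \<beta>) * t p powr \<beta> * t n powr (- \<beta> - 1) \<le> (1 - \<beta>) * t p powr \<beta> * x powr (- \<beta> - 1)"
    using \<beta>_pos \<beta>_less_1 by (intro mult_left_mono powr_mono2') auto
  also have "\<dots> \<le> (\<Sum>k=1..p. ker_int n k * slope (barrier p) k)
     + ((\<Sum>k=p+1..n-1. integral {t (k - 1)..t k} \<phi>) + integral {t (n - 1)..x} \<phi>)"
    unfolding head tail using capped_power_caputo_ge[of \<beta> "t p" x] \<beta>_pos \<beta>_less_1 tp px by simp
  finally have "(1 - \<beta>) * t p powr \<beta> * t n powr (- \<beta> - 1) \<le> (\<Sum>k=1..p. ker_int n k * slope (barrier p) k)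
     + ((\<Sum>k=p+1..n-1. integral {t (k - 1)..t k} \<phi>) + integral {t (n - 1)..x} \<phi>)" .
  moreover have "(\<Sum>k=p+1..n-1. integral {t (k - 1)..t k} \<phi>)
      - (\<Sum>k=p+1..n-1. step k * curv k * (ker n (t k) - ker n (t (k - 1))))
      \<le> (\<Sum>k=p+1..n-1. ker_int n k * slope (barrier p) k)"
    unfolding sum_subtractf[symmetric] using mid by (rule sum_mono)
  moreover have "(\<Sum>k=1..n. ker_int n k * slope (barrier p) k) =
      (\<Sum>k=1..p. ker_int n k * slope (barrier p) k)
      + (\<Sum>k=p+1..n-1. ker_int n k * slope (barrier p) k) + ker_int n n * slope (barrier p) n"
    using n by (intro sum_split_last) auto
  ultimately show ?thesis
    using last by linarith
qed

text \<open>Corrections for jumps of the slope vanish where the barrier is linear and are nonnegative where it is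
convex; the concave kink contributes the last error term.\<close>

lemma D_barrier_after_raw:
  assumes p: "p \<in> {1..N}" and n: "n \<in> {p+1..N}"
  shows "(1 - \<beta>) * t p powr \<beta> * t n powr (- \<beta> - 1)
     - (\<Sum>k=p+1..n-1. step k * curv k * (ker n (t k) - ker n (t (k - 1))))
     - curv n * ker_int n n - 2 * t p powr (\<beta> - 2) * ker_moment n p
    \<le> Gamma (1 - \<beta>) * D (barrier p) n"
proof -
  have nN: "n \<in> {1..N}"
    using n by auto
  have "(\<Sum>k=1..n-1. if k = p then - (2 * t p powr (\<beta> - 2) * ker_moment n p) else 0)
    \<le> (\<Sum>k=1..n-1. ker_moment n k * (slope (barrier p) (k + 1) - slope (barrier p) k))"
  proof (rule sum_mono)
    fix k assume k: "k \<in> {1..n-1}"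
    have m: "0 \<le> ker_moment n k"
      using ker_moment_bounds(1)[OF nN k] .
    consider "k < p" | "k = p" | "p < k"
      by linarith
    thus "(if k = p then - (2 * t p powr (\<beta> - 2) * ker_moment n p) else 0)
      \<le> ker_moment n k * (slope (barrier p) (k + 1) - slope (barrier p) k)"
    proof cases
      case 1
      thus ?thesis
        using slope_barrier_linear[OF p, of k] slope_barrier_linear[OF p, of "k + 1"] k by simp
    next
      case 2
      have "- (2 * t p powr (\<beta> - 2)) \<le> slope (barrier p) (p + 1) - slope (barrier p) p"
        using slope_barrier_linear[OF p, of p] slope_barrier_after_kink_ge[OF p] n p by auto
      hence "ker_moment n p * - (2 * t p powr (\<beta> - 2))
          \<le> ker_moment n p * (slope (barrier p) (p + 1) - slope (barrier p) p)"
        using m 2 by (intro mult_left_mono) auto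
      thus ?thesis
        using 2 by (simp add: mult_ac)
    next
      case 3
      thus ?thesis
        using slope_barrier_mono[OF p, of k] m k n by auto
    qed
  qed
  moreover have "(\<Sum>k=1..n-1. if k = p then - (2 * t p powr (\<beta> - 2) * ker_moment n p) else 0)
      = - (2 * t p powr (\<beta> - 2) * ker_moment n p)"
    using p n by auto
  ultimately show ?thesis
    using sum_ker_int_barrier_ge[OF p n] D_eq[OF nN, of "barrier p"] by linarith
qed

end

section \<open>Truncation errors on a quasi-graded mesh\<close>

context graded_mesh
begin

lemma step_le': "k \<in> {1..N} \<Longrightarrow> step k \<le> K * t k / real k"
  using step_le[of k] by (simp add: pos_le_divide_eq mult.commute)

lemma inverse_index_le:
  assumes "1 \<le> p" "p \<le> k" "k \<le> N"
  shows "1 / real k \<le> K / real p * (t p / t k) powr \<kappa>"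
proof -
  have "real p / real k / real p \<le> K * (t p / t k) powr \<kappa> / real p"
    using index_ratio_le[OF assms] by (rule divide_right_mono) simp
  thus ?thesis
    using assms by simp
qed

lemma step_curv_le:
  assumes k: "k \<in> {2..N}"
  shows "step k * curv k \<le> 2 * K ^ 5 * t k powr (\<beta> - 1) / (real k)\<^sup>2"
proof -
  have kN: "k \<in> {1..N}" and tk: "0 < t k" "0 < t (k - 1)"
    using k by (auto intro!: t_pos)
  have "t (k - 1) powr (\<beta> - 3) \<le> (t k / K) powr (\<beta> - 3)"
    using t_le_prev[OF k] K_ge tk \<beta>_less_1
    by (intro powr_mono2') (auto simp: pos_divide_le_eq mult.commute)
  also have "\<dots> = t k powr (\<beta> - 3) * K powr (3 - \<beta>)"
    using tk K_ge powr_minus_divide[of K "3 - \<beta>"] by (simp add: powr_divide)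
  also have "\<dots> \<le> t k powr (\<beta> - 3) * K powr 3"
    using K_ge \<beta>_pos by (intro mult_left_mono powr_mono) auto
  also have "\<dots> = t k powr (\<beta> - 3) * K ^ 3"
    using K_ge by simp
  finally have prev: "t (k - 1) powr (\<beta> - 3) \<le> t k powr (\<beta> - 3) * K ^ 3" .
  have pw: "t k powr (\<beta> - 3) * (t k)\<^sup>2 = t k powr (\<beta> - 1)"
    using tk powr_add[of "t k" "\<beta> - 3" 2] by simp
  have "step k * curv k = 2 * ((step k)\<^sup>2 * t (k - 1) powr (\<beta> - 3))"
    by (simp add: curv_def power2_eq_square)
  also have "\<dots> \<le> 2 * ((K * t k / real k)\<^sup>2 * (t k powr (\<beta> - 3) * K ^ 3))"
    using step_le'[OF kN] step_pos[OF kN] prev by (intro mult_left_mono mult_mono power_mono) auto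
  also have "\<dots> = 2 * K ^ 5 * (t k powr (\<beta> - 3) * (t k)\<^sup>2) / (real k)\<^sup>2"
    by (simp add: power_divide power_mult_distrib eval_nat_numeral mult_ac)
  finally show ?thesis
    unfolding pw .
qed

lemma ker_diff_far_le:
  assumes n: "n \<in> {1..N}" and k: "k \<in> {1..n-1}" and far: "t k \<le> ts n / 2"
  shows "ker n (t k) - ker n (t (k - 1)) \<le> 16 * step k * t n powr (-\<beta> - 1)"
proof -
  have tk: "t (k - 1) < t k" "t k < ts n"
    using k n t_before_ts[OF n, of k] by (auto intro!: t_less)
  have tn: "0 < t n"
    using n t_pos by auto
  have "(t n / 4) powr (-\<beta> - 1) = t n powr (-\<beta> - 1) * 4 powr (\<beta> + 1)"
    using tn powr_minus_divide[of 4 "\<beta> + 1"] by (simp add: powr_divide)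
  also have "\<dots> \<le> t n powr (-\<beta> - 1) * 4 powr 2"
    using \<beta>_less_1 by (intro mult_left_mono powr_mono) auto
  finally have quarter: "(t n / 4) powr (-\<beta> - 1) \<le> 16 * t n powr (-\<beta> - 1)"
    by simp
  have "(ts n - t k) powr (-\<beta>) - (ts n - t (k - 1)) powr (-\<beta>)
      \<le> \<beta> * (ts n - t k) powr (-\<beta> - 1) * (ts n - t (k - 1) - (ts n - t k))"
    using tk \<beta>_pos by (intro powr_diff_neg_le) auto
  also have "\<dots> = (\<beta> * (ts n - t k) powr (-\<beta> - 1)) * step k"
    by simp
  also have "\<dots> \<le> (1 * (t n / 4) powr (-\<beta> - 1)) * step k"
    using tk far tn ts_ge_half[OF n] \<beta>_pos \<beta>_less_1
    by (intro mult_right_mono mult_mono powr_mono2') auto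
  also have "\<dots> \<le> (1 * (16 * t n powr (-\<beta> - 1))) * step k"
    using tk quarter by (intro mult_right_mono mult_left_mono) auto
  also have "\<dots> = 16 * step k * t n powr (-\<beta> - 1)"
    by (simp only: mult_ac mult_1)
  finally show ?thesis .
qed

lemma ker_last_le:
  assumes n: "n \<in> {1..N}"
  shows "ker n (t (n - 1)) \<le> 2 * K * real n powr \<beta> * t n powr (-\<beta>)"
proof -
  have tn: "0 < t n" and n0: "0 < real n"
    using n t_pos by auto
  have "t n / (2 * K * real n) \<le> step n / 2"
    using step_ge[OF n] K_ge n0 by (simp add: field_simps)
  also have "\<dots> \<le> \<sigma> * step n"
    using mult_right_mono[OF \<sigma>_ge, of "step n"] step_pos[OF n] by simp
  also have "\<dots> = ts n - t (n - 1)"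
    by (simp add: ts_eq)
  finally have "ker n (t (n - 1)) \<le> (t n / (2 * K * real n)) powr (-\<beta>)"
    using tn n0 K_ge \<beta>_pos by (intro powr_mono2') auto
  also have "\<dots> = (2 * K) powr \<beta> * real n powr \<beta> * t n powr (-\<beta>)"
    using tn n0 K_ge by (simp add: powr_divide powr_mult powr_minus field_simps)
  also have "\<dots> \<le> (2 * K) powr 1 * real n powr \<beta> * t n powr (-\<beta>)"
    using K_ge \<beta>_less_1 by (intro mult_right_mono powr_mono) auto
  finally show ?thesis
    using K_ge by simp
qed

lemma powr_index_le: "1 \<le> n \<Longrightarrow> real n powr \<beta> \<le> real n"
  using powr_mono[of \<beta> 1 "real n"] \<beta>_less_1 by simp

text \<open>For intervals in the first half of the time span the kernel is smooth and its variation is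
proportional to \<open>step k\<close>. In the second half the kernel may be singular, but the coefficient of its
variation is uniformly small and the variations telescope. One summand covers each case.\<close>

lemma truncation_term_le:
  assumes p: "p \<in> {1..N}" and n: "n \<in> {p+1..N}" and k: "k \<in> {p+1..n-1}"
  shows "step k * curv k * (ker n (t k) - ker n (t (k - 1))) \<le>
    32 * K ^ 6 / real p * t p powr \<kappa> * t n powr (-\<beta> - 1) * (step k * t k powr (\<beta> - \<kappa> - 1))
    + 8 * K ^ 7 * t n powr (\<beta> - 1) / (real n)\<^sup>2 * (ker n (t k) - ker n (t (k - 1)))"
    (is "?lhs \<le> ?A + ?B")
proof -
  have nN: "n \<in> {1..N}" and kN: "k \<in> {2..N}" "k \<in> {1..N}" and kn: "k \<in> {1..n-1}"
    using n k p by auto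
  have tk: "0 < t k" and tp: "0 < t p" and tn: "0 < t n" and tkn: "t k \<le> t n"
    using kN p nN k n by (auto intro!: t_pos t_le)
  have st: "0 < step k"
    using step_pos[OF kN(2)] .
  have d0: "0 \<le> ker n (t k) - ker n (t (k - 1))"
    using t_before_ts[OF nN, of k] k st \<beta>_pos by (auto intro!: kernel_mono)
  have K0: "0 \<le> K"
    using K_ge by simp
  have A0: "0 \<le> ?A" and B0: "0 \<le> ?B"
    using st d0 K0 by (auto intro!: mult_nonneg_nonneg)
  show ?thesis
  proof (cases "t k \<le> ts n / 2")
    case True
    have k1: "1 \<le> real k"
      using kN by simp
    have "1 / (real k)\<^sup>2 \<le> 1 / real k"
      using k1 by (simp add: field_simps power2_eq_square)
    also have "\<dots> \<le> K / real p * (t p / t k) powr \<kappa>"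
      using p k kN by (intro inverse_index_le) auto
    also have "\<dots> = K / real p * (t p powr \<kappa> * t k powr (-\<kappa>))"
      using tp tk by (simp add: powr_divide powr_minus_divide)
    finally have ik: "1 / (real k)\<^sup>2 \<le> K / real p * (t p powr \<kappa> * t k powr (-\<kappa>))" .
    have pw: "t k powr (\<beta> - 1) * t k powr (-\<kappa>) = t k powr (\<beta> - \<kappa> - 1)"
      using powr_add[of "t k" "\<beta> - 1" "-\<kappa>"] by (simp add: algebra_simps)
    have "?lhs \<le> (2 * K ^ 5 * t k powr (\<beta> - 1) / (real k)\<^sup>2) * (16 * step k * t n powr (-\<beta> - 1))"
      using step_curv_le[OF kN(1)] ker_diff_far_le[OF nN kn True] d0 K0
      by (intro mult_mono) auto
    also have "\<dots> = 32 * K ^ 5 * t k powr (\<beta> - 1) * step k * t n powr (-\<beta> - 1) * (1 / (real k)\<^sup>2)"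
      by simp
    also have "\<dots> \<le> 32 * K ^ 5 * t k powr (\<beta> - 1) * step k * t n powr (-\<beta> - 1)
        * (K / real p * (t p powr \<kappa> * t k powr (-\<kappa>)))"
      using ik st K0 by (intro mult_left_mono) auto
    also have "\<dots> = 32 * K ^ 6 / real p * t p powr \<kappa> * t n powr (-\<beta> - 1)
        * (step k * (t k powr (\<beta> - 1) * t k powr (-\<kappa>)))"
      by (simp add: eval_nat_numeral mult_ac)
    finally have "?lhs \<le> ?A"
      unfolding pw .
    thus ?thesis
      using B0 by simp
  next
    case False
    hence near: "t n \<le> 4 * t k"
      using ts_ge_half[OF nN] by simp
    have idx: "real n \<le> K * real k"
      using kN k nN near by (intro index_le) auto
    have "t k powr (\<beta> - 1) \<le> (t n / 4) powr (\<beta> - 1)"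
      using near tn \<beta>_less_1 by (intro powr_mono2') auto
    also have "\<dots> = t n powr (\<beta> - 1) * 4 powr (1 - \<beta>)"
      using tn powr_minus_divide[of 4 "1 - \<beta>"] by (simp add: powr_divide)
    also have "\<dots> \<le> t n powr (\<beta> - 1) * 4 powr 1"
      using \<beta>_pos by (intro mult_left_mono powr_mono) auto
    finally have pw: "t k powr (\<beta> - 1) \<le> 4 * t n powr (\<beta> - 1)"
      by simp
    have "(real n)\<^sup>2 \<le> (K * real k)\<^sup>2"
      using idx by (intro power_mono) auto
    hence ik: "1 / (real k)\<^sup>2 \<le> K\<^sup>2 / (real n)\<^sup>2"
      using kN nN by (simp add: field_simps power_mult_distrib)
    have "step k * curv k \<le> 2 * K ^ 5 * t k powr (\<beta> - 1) * (1 / (real k)\<^sup>2)"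
      using step_curv_le[OF kN(1)] by simp
    also have "\<dots> \<le> 2 * K ^ 5 * (4 * t n powr (\<beta> - 1)) * (K\<^sup>2 / (real n)\<^sup>2)"
      using pw ik K0 by (intro mult_mono) auto
    also have "\<dots> = 8 * K ^ 7 * t n powr (\<beta> - 1) / (real n)\<^sup>2"
      by (simp add: eval_nat_numeral mult_ac)
    finally have "?lhs \<le> ?B"
      using d0 by (intro mult_right_mono)
    thus ?thesis
      using A0 by simp
  qed
qed

text \<open>The first summand of \<open>truncation_term_le\<close> is a Riemann sum for the integral of
\<open>s powr (\<beta> - \<kappa> - 1)\<close>, which converges at the origin because \<open>\<kappa> < \<beta>\<close>.\<close>

lemma truncation_sum_le:
  assumes p: "p \<in> {1..N}" and n: "n \<in> {p+1..N}"
  shows "(\<Sum>k=p+1..n-1. step k * curv k * (ker n (t k) - ker n (t (k - 1))))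
    \<le> (32 * K ^ 6 / (\<beta> - \<kappa>) + 16 * K ^ 9) / real p * ((t p / t n) powr \<kappa> / t n)"
proof -
  have nN: "n \<in> {1..N}"
    using n by auto
  have tp: "0 < t p" and tn: "0 < t n" and n1: "1 \<le> real n" and p1: "1 \<le> real p"
    using p nN by (auto intro!: t_pos)
  define u where "u = (t p / t n) powr \<kappa>"
  have u: "u = t p powr \<kappa> * t n powr (-\<kappa>)"
    using tp tn by (simp add: u_def powr_divide powr_minus_divide)
  have K0: "0 \<le> K"
    using K_ge by simp
  define A where "A = 32 * K ^ 6 / real p * t p powr \<kappa> * t n powr (-\<beta> - 1)"
  define B where "B = 8 * K ^ 7 * t n powr (\<beta> - 1) / (real n)\<^sup>2"
  have A0: "0 \<le> A" and B0: "0 \<le> B"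
    using K0 by (auto simp: A_def B_def)
  have "(\<Sum>k=p+1..n-1. step k * curv k * (ker n (t k) - ker n (t (k - 1))))
     \<le> (\<Sum>k=p+1..n-1. A * (step k * t k powr (\<beta> - \<kappa> - 1)) + B * (ker n (t k) - ker n (t (k - 1))))"
    unfolding A_def B_def by (intro sum_mono truncation_term_le p n)
  also have "\<dots> = A * (\<Sum>k=p+1..n-1. step k * t k powr (\<beta> - \<kappa> - 1))
      + B * (\<Sum>k=p+1..n-1. ker n (t k) - ker n (t (k - 1)))"
    by (simp add: sum.distrib sum_distrib_left)
  also have "\<dots> \<le> A * (t n powr (\<beta> - \<kappa>) / (\<beta> - \<kappa>)) + B * (2 * K * real n powr \<beta> * t n powr (-\<beta>))"
  proof (intro add_mono mult_left_mono A0 B0)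
    have "(\<Sum>k=p+1..n-1. step k * t k powr (\<beta> - \<kappa> - 1))
        \<le> t (n - 1) powr (\<beta> - \<kappa>) / (\<beta> - \<kappa>) - t p powr (\<beta> - \<kappa>) / (\<beta> - \<kappa>)"
    proof (rule sum_le_telescope)
      fix k assume k: "k \<in> {p+1..n-1}"
      have "t (k - 1) < t k" "0 \<le> t (k - 1)"
        using k n t_le[of 0 "k - 1"] by (auto intro!: t_less)
      hence "(\<beta> - \<kappa>) * t k powr (\<beta> - \<kappa> - 1) * step k \<le> t k powr (\<beta> - \<kappa>) - t (k - 1) powr (\<beta> - \<kappa>)"
        using \<kappa>_less \<kappa>_pos \<beta>_less_1 by (intro powr_diff_ge) auto
      thus "step k * t k powr (\<beta> - \<kappa> - 1)
          \<le> t k powr (\<beta> - \<kappa>) / (\<beta> - \<kappa>) - t (k - 1) powr (\<beta> - \<kappa>) / (\<beta> - \<kappa>)"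
        using \<kappa>_less by (simp add: diff_divide_distrib[symmetric] pos_le_divide_eq mult_ac)
    qed (use n in auto)
    also have "\<dots> \<le> t n powr (\<beta> - \<kappa>) / (\<beta> - \<kappa>) - 0"
      using \<kappa>_less n t_le[of 0 "n - 1"] t_le[of "n - 1" n]
      by (intro diff_mono divide_right_mono powr_mono2) auto
    finally show "(\<Sum>k=p+1..n-1. step k * t k powr (\<beta> - \<kappa> - 1)) \<le> t n powr (\<beta> - \<kappa>) / (\<beta> - \<kappa>)"
      by simp
  next
    have "(\<Sum>k=p+1..n-1. ker n (t k) - ker n (t (k - 1))) \<le> ker n (t (n - 1)) - ker n (t p)"
      by (rule sum_le_telescope) (use n in auto)
    also have "\<dots> \<le> ker n (t (n - 1))"
      by simp
    also have "\<dots> \<le> 2 * K * real n powr \<beta> * t n powr (-\<beta>)"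
      by (rule ker_last_le[OF nN])
    finally show "(\<Sum>k=p+1..n-1. ker n (t k) - ker n (t (k - 1))) \<le> 2 * K * real n powr \<beta> * t n powr (-\<beta>)" .
  qed
  also have "A * (t n powr (\<beta> - \<kappa>) / (\<beta> - \<kappa>)) = 32 * K ^ 6 / (\<beta> - \<kappa>) / real p * (u / t n)"
  proof -
    have "t n powr (-\<beta> - 1) * t n powr (\<beta> - \<kappa>) = t n powr (-\<kappa>) / t n"
    proof -
      have "t n powr (-\<beta> - 1) * t n powr (\<beta> - \<kappa>) = t n powr ((-\<beta> - 1) + (\<beta> - \<kappa>))"
        by (rule powr_add[symmetric])
      also have "(-\<beta> - 1) + (\<beta> - \<kappa>) = -\<kappa> - 1"
        by simp
      also have "t n powr (-\<kappa> - 1) = t n powr (-\<kappa>) / t n powr 1"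
        by (rule powr_diff)
      finally show ?thesis
        using tn by simp
    qed
    hence "t p powr \<kappa> * (t n powr (-\<beta> - 1) * t n powr (\<beta> - \<kappa>)) = u / t n"
      by (simp add: u)
    moreover have "A * (t n powr (\<beta> - \<kappa>) / (\<beta> - \<kappa>))
       = 32 * K ^ 6 / (\<beta> - \<kappa>) / real p * (t p powr \<kappa> * (t n powr (-\<beta> - 1) * t n powr (\<beta> - \<kappa>)))"
      by (simp add: A_def mult_ac)
    ultimately show ?thesis by simp
  qed
  also have "B * (2 * K * real n powr \<beta> * t n powr (-\<beta>)) \<le> 16 * K ^ 9 / real p * (u / t n)"
  proof -
    have e: "t n powr (\<beta> - 1) * t n powr (-\<beta>) = 1 / t n"
      using tn powr_add[of "t n" "\<beta> - 1" "-\<beta>"] powr_minus_divide[of "t n" 1] by simp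
    have "B * (2 * K * real n powr \<beta> * t n powr (-\<beta>))
       = 16 * K ^ 8 / (real n)\<^sup>2 * real n powr \<beta> * (t n powr (\<beta> - 1) * t n powr (-\<beta>))"
      by (simp add: B_def eval_nat_numeral mult_ac)
    also have "\<dots> \<le> 16 * K ^ 8 / (real n)\<^sup>2 * real n * (t n powr (\<beta> - 1) * t n powr (-\<beta>))"
      using K0 powr_index_le[of n] nN by (intro mult_right_mono mult_left_mono) auto
    also have "\<dots> = 16 * K ^ 8 * (1 / real n) / t n"
      unfolding e using n1 by (simp add: power2_eq_square)
    also have "\<dots> \<le> 16 * K ^ 8 * (K / real p * u) / t n"
      unfolding u_def using inverse_index_le[of p n] p n tn K0
      by (intro divide_right_mono mult_left_mono) auto
    also have "\<dots> = 16 * K ^ 9 / real p * (u / t n)"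
      by (simp add: eval_nat_numeral mult_ac)
    finally show ?thesis .
  qed
  finally show ?thesis
    unfolding u_def by (simp add: add_divide_distrib distrib_right)
qed

lemma truncation_last_le:
  assumes p: "p \<in> {1..N}" and n: "n \<in> {p+1..N}"
  shows "curv n * ker_int n n \<le> 2 * K ^ 7 / (1 - \<beta>) / real p * ((t p / t n) powr \<kappa> / t n)"
proof -
  have nN: "n \<in> {1..N}" "n \<in> {2..N}"
    using n p by auto
  have tn: "0 < t n" and n1: "1 \<le> real n" and st: "0 < step n"
    using nN step_pos by (auto intro!: t_pos)
  have K0: "0 \<le> K"
    using K_ge by simp
  have stn: "(\<sigma> * step n) powr (1 - \<beta>) \<le> step n * ((t n / real n) powr (-\<beta>) * K)"
  proof -
    have "(\<sigma> * step n) powr (1 - \<beta>) \<le> (1 * step n) powr (1 - \<beta>)"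
      using \<sigma>_ge \<sigma>_le st \<beta>_less_1 by (intro powr_mono2 mult_right_mono) auto
    also have "\<dots> = step n * step n powr (-\<beta>)"
      using st powr_add[of "step n" 1 "-\<beta>"] by simp
    also have "step n powr (-\<beta>) \<le> (t n / real n / K) powr (-\<beta>)"
      using step_ge[OF nN(1)] K_ge n1 tn \<beta>_pos by (intro powr_mono2') (auto simp: field_simps)
    also have "\<dots> = (t n / real n) powr (-\<beta>) * K powr \<beta>"
      using tn n1 K_ge powr_minus_divide[of K \<beta>] powr_divide[of "t n / real n" K "-\<beta>"] by simp
    also have "\<dots> \<le> (t n / real n) powr (-\<beta>) * K powr 1"
      using K_ge \<beta>_less_1 by (intro mult_left_mono powr_mono) auto
    finally show ?thesis
      using st K_ge by simp
  qed
  have "curv n * ker_int n n = curv n * ((\<sigma> * step n) powr (1 - \<beta>)) / (1 - \<beta>)"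
    by (simp add: ker_int_last[OF nN(1)])
  also have "\<dots> \<le> curv n * (step n * ((t n / real n) powr (-\<beta>) * K)) / (1 - \<beta>)"
    using stn st \<beta>_less_1 by (intro divide_right_mono mult_left_mono) (auto simp: curv_def)
  also have "\<dots> = (step n * curv n) * ((t n / real n) powr (-\<beta>) * K / (1 - \<beta>))"
    by simp
  also have "\<dots> \<le> (2 * K ^ 5 * t n powr (\<beta> - 1) / (real n)\<^sup>2) * ((t n / real n) powr (-\<beta>) * K / (1 - \<beta>))"
    using step_curv_le[OF nN(2)] K0 \<beta>_less_1 by (intro mult_right_mono) auto
  also have "\<dots> = 2 * K ^ 6 / (1 - \<beta>) * (real n powr \<beta> / (real n)\<^sup>2 * (t n powr (\<beta> - 1) * t n powr (-\<beta>)))"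
  proof -
    have "(t n / real n) powr (-\<beta>) = real n powr \<beta> * t n powr (-\<beta>)"
      using tn n1 by (simp add: powr_divide powr_minus field_simps)
    thus ?thesis
      by (simp add: eval_nat_numeral mult_ac)
  qed
  also have "t n powr (\<beta> - 1) * t n powr (-\<beta>) = 1 / t n"
    using tn powr_add[of "t n" "\<beta> - 1" "-\<beta>"] powr_minus_divide[of "t n" 1] by simp
  also have "2 * K ^ 6 / (1 - \<beta>) * (real n powr \<beta> / (real n)\<^sup>2 * (1 / t n))
      \<le> 2 * K ^ 6 / (1 - \<beta>) * (real n / (real n)\<^sup>2 * (1 / t n))"
    using powr_index_le[of n] nN tn K0 \<beta>_less_1 by (intro mult_left_mono mult_right_mono divide_right_mono) auto
  also have "\<dots> = 2 * K ^ 6 / (1 - \<beta>) * (1 / real n * (1 / t n))"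
    using n1 by (simp add: power2_eq_square)
  also have "\<dots> \<le> 2 * K ^ 6 / (1 - \<beta>) * (K / real p * (t p / t n) powr \<kappa> * (1 / t n))"
    using inverse_index_le[of p n] p n tn K0 \<beta>_less_1 by (intro mult_left_mono mult_right_mono) auto
  also have "\<dots> = 2 * K ^ 7 / (1 - \<beta>) / real p * ((t p / t n) powr \<kappa> / t n)"
    by (simp add: eval_nat_numeral mult_ac)
  finally show ?thesis .
qed

text \<open>For \<open>n\<close> close to \<open>p\<close> only the size of the kernel is available, and this case is responsible for the
rate \<open>p powr (\<beta> - 1)\<close>; all other errors are of order \<open>1 / p\<close>.\<close>

lemma truncation_kink_le:
  assumes p: "p \<in> {1..N}" and n: "n \<in> {p+1..N}"
  shows "2 * t p powr (\<beta> - 2) * ker_moment n p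
    \<le> 96 * K ^ 3 * real p powr (\<beta> - 1) * ((t p / t n) powr \<kappa> / t n)"
proof -
  have nN: "n \<in> {1..N}" and pn: "p \<in> {1..n-1}"
    using n p by auto
  have tn: "0 < t n" and tp: "0 < t p" and tpn: "t p \<le> t n" and n1: "1 \<le> real n" and p1: "1 \<le> real p"
    and st: "0 < step p"
    using nN p n step_pos by (auto intro!: t_pos t_le)
  have K0: "0 \<le> K"
    using K_ge by simp
  define u where "u = (t p / t n) powr \<kappa>"
  define d where "d = ker n (t p) - ker n (t (p - 1))"
  have d0: "0 \<le> d"
    using t_before_ts[OF nN, of p] pn st \<beta>_pos by (auto intro!: kernel_mono simp: d_def)
  have pw: "t p powr (\<beta> - 2) * t p = t p powr (\<beta> - 1)" "t p powr (\<beta> - 1) * t p = t p powr \<beta>"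
    using tp powr_add[of "t p" "\<beta> - 2" 1] powr_add[of "t p" "\<beta> - 1" 1] by simp_all
  have "2 * t p powr (\<beta> - 2) * ker_moment n p \<le> 2 * t p powr (\<beta> - 2) * (step p * d)"
    using ker_moment_bounds(2)[OF nN pn] by (intro mult_left_mono) (auto simp: d_def)
  also have "\<dots> \<le> 2 * t p powr (\<beta> - 2) * (K * t p / real p * d)"
    using step_le'[OF p] d0 by (intro mult_left_mono mult_right_mono) auto
  also have "\<dots> = 2 * K / real p * t p powr (\<beta> - 1) * d"
    unfolding pw(1)[symmetric] by simp
  finally have bound: "2 * t p powr (\<beta> - 2) * ker_moment n p \<le> 2 * K / real p * t p powr (\<beta> - 1) * d" .
  have pp: "1 / real p \<le> real p powr (\<beta> - 1)"
    using powr_mono[of "-1" "\<beta> - 1" "real p"] p1 \<beta>_pos by (simp add: powr_minus_divide)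
  show ?thesis
  proof (cases "t p \<le> ts n / 2")
    case True
    have "d \<le> 16 * step p * t n powr (-\<beta> - 1)"
      unfolding d_def by (rule ker_diff_far_le[OF nN pn True])
    also have "\<dots> \<le> 16 * (K * t p / real p) * t n powr (-\<beta> - 1)"
      using step_le'[OF p] by (intro mult_right_mono mult_left_mono) auto
    finally have d: "d \<le> 16 * (K * t p / real p) * t n powr (-\<beta> - 1)" .
    have "2 * K / real p * t p powr (\<beta> - 1) * d
        \<le> 2 * K / real p * t p powr (\<beta> - 1) * (16 * (K * t p / real p) * t n powr (-\<beta> - 1))"
      using d K0 by (intro mult_left_mono) auto
    also have "\<dots> = 32 * K\<^sup>2 * (1 / real p * (1 / real p)) * (t p powr \<beta> * t n powr (-\<beta> - 1))"
      unfolding pw(2)[symmetric] by (simp add: power2_eq_square)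
    also have "\<dots> \<le> 32 * K ^ 3 * (1 * real p powr (\<beta> - 1)) * (u / t n)"
    proof (intro mult_mono)
      have "t p powr \<beta> * t n powr (-\<beta> - 1) = (t p / t n) powr \<beta> / t n"
        using tp tn powr_diff[of "t n" "-\<beta>" 1] powr_divide[of "t p" "t n" \<beta>]
          powr_minus_divide[of "t n" \<beta>] by simp
      also have "(t p / t n) powr \<beta> \<le> u"
        unfolding u_def using tp tn tpn \<kappa>_less by (intro powr_mono') auto
      finally show "t p powr \<beta> * t n powr (-\<beta> - 1) \<le> u / t n"
        using tn by (simp add: divide_right_mono)
      show "K\<^sup>2 \<le> K ^ 3"
        using K_ge by (intro power_increasing) auto
    qed (use pp p1 tn K0 in \<open>auto simp: u_def\<close>)
    also have "\<dots> \<le> 96 * K ^ 3 * real p powr (\<beta> - 1) * (u / t n)"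
      using K0 tn by (intro mult_right_mono) (auto simp: u_def)
    finally show ?thesis
      using bound unfolding u_def by linarith
  next
    case False
    hence near: "t n \<le> 4 * t p"
      using ts_ge_half[OF nN] by simp
    have idx: "real n \<le> K * real p"
      using p n nN near by (intro index_le) auto
    have "d \<le> ker n (t p)"
      by (simp add: d_def)
    also have "\<dots> \<le> ker n (t (n - 1))"
      using n t_le[of p "n - 1"] t_before_ts[OF nN, of "n - 1"] \<beta>_pos by (intro kernel_mono) auto
    also have "\<dots> \<le> 2 * K * real n powr \<beta> * t n powr (-\<beta>)"
      by (rule ker_last_le[OF nN])
    finally have d1: "d \<le> 2 * K * real n powr \<beta> * t n powr (-\<beta>)" .
    have "real n powr \<beta> \<le> (K * real p) powr \<beta>"
      using idx \<beta>_pos by (intro powr_mono2) auto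
    also have "\<dots> = K powr \<beta> * real p powr \<beta>"
      using K0 by (simp add: powr_mult)
    also have "\<dots> \<le> K powr 1 * real p powr \<beta>"
      using K_ge \<beta>_less_1 by (intro mult_right_mono powr_mono) auto
    finally have "real n powr \<beta> \<le> K * real p powr \<beta>"
      using K_ge by simp
    hence "2 * K * real n powr \<beta> * t n powr (-\<beta>) \<le> 2 * K * (K * real p powr \<beta>) * t n powr (-\<beta>)"
      using K0 by (intro mult_right_mono mult_left_mono) auto
    with d1 have d: "d \<le> 2 * K * (K * real p powr \<beta>) * t n powr (-\<beta>)"
      by (rule order_trans)
    have "t p powr (\<beta> - 1) \<le> (t n / 4) powr (\<beta> - 1)"
      using near tn \<beta>_less_1 by (intro powr_mono2') auto
    also have "\<dots> = t n powr (\<beta> - 1) * 4 powr (1 - \<beta>)"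
      using tn powr_minus_divide[of 4 "1 - \<beta>"] by (simp add: powr_divide)
    also have "\<dots> = 4 * t n powr (\<beta> - 1) * 4 powr (-\<beta>)"
      using powr_add[of 4 1 "-\<beta>"] by simp
    also have "\<dots> \<le> 4 * t n powr (\<beta> - 1) * u"
    proof (rule mult_left_mono)
      have "(4::real) powr (-\<beta>) \<le> 4 powr (-\<kappa>)"
        using \<kappa>_less by (intro powr_mono) auto
      also have "\<dots> = (1 / 4) powr \<kappa>"
        by (simp add: powr_divide powr_minus_divide)
      also have "\<dots> \<le> u"
        unfolding u_def using near tn tp \<kappa>_pos by (intro powr_mono2) (auto simp: field_simps)
      finally show "(4::real) powr (-\<beta>) \<le> u" .
    qed auto
    finally have tpw: "t p powr (\<beta> - 1) \<le> 4 * t n powr (\<beta> - 1) * u" .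
    have e: "t n powr (\<beta> - 1) * t n powr (-\<beta>) = 1 / t n"
      using tn powr_add[of "t n" "\<beta> - 1" "-\<beta>"] powr_minus_divide[of "t n" 1] by simp
    have pe: "real p powr \<beta> = real p powr (\<beta> - 1) * real p"
      using p1 powr_add[of "real p" "\<beta> - 1" 1] by simp
    have "2 * K / real p * t p powr (\<beta> - 1) * d
      \<le> 2 * K / real p * (4 * t n powr (\<beta> - 1) * u) * (2 * K * (K * real p powr \<beta>) * t n powr (-\<beta>))"
      using tpw d d0 K0 by (intro mult_mono mult_left_mono) (auto simp: u_def)
    also have "\<dots> = 16 * K ^ 3 * (real p powr \<beta> / real p) * u * (t n powr (\<beta> - 1) * t n powr (-\<beta>))"
      by (simp add: eval_nat_numeral mult_ac)
    also have "\<dots> = 16 * K ^ 3 * real p powr (\<beta> - 1) * (u / t n)"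
      unfolding e pe using p1 by simp
    also have "\<dots> \<le> 96 * K ^ 3 * real p powr (\<beta> - 1) * (u / t n)"
      using K0 tn by (intro mult_right_mono) (auto simp: u_def)
    finally show ?thesis
      using bound unfolding u_def by linarith
  qed
qed

definition trunc_const :: real where
  "trunc_const = 32 * K ^ 6 / (\<beta> - \<kappa>) + 16 * K ^ 9 + 2 * K ^ 7 / (1 - \<beta>) + 96 * K ^ 3"

lemma trunc_const_nonneg: "0 \<le> trunc_const"
  using K_ge \<kappa>_less \<beta>_less_1 by (simp add: trunc_const_def)

lemma D_barrier_after:
  assumes p: "p \<in> {1..N}" and n: "n \<in> {p+1..N}"
  shows "(1 - \<beta>) * t p powr \<beta> * t n powr (- \<beta> - 1)
     - trunc_const * real p powr (\<beta> - 1) * ((t p / t n) powr \<kappa> / t n)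
    \<le> Gamma (1 - \<beta>) * D (barrier p) n"
proof -
  define W where "W = (t p / t n) powr \<kappa> / t n"
  have tn: "0 < t n" and p1: "1 \<le> real p"
    using n p by (auto intro!: t_pos)
  have pp: "1 / real p \<le> real p powr (\<beta> - 1)"
    using powr_mono[of "-1" "\<beta> - 1" "real p"] p1 \<beta>_pos by (simp add: powr_minus_divide)
  have W0: "0 \<le> W"
    using tn by (simp add: W_def)
  have up: "c / real p * W \<le> c * real p powr (\<beta> - 1) * W" if "0 \<le> c" for c
    using mult_right_mono[OF mult_left_mono[OF pp that] W0] by simp
  have "(32 * K ^ 6 / (\<beta> - \<kappa>) + 16 * K ^ 9) / real p * W
      \<le> (32 * K ^ 6 / (\<beta> - \<kappa>) + 16 * K ^ 9) * real p powr (\<beta> - 1) * W"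
    using K_ge \<kappa>_less by (intro up) auto
  moreover have "2 * K ^ 7 / (1 - \<beta>) / real p * W \<le> 2 * K ^ 7 / (1 - \<beta>) * real p powr (\<beta> - 1) * W"
    using K_ge \<beta>_less_1 by (intro up) auto
  moreover have "trunc_const * real p powr (\<beta> - 1) * W =
     (32 * K ^ 6 / (\<beta> - \<kappa>) + 16 * K ^ 9) * real p powr (\<beta> - 1) * W
     + 2 * K ^ 7 / (1 - \<beta>) * real p powr (\<beta> - 1) * W + 96 * K ^ 3 * real p powr (\<beta> - 1) * W"
    by (simp only: trunc_const_def distrib_right)
  ultimately show ?thesis
    using D_barrier_after_raw[OF p n] truncation_sum_le[OF p n] truncation_last_le[OF p n]
      truncation_kink_le[OF p n]
    unfolding W_def[symmetric] by linarith
qed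

end

section \<open>Discrete Green functions\<close>

context alikhanov_mesh
begin

text \<open>The choice among solutions concerns only the values beyond the index \<open>N\<close>, which are unspecified.\<close>

definition green :: "nat \<Rightarrow> nat \<Rightarrow> real" where
  "green p = (SOME w. w 0 = 0 \<and>
     (\<forall>n\<in>{1..N}. D w n = (if p \<le> n then t p powr \<beta> * t n powr (-\<beta> - 1) else 0)))"

lemma green_0 [simp]: "green p 0 = 0"
  and D_green: "n \<in> {1..N} \<Longrightarrow> D (green p) n = (if p \<le> n then t p powr \<beta> * t n powr (-\<beta> - 1) else 0)"
proof -
  have "green p 0 = 0 \<and>
     (\<forall>n\<in>{1..N}. D (green p) n = (if p \<le> n then t p powr \<beta> * t n powr (-\<beta> - 1) else 0))"
    unfolding green_def by (rule someI_ex[OF ex_solution])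
  thus "green p 0 = 0"
    "n \<in> {1..N} \<Longrightarrow> D (green p) n = (if p \<le> n then t p powr \<beta> * t n powr (-\<beta> - 1) else 0)"
    by auto
qed

lemma D_green_nonneg: "n \<in> {1..N} \<Longrightarrow> 0 \<le> D (green p) n"
  by (simp add: D_green)

lemma green_nonneg: "j \<le> N \<Longrightarrow> 0 \<le> green p j"
proof -
  assume j: "j \<le> N"
  have "(\<lambda>_. 0) j \<le> green p j"
  proof (rule comparison[OF order_refl _ _ j])
    fix n assume n: "n \<in> {1..N}"
    show "D (\<lambda>_. 0) n \<le> D (green p) n"
      using D_green_nonneg[OF n] D_cmult[OF n, of 0 "\<lambda>_. 0"] by simp
  qed simp
  thus ?thesis .
qed

lemma last_index_before_time:
  assumes j: "j \<in> {1..N}" and c: "0 \<le> c" "c < t j"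
  obtains m where "m < j" "t m \<le> c" "\<And>q. m < q \<Longrightarrow> q \<le> N \<Longrightarrow> c < t q"
proof -
  define l where "l = (LEAST q. c < t q)"
  have l: "c < t l" "l \<le> j"
    using c unfolding l_def by (auto intro: LeastI Least_le)
  have l0: "l \<noteq> 0"
    using l c by (auto intro: ccontr)
  have "t (l - 1) \<le> c"
    using not_less_Least[of "l - 1" "\<lambda>q. c < t q"] l0 unfolding l_def[symmetric] by auto
  moreover have "c < t q" if "l - 1 < q" "q \<le> N" for q
  proof -
    have "t l \<le> t q"
      using that by (intro t_le) auto
    thus ?thesis
      using l by simp
  qed
  ultimately show ?thesis
    using l l0 by (intro that[of "l - 1"]) auto
qed

lemma sum_step: "a \<le> b \<Longrightarrow> (\<Sum>q=a+1..b. step q) = t b - t a"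
  by (induction b rule: dec_induct) auto

lemma D_green_near_ge:
  assumes j: "j \<in> {1..N}" and q: "1 \<le> q" "q \<le> j" and near: "t j \<le> 2 * t q"
  shows "1 / (2 * t j) \<le> D (green q) j"
proof -
  have tj: "0 < t j" and tq: "0 < t q"
    using j q by (auto intro!: t_pos)
  have "1 / 2 = (1 / 2 :: real) powr 1"
    by simp
  also have "\<dots> \<le> (1 / 2) powr \<beta>"
    using \<beta>_less_1 by (intro powr_mono') auto
  also have "\<dots> \<le> (t q / t j) powr \<beta>"
    using near tj \<beta>_pos by (intro powr_mono2) (auto simp: field_simps)
  finally have "1 / 2 / t j \<le> (t q / t j) powr \<beta> / t j"
    using tj by (intro divide_right_mono) auto
  also have "\<dots> = t q powr \<beta> * t j powr (-\<beta> - 1)"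
    using tj tq powr_diff[of "t j" "-\<beta>" 1] powr_divide[of "t q" "t j" \<beta>] powr_minus_divide[of "t j" \<beta>]
    by simp
  finally show ?thesis
    using q by (simp add: D_green[OF j])
qed

text \<open>Only the indices \<open>q \<le> j\<close> with \<open>t q\<close> in the upper half of \<open>[0, t j]\<close> are used: there \<open>f q\<close> is
comparable to \<open>f j\<close> and \<open>D (green q) j\<close> to \<open>1 / t j\<close>, and the steps add up to at least \<open>t j / 2\<close>.\<close>

lemma D_superposition_ge:
  assumes j: "j \<in> {1..N}" and Q: "Q \<subseteq> {1..N}" and f: "\<And>q. q \<in> Q \<Longrightarrow> 0 \<le> f q" and L: "0 < L" and fj: "0 \<le> f j"
    and window: "\<And>q. 1 \<le> q \<Longrightarrow> q \<le> j \<Longrightarrow> t j < 2 * t q \<Longrightarrow> q \<in> Q \<and> f j \<le> L * f q"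
  shows "f j / (4 * L) \<le> D (\<lambda>k. \<Sum>q\<in>Q. step q * f q * green q k) j"
proof -
  have tj: "0 < t j"
    using j t_pos by auto
  obtain m where m: "m < j" "t m \<le> t j / 2" "\<And>q. m < q \<Longrightarrow> q \<le> N \<Longrightarrow> t j / 2 < t q"
    using last_index_before_time[OF j, of "t j / 2"] tj by auto
  have sub: "{m+1..j} \<subseteq> Q"
  proof
    fix q assume q: "q \<in> {m+1..j}"
    hence "t j < 2 * t q"
      using m(3)[of q] j by auto
    thus "q \<in> Q"
      using window[of q] q by auto
  qed
  have "f j / (4 * L) = t j / 2 * (f j / L * (1 / (2 * t j)))"
    using tj by simp
  also have "\<dots> \<le> (t j - t m) * (f j / L * (1 / (2 * t j)))"
    using m(2) tj fj L by (intro mult_right_mono) auto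
  also have "\<dots> = (\<Sum>q=m+1..j. step q * (f j / L * (1 / (2 * t j))))"
    by (simp only: sum_distrib_right[symmetric] sum_step[OF less_imp_le[OF m(1)]])
  also have "\<dots> \<le> (\<Sum>q=m+1..j. step q * (f q * D (green q) j))"
  proof (intro sum_mono mult_left_mono mult_mono)
    fix q assume q: "q \<in> {m+1..j}"
    hence near: "t j < 2 * t q"
      using m(3)[of q] j by auto
    show "f j / L \<le> f q"
      using window[of q] near q L by (auto simp: field_simps)
    show "1 / (2 * t j) \<le> D (green q) j"
      using near q by (intro D_green_near_ge j) auto
    show "0 \<le> f q"
      using sub q f by auto
    show "0 \<le> step q"
      using step_pos[of q] q j by auto
  qed (use tj in auto)
  also have "\<dots> \<le> (\<Sum>q\<in>Q. step q * (f q * D (green q) j))"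
  proof (intro sum_mono2 sub mult_nonneg_nonneg)
    show "finite Q"
      using Q finite_subset by blast
    fix q assume "q \<in> Q - {m+1..j}"
    hence "q \<in> Q" "q \<in> {1..N}"
      using Q by auto
    thus "0 \<le> f q" "0 \<le> D (green q) j" "0 \<le> step q"
      using f step_pos[of q] D_green_nonneg[OF j] by auto
  qed
  also have "\<dots> = D (\<lambda>k. \<Sum>q\<in>Q. step q * f q * green q k) j"
    by (simp add: D_sum[OF j] D_cmult[OF j] mult.assoc)
  finally show ?thesis .
qed

end

context graded_mesh
begin

text \<open>The shape of the truncation error of the barrier with kink \<open>p\<close>, without its small factor.\<close>

definition error_weight :: "nat \<Rightarrow> nat \<Rightarrow> real" where
  "error_weight p q = (t p / t q) powr \<kappa> / t q"

text \<open>The summand for \<open>q = p + 1\<close> is there for the times up to \<open>2 * t p\<close>, where the upper half of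
\<open>[0, t n]\<close> is not contained in the range \<open>q > p\<close> and the superposition alone may be too small.\<close>

definition correction_weight :: "nat \<Rightarrow> nat \<Rightarrow> real" where
  "correction_weight p q = 4 * (step q * error_weight p q + of_bool (q = p + 1))"

definition correction :: "nat \<Rightarrow> nat \<Rightarrow> real" where
  "correction p k = (\<Sum>q=p+1..N. correction_weight p q * green q k)"

definition corrected_barrier :: "nat \<Rightarrow> nat \<Rightarrow> real" where
  "corrected_barrier p k = Gamma (1 - \<beta>) * barrier p k
     + trunc_const * real p powr (\<beta> - 1) * correction p k"

lemma error_weight_nonneg: "q \<le> N \<Longrightarrow> 0 \<le> error_weight p q"
  using t_le[of 0 q] by (simp add: error_weight_def)

lemma error_weight_antimono:
  assumes "1 \<le> p" "p \<le> N" "1 \<le> q" "q \<le> j" "j \<le> N"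
  shows "error_weight p j \<le> error_weight p q"
proof -
  have "0 < t p" "0 < t q" "t q \<le> t j"
    using assms by (auto intro!: t_pos t_le)
  thus ?thesis
    unfolding error_weight_def using \<kappa>_pos
    by (intro frac_le powr_mono2 divide_left_mono) auto
qed

lemma sum_error_weight_le:
  assumes p: "p \<in> {1..N}"
  shows "(\<Sum>q=p+1..N. step q * error_weight p q) \<le> 1 / \<kappa>"
proof -
  have tp: "0 < t p"
    using p t_pos by auto
  have "(\<Sum>q=p+1..N. step q * error_weight p q)
      \<le> - (t p powr \<kappa> * t N powr (-\<kappa>) / \<kappa>) - - (t p powr \<kappa> * t p powr (-\<kappa>) / \<kappa>)"
  proof (rule sum_le_telescope)
    fix q assume q: "q \<in> {p+1..N}"
    have tq: "0 < t (q - 1)" "t (q - 1) < t q"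
      using q p by (auto intro!: t_pos t_less)
    have "error_weight p q = t p powr \<kappa> * t q powr (-\<kappa> - 1)"
      using tp tq powr_diff[of "t q" "-\<kappa>" 1] powr_divide[of "t p" "t q" \<kappa>] powr_minus_divide[of "t q" \<kappa>]
      by (simp add: error_weight_def)
    hence "step q * error_weight p q = t p powr \<kappa> * (\<kappa> * t q powr (-\<kappa> - 1) * step q) / \<kappa>"
      using \<kappa>_pos by simp
    also have "\<dots> \<le> t p powr \<kappa> * (t (q - 1) powr (-\<kappa>) - t q powr (-\<kappa>)) / \<kappa>"
      using tq \<kappa>_pos powr_diff_neg_ge[of "t (q - 1)" "t q" \<kappa>] by (intro divide_right_mono mult_left_mono) auto
    also have "\<dots> = - (t p powr \<kappa> * t q powr (-\<kappa>) / \<kappa>) - - (t p powr \<kappa> * t (q - 1) powr (-\<kappa>) / \<kappa>)"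
      by (simp add: right_diff_distrib diff_divide_distrib)
    finally show "step q * error_weight p q \<le> \<dots>" .
  qed (use p in auto)
  also have "\<dots> \<le> 1 / \<kappa>"
    using tp \<kappa>_pos by (simp add: powr_minus_divide)
  finally show ?thesis .
qed

lemma correction_weight_nonneg: "q \<in> {1..N} \<Longrightarrow> 0 \<le> correction_weight p q"
  using step_pos[of q] error_weight_nonneg[of q p] by (auto simp: correction_weight_def)

lemma sum_correction_weight_le:
  assumes p: "p \<in> {1..N}"
  shows "(\<Sum>q=p+1..N. correction_weight p q) \<le> 4 + 4 / \<kappa>"
proof -
  have "(\<Sum>q=p+1..N. correction_weight p q) =
      4 * ((\<Sum>q=p+1..N. step q * error_weight p q) + (\<Sum>q=p+1..N. of_bool (q = p + 1)))"
    by (simp add: correction_weight_def sum_distrib_left sum.distrib)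
  also have "(\<Sum>q=p+1..N. of_bool (q = p + 1)) \<le> (1::real)"
    by (simp add: of_bool_def)
  finally show ?thesis
    using sum_error_weight_le[OF p] by simp
qed

lemma D_correction: "n \<in> {1..N} \<Longrightarrow>
    D (correction p) n = (\<Sum>q=p+1..N. correction_weight p q * D (green q) n)"
  unfolding correction_def by (simp add: D_sum D_cmult)

lemma D_correction_nonneg: "n \<in> {1..N} \<Longrightarrow> 0 \<le> D (correction p) n"
  unfolding D_correction
  by (intro sum_nonneg mult_nonneg_nonneg correction_weight_nonneg D_green_nonneg) auto

text \<open>Hence adding a small multiple of \<open>correction p\<close> to the barrier compensates its truncation error.\<close>

lemma error_weight_le_D:
  assumes p: "p \<in> {1..N}" and n: "n \<in> {p+1..N}"
  shows "error_weight p n \<le> D (correction p) n"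
proof -
  have nN: "n \<in> {1..N}"
    using n by auto
  have tp: "0 < t p" and tn: "0 < t n" and tpn: "t p \<le> t n"
    using p n by (auto intro!: t_pos t_le)
  show ?thesis
  proof (cases "t n \<le> 2 * t p")
    case True
    have "(t p / t n) powr \<kappa> \<le> 1"
      using tp tn tpn \<kappa>_pos by (intro powr_le1) auto
    hence "error_weight p n \<le> 1 / t n"
      unfolding error_weight_def using tn by (intro divide_right_mono) auto
    also have "1 / t n = 2 * (1 / (2 * t n))"
      by simp
    also have "\<dots> \<le> correction_weight p (p + 1) * D (green (p + 1)) n"
    proof (rule mult_mono)
      have "t p \<le> t (p + 1)"
        using n by (intro t_le) auto
      thus "1 / (2 * t n) \<le> D (green (p + 1)) n"
        using True n by (intro D_green_near_ge nN) auto
      have "0 \<le> step (p + 1) * error_weight p (p + 1)"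
        using n \<open>t p \<le> t (p + 1)\<close> by (intro mult_nonneg_nonneg error_weight_nonneg) auto
      thus "2 \<le> correction_weight p (p + 1)" "0 \<le> correction_weight p (p + 1)"
        by (simp_all add: correction_weight_def)
    qed (use tn in auto)
    also have "\<dots> \<le> D (correction p) n"
      unfolding D_correction[OF nN] using n
      by (intro member_le_sum mult_nonneg_nonneg correction_weight_nonneg D_green_nonneg nN) auto
    finally show ?thesis .
  next
    case False
    have "error_weight p n / (4 * 1) \<le> D (\<lambda>k. \<Sum>q=p+1..N. step q * error_weight p q * green q k) n"
    proof (rule D_superposition_ge[OF nN])
      show "{p+1..N} \<subseteq> {1..N}"
        by auto
      fix q assume q: "1 \<le> q" "q \<le> n" "t n < 2 * t q"
      have "t p < t q"
        using q False by linarith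
      hence "p < q"
        using t_less_iff[of p q] p n q by auto
      thus "q \<in> {p+1..N} \<and> error_weight p n \<le> 1 * error_weight p q"
        using q n p error_weight_antimono[of p q n] by auto
    qed (use error_weight_nonneg nN in auto)
    also have "\<dots> = (\<Sum>q=p+1..N. step q * error_weight p q * D (green q) n)"
      by (simp add: D_sum[OF nN] D_cmult[OF nN])
    also have "\<dots> \<le> (\<Sum>q=p+1..N. correction_weight p q / 4 * D (green q) n)"
      by (intro sum_mono mult_right_mono D_green_nonneg nN) (simp add: correction_weight_def)
    also have "\<dots> = D (correction p) n / 4"
      unfolding D_correction[OF nN] by (simp add: sum_divide_distrib)
    finally show ?thesis
      by simp
  qed
qed

lemma D_corrected_barrier:
  assumes n: "n \<in> {1..N}"
  shows "D (corrected_barrier p) n = Gamma (1 - \<beta>) * D (barrier p) n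
     + trunc_const * real p powr (\<beta> - 1) * D (correction p) n"
  unfolding corrected_barrier_def using n by (simp only: D_add D_cmult)

lemma D_corrected_barrier_after:
  assumes p: "p \<in> {1..N}" and n: "n \<in> {p+1..N}"
  shows "(1 - \<beta>) * t p powr \<beta> * t n powr (- \<beta> - 1) \<le> D (corrected_barrier p) n"
proof -
  have nN: "n \<in> {1..N}"
    using n by auto
  have "trunc_const * real p powr (\<beta> - 1) * error_weight p n
      \<le> trunc_const * real p powr (\<beta> - 1) * D (correction p) n"
    using error_weight_le_D[OF p n] trunc_const_nonneg by (intro mult_left_mono) auto
  thus ?thesis
    using D_barrier_after[OF p n] unfolding D_corrected_barrier[OF nN] error_weight_def[symmetric] by linarith
qed

lemma D_corrected_barrier_before:
  assumes p: "p \<in> {1..N}" and n: "n \<in> {1..p}"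
  shows "(t n / t p) powr (2 - \<beta>) / (2 * t n) \<le> D (corrected_barrier p) n"
proof -
  have nN: "n \<in> {1..N}"
    using n p by auto
  have tp: "0 < t p" and tn: "0 < t n"
    using p n by (auto intro!: t_pos)
  have "0 \<le> trunc_const * real p powr (\<beta> - 1) * D (correction p) n"
    using trunc_const_nonneg D_correction_nonneg[OF nN] by (intro mult_nonneg_nonneg) auto
  moreover have "Gamma (1 - \<beta>) * (t n powr (1 - \<beta>) * t p powr (\<beta> - 2) / (2 * Gamma (1 - \<beta>)))
      \<le> Gamma (1 - \<beta>) * D (barrier p) n"
    using D_barrier_before[OF p n] Gamma_pos by (intro mult_left_mono) auto
  moreover have "Gamma (1 - \<beta>) * (t n powr (1 - \<beta>) * t p powr (\<beta> - 2) / (2 * Gamma (1 - \<beta>)))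
      = t n powr (1 - \<beta>) * t p powr (\<beta> - 2) / 2"
    using Gamma_pos by simp
  moreover have "t n powr (1 - \<beta>) * t p powr (\<beta> - 2) / 2 = (t n / t p) powr (2 - \<beta>) / (2 * t n)"
  proof -
    have "t n powr (2 - \<beta>) = t n powr (1 - \<beta>) * t n"
      using tn powr_add[of "t n" "1 - \<beta>" 1] by simp
    moreover have "(t n / t p) powr (2 - \<beta>) = t n powr (2 - \<beta>) * t p powr (\<beta> - 2)"
      using tn tp powr_divide[of "t n" "t p" "2 - \<beta>"] powr_minus_divide[of "t p" "2 - \<beta>"] by simp
    ultimately show ?thesis
      using tn by simp
  qed
  ultimately show ?thesis
    unfolding D_corrected_barrier[OF nN] by linarith
qed

lemma corrected_barrier_le:
  assumes p: "p \<in> {1..N}" and j: "j \<in> {1..N}" and M0: "0 \<le> M"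
    and M: "\<And>q. q \<in> {p+1..N} \<Longrightarrow> green q j \<le> M * t j powr (\<beta> - 1)"
  shows "corrected_barrier p j
    \<le> (Gamma (1 - \<beta>) + trunc_const * real p powr (\<beta> - 1) * (4 + 4 / \<kappa>) * M) * t j powr (\<beta> - 1)"
proof -
  define P where "P = t j powr (\<beta> - 1)"
  have "correction p j \<le> (\<Sum>q=p+1..N. correction_weight p q * (M * P))"
    unfolding correction_def P_def
    by (intro sum_mono mult_left_mono M correction_weight_nonneg) auto
  also have "\<dots> = (\<Sum>q=p+1..N. correction_weight p q) * (M * P)"
    by (simp add: sum_distrib_right)
  also have "\<dots> \<le> (4 + 4 / \<kappa>) * (M * P)"
    using sum_correction_weight_le[OF p] M0 by (intro mult_right_mono) (auto simp: P_def)
  finally have "trunc_const * real p powr (\<beta> - 1) * correction p j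
      \<le> trunc_const * real p powr (\<beta> - 1) * ((4 + 4 / \<kappa>) * (M * P))"
    using trunc_const_nonneg by (intro mult_left_mono) auto
  moreover have "Gamma (1 - \<beta>) * barrier p j \<le> Gamma (1 - \<beta>) * P"
    unfolding P_def using barrier_le[OF p j] Gamma_pos by (intro mult_left_mono) auto
  ultimately show ?thesis
    unfolding corrected_barrier_def P_def[symmetric] by (simp add: distrib_right mult.assoc)
qed

lemma corrected_barrier_0 [simp]: "corrected_barrier p 0 = 0"
  by (simp add: corrected_barrier_def correction_def)

text \<open>A barrier with a later kink \<open>P\<close> also dominates \<open>green p\<close>, at the price of the factor \<open>\<rho>\<close>, which
measures how far \<open>t p\<close> lies below \<open>t P\<close>. This serves the small indices \<open>p\<close>, for which the truncation
error of their own barrier is not small.\<close>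

lemma green_le_corrected_barrier:
  assumes p: "p \<in> {1..N}" and P: "P \<in> {p..N}" and \<rho>: "0 < \<rho>" "\<rho> \<le> 1"
    and close: "\<And>n. n \<in> {p..P} \<Longrightarrow> \<rho> \<le> (t n / t P) powr (2 - \<beta>)" and j: "j \<in> {1..N}"
  shows "\<rho> * (1 - \<beta>) / 2 * green p j \<le> corrected_barrier P j"
proof (rule comparison[OF order_refl, of "\<lambda>j. \<rho> * (1 - \<beta>) / 2 * green p j"])
  fix n assume n: "n \<in> {1..N}"
  have PN: "P \<in> {1..N}"
    using p P by auto
  have tn: "0 < t n" and tp: "0 < t p" and tpP: "t p \<le> t P"
    using n p P by (auto intro!: t_pos t_le)
  have \<rho>': "\<rho> * (1 - \<beta>) / 2 \<le> \<rho> / 2" "\<rho> * (1 - \<beta>) / 2 \<le> 1 - \<beta>"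
  proof -
    show "\<rho> * (1 - \<beta>) / 2 \<le> \<rho> / 2"
      using \<rho> \<beta>_pos \<beta>_less_1 by (intro divide_right_mono mult_left_le) auto
    have "\<rho> * (1 - \<beta>) / 2 \<le> 1 * (1 - \<beta>) / 2"
      using \<rho> \<beta>_less_1 by (intro divide_right_mono mult_right_mono) auto
    also have "\<dots> \<le> 1 - \<beta>"
      using \<beta>_less_1 by simp
    finally show "\<rho> * (1 - \<beta>) / 2 \<le> 1 - \<beta>" .
  qed
  have "\<rho> * (1 - \<beta>) / 2 * D (green p) n \<le> D (corrected_barrier P) n"
  proof (cases "n \<le> P")
    case True
    have "\<rho> * (1 - \<beta>) / 2 * D (green p) n \<le> (t n / t P) powr (2 - \<beta>) / (2 * t n)"
    proof (cases "p \<le> n")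
      case True
      have "t p powr \<beta> * t n powr (-\<beta> - 1) \<le> t n powr \<beta> * t n powr (-\<beta> - 1)"
        using True tp n \<beta>_pos by (intro mult_right_mono powr_mono2 t_le) auto
      also have "\<dots> = 1 / t n"
        using tn powr_add[of "t n" "\<beta>" "-\<beta> - 1"] powr_minus_divide[of "t n" 1] by simp
      finally have "\<rho> * (1 - \<beta>) / 2 * D (green p) n \<le> \<rho> / 2 * (1 / t n)"
        using True \<rho> \<rho>' \<beta>_less_1 unfolding D_green[OF n] by (intro mult_mono) auto
      also have "\<dots> \<le> (t n / t P) powr (2 - \<beta>) / 2 * (1 / t n)"
        using close[of n] True \<open>n \<le> P\<close> tn by (intro mult_right_mono divide_right_mono) auto
      finally show ?thesis
        by simp
    qed (use tn in \<open>simp add: D_green[OF n]\<close>)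
    thus ?thesis
      using D_corrected_barrier_before[OF PN, of n] n True by auto
  next
    case False
    have "t p powr \<beta> * t n powr (-\<beta> - 1) \<le> t P powr \<beta> * t n powr (-\<beta> - 1)"
      using tp tpP \<beta>_pos by (intro mult_right_mono powr_mono2) auto
    hence "\<rho> * (1 - \<beta>) / 2 * (t p powr \<beta> * t n powr (-\<beta> - 1)) \<le> (1 - \<beta>) * (t P powr \<beta> * t n powr (-\<beta> - 1))"
      using \<beta>_less_1 by (intro mult_mono[OF \<rho>'(2)]) auto
    thus ?thesis
      using D_corrected_barrier_after[OF PN, of n] False n P by (auto simp: D_green[OF n] mult.assoc)
  qed
  thus "D (\<lambda>j. \<rho> * (1 - \<beta>) / 2 * green p j) n \<le> D (corrected_barrier P) n"
    by (simp only: D_cmult[OF n])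
qed (use j in auto)

text \<open>From this index on the correction is absorbed in \<open>green_le_late\<close>. The index depends on \<open>\<beta>\<close>, \<open>K\<close>
and \<open>\<kappa>\<close> only.\<close>

definition first_index :: nat where
  "first_index = (SOME m. 1 \<le> m \<and> trunc_const * real m powr (\<beta> - 1) * (4 + 4 / \<kappa>) \<le> (1 - \<beta>) / 4)"

lemma first_index: "1 \<le> first_index"
    "trunc_const * real first_index powr (\<beta> - 1) * (4 + 4 / \<kappa>) \<le> (1 - \<beta>) / 4"
proof -
  have "((\<lambda>m. trunc_const * real m powr (\<beta> - 1) * (4 + 4 / \<kappa>)) \<longlongrightarrow> trunc_const * 0 * (4 + 4 / \<kappa>)) sequentially"
    using \<beta>_less_1 by (intro tendsto_intros tendsto_neg_powr filterlim_real_sequentially) auto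
  moreover have "trunc_const * 0 * (4 + 4 / \<kappa>) < (1 - \<beta>) / 4"
    using \<beta>_less_1 by simp
  ultimately have "eventually (\<lambda>m. trunc_const * real m powr (\<beta> - 1) * (4 + 4 / \<kappa>) < (1 - \<beta>) / 4) sequentially"
    by (rule order_tendstoD)
  with eventually_ge_at_top[of 1]
  have "eventually (\<lambda>m. 1 \<le> m \<and> trunc_const * real m powr (\<beta> - 1) * (4 + 4 / \<kappa>) \<le> (1 - \<beta>) / 4) sequentially"
    by eventually_elim auto
  hence "\<exists>m. 1 \<le> m \<and> trunc_const * real m powr (\<beta> - 1) * (4 + 4 / \<kappa>) \<le> (1 - \<beta>) / 4"
    using eventually_happens' sequentially_bot by blast
  from someI_ex[OF this] show "1 \<le> first_index"
    "trunc_const * real first_index powr (\<beta> - 1) * (4 + 4 / \<kappa>) \<le> (1 - \<beta>) / 4"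
    unfolding first_index_def by auto
qed

lemma trunc_factor_le:
  assumes "first_index \<le> p"
  shows "trunc_const * real p powr (\<beta> - 1) * (4 + 4 / \<kappa>) \<le> (1 - \<beta>) / 4"
proof -
  have "real p powr (\<beta> - 1) \<le> real first_index powr (\<beta> - 1)"
    using assms first_index \<beta>_less_1 by (intro powr_mono2') auto
  hence "trunc_const * real p powr (\<beta> - 1) * (4 + 4 / \<kappa>) \<le> trunc_const * real first_index powr (\<beta> - 1) * (4 + 4 / \<kappa>)"
    using trunc_const_nonneg \<kappa>_pos by (intro mult_left_mono mult_right_mono) auto
  thus ?thesis
    using first_index by linarith
qed

text \<open>The corrected barrier is itself bounded by the functions \<open>green q\<close>, \<open>q > p\<close>. On a fixed mesh there
is a best constant \<open>M\<close> valid for all of them at once, and the comparison with the corrected barrier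
gives \<open>(1 - \<beta>) / 2 * M \<le> Gamma (1 - \<beta>) + (1 - \<beta>) / 4 * M\<close>.\<close>

lemma green_le_late:
  assumes p: "p \<in> {first_index..N}" and j: "j \<in> {1..N}"
  shows "green p j \<le> 4 * Gamma (1 - \<beta>) / (1 - \<beta>) * t j powr (\<beta> - 1)"
proof -
  define I where "I = {first_index..N} \<times> {1..N}"
  define R where "R = (\<lambda>(q, i). green q i / t i powr (\<beta> - 1))"
  define M where "M = Max (R ` I)"
  have fin: "finite I" "I \<noteq> {}"
    using p j by (auto simp: I_def)
  have tpow: "0 < t i powr (\<beta> - 1)" if "i \<in> {1..N}" for i
    using t_pos[of i] that by auto
  have M: "green q i \<le> M * t i powr (\<beta> - 1)" if "q \<in> {first_index..N}" "i \<in> {1..N}" for q i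
  proof -
    have "R (q, i) \<le> M"
      unfolding M_def using fin that by (intro Max_ge) (auto simp: I_def)
    thus ?thesis
      using tpow[OF that(2)] by (simp add: R_def pos_divide_le_eq)
  qed
  have M0: "0 \<le> M"
  proof -
    have "0 \<le> M * t j powr (\<beta> - 1)"
      using M[OF p j] green_nonneg[of j p] j by auto
    thus ?thesis
      using tpow[OF j] by (simp add: zero_le_mult_iff)
  qed
  have "M \<in> R ` I"
    unfolding M_def using fin by (intro Max_in) auto
  then obtain q i where qi: "q \<in> {first_index..N}" "i \<in> {1..N}" "M = R (q, i)"
    by (auto simp: I_def)
  have qN: "q \<in> {1..N}"
    using qi first_index by auto
  have "1 * (1 - \<beta>) / 2 * green q i \<le> corrected_barrier q i"
    using t_pos[of q] qN qi by (intro green_le_corrected_barrier) auto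
  also have "\<dots> \<le> (Gamma (1 - \<beta>) + trunc_const * real q powr (\<beta> - 1) * (4 + 4 / \<kappa>) * M) * t i powr (\<beta> - 1)"
    using qi M M0 by (intro corrected_barrier_le qN) auto
  also have "\<dots> \<le> (Gamma (1 - \<beta>) + (1 - \<beta>) / 4 * M) * t i powr (\<beta> - 1)"
    using trunc_factor_le[of q] qi M0 by (intro mult_right_mono add_left_mono) auto
  also have "green q i = M * t i powr (\<beta> - 1)"
    using qi(3) tpow[OF qi(2)] by (simp add: R_def)
  finally have "(1 - \<beta>) / 2 * M * t i powr (\<beta> - 1) \<le> (Gamma (1 - \<beta>) + (1 - \<beta>) / 4 * M) * t i powr (\<beta> - 1)"
    by simp
  hence "(1 - \<beta>) / 2 * M \<le> Gamma (1 - \<beta>) + (1 - \<beta>) / 4 * M"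
    using tpow[OF qi(2)] by (simp only: mult_le_cancel_right_pos)
  hence "(1 - \<beta>) * M \<le> 4 * Gamma (1 - \<beta>)"
    by (simp add: field_simps)
  hence "M \<le> 4 * Gamma (1 - \<beta>) / (1 - \<beta>)"
    using \<beta>_less_1 by (simp add: pos_le_divide_eq mult.commute)
  thus ?thesis
    using M[OF p j] tpow[OF j] by (meson mult_right_mono less_imp_le order_trans)
qed

definition green_const :: real where
  "green_const = 4 * Gamma (1 - \<beta>) / ((K * real first_index) powr (- (2 / \<kappa>)) * (1 - \<beta>))"

text \<open>For \<open>p\<close> below \<open>first_index\<close> the barrier with kink \<open>min first_index N\<close> is used. If this minimum is
\<open>N\<close>, the mesh ends at the kink, the correction is an empty sum, and \<open>green_le_late\<close> is not invoked.\<close>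

theorem green_le:
  assumes p: "p \<in> {1..N}" and j: "j \<in> {1..N}"
  shows "green p j \<le> green_const * t j powr (\<beta> - 1)"
proof -
  \<comment> \<open>If \<open>p \<le> n \<le> P \<le> first_index\<close>, then \<open>t n / t P\<close> is at least \<open>1 / (K * first_index)\<close> to the
power \<open>1 / \<kappa>\<close>, and \<open>2 - \<beta> \<le> 2\<close>.\<close>
  define \<rho> where "\<rho> = (K * real first_index) powr (- (2 / \<kappa>))"
  define P where "P = max p (min first_index N)"
  have P: "P \<in> {p..N}" "P \<in> {1..N}"
    using p by (auto simp: P_def)
  have Kf: "1 \<le> K * real first_index"
    using K_ge first_index(1) mult_mono[of 1 K 1 "real first_index"] by simp
  have \<rho>: "0 < \<rho>" "\<rho> \<le> 1"
  proof -
    have "0 < K * real first_index"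
      using Kf by linarith
    moreover have "(K * real first_index) powr (- (2 / \<kappa>)) \<le> (K * real first_index) powr 0"
      using Kf \<kappa>_pos by (intro powr_mono) auto
    ultimately show "0 < \<rho>" "\<rho> \<le> 1"
      by (simp_all add: \<rho>_def del: powr_zero_eq_one) (auto split: if_splits)
  qed
  have tj: "0 < t j powr (\<beta> - 1)"
    using t_pos[of j] j by auto
  have close: "\<rho> \<le> (t n / t P) powr (2 - \<beta>)" if n: "n \<in> {p..P}" for n
  proof -
    have tn: "0 < t n" and tP: "0 < t P" and tnP: "t n \<le> t P"
      using n p P by (auto intro!: t_pos t_le)
    show ?thesis
    proof (cases "n = P")
      case True
      thus ?thesis
        using \<rho> tP by simp
    next
      case False
      hence Pf: "P \<le> first_index"
        using n by (auto simp: P_def max_def split: if_splits)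
      have "1 / real P \<le> K * (t n / t P) powr \<kappa>"
      proof -
        have "1 / real P \<le> real n / real P"
          using n p by (intro divide_right_mono) auto
        also have "\<dots> \<le> K * (t n / t P) powr \<kappa>"
          using n p P by (intro index_ratio_le) auto
        finally show ?thesis .
      qed
      hence "1 / (K * real P) \<le> (t n / t P) powr \<kappa>"
        using K_ge P by (simp add: field_simps)
      moreover have "1 / (K * real first_index) \<le> 1 / (K * real P)"
        using Pf P K_ge by (intro divide_left_mono mult_left_mono) auto
      ultimately have "1 / (K * real first_index) \<le> (t n / t P) powr \<kappa>"
        by linarith
      hence "(1 / (K * real first_index)) powr (2 / \<kappa>) \<le> ((t n / t P) powr \<kappa>) powr (2 / \<kappa>)"
        using Kf \<kappa>_pos by (intro powr_mono2) auto
      also have "\<dots> = (t n / t P) powr 2"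
        using \<kappa>_pos by (simp add: powr_powr)
      also have "\<dots> \<le> (t n / t P) powr (2 - \<beta>)"
        using tn tP tnP \<beta>_pos by (intro powr_mono') auto
      finally show ?thesis
        using Kf powr_divide[of 1 "K * real first_index" "2 / \<kappa>"]
          powr_minus_divide[of "K * real first_index" "2 / \<kappa>"] by (simp add: \<rho>_def)
    qed
  qed
  \<comment> \<open>For \<open>P = N\<close> no Green function enters the correction, so the constant \<open>0\<close> is admissible.\<close>
  define M where "M = (if P < N then 4 * Gamma (1 - \<beta>) / (1 - \<beta>) else 0)"
  have M0: "0 \<le> M"
    using Gamma_pos \<beta>_less_1 by (simp add: M_def)
  have "\<rho> * (1 - \<beta>) / 2 * green p j \<le> corrected_barrier P j"
    by (rule green_le_corrected_barrier[OF p P(1) \<rho> close j])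
  also have "\<dots> \<le> (Gamma (1 - \<beta>) + trunc_const * real P powr (\<beta> - 1) * (4 + 4 / \<kappa>) * M) * t j powr (\<beta> - 1)"
  proof (rule corrected_barrier_le[OF P(2) j M0])
    fix q assume "q \<in> {P+1..N}"
    thus "green q j \<le> M * t j powr (\<beta> - 1)"
      using green_le_late[of q j] j by (auto simp: M_def P_def)
  qed
  also have "\<dots> \<le> (Gamma (1 - \<beta>) + Gamma (1 - \<beta>)) * t j powr (\<beta> - 1)"
  proof (intro mult_right_mono add_left_mono)
    show "trunc_const * real P powr (\<beta> - 1) * (4 + 4 / \<kappa>) * M \<le> Gamma (1 - \<beta>)"
    proof (cases "P < N")
      case True
      hence "first_index \<le> P"
        by (auto simp: P_def)
      from mult_right_mono[OF trunc_factor_le[OF this] M0] show ?thesis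
        using True \<beta>_less_1 by (simp add: M_def)
    qed (use Gamma_pos in \<open>simp add: M_def\<close>)
  qed auto
  finally have le: "\<rho> * (1 - \<beta>) / 2 * green p j \<le> 2 * Gamma (1 - \<beta>) * t j powr (\<beta> - 1)"
    by simp
  have "green p j = \<rho> * (1 - \<beta>) / 2 * green p j * (2 / (\<rho> * (1 - \<beta>)))"
    using \<rho> \<beta>_less_1 by simp
  also have "\<dots> \<le> 2 * Gamma (1 - \<beta>) * t j powr (\<beta> - 1) * (2 / (\<rho> * (1 - \<beta>)))"
    using le \<rho> \<beta>_less_1 by (intro mult_right_mono) auto
  also have "\<dots> = green_const * t j powr (\<beta> - 1)"
    by (simp add: green_const_def \<rho>_def)
  finally show ?thesis .
qed

end

section \<open>Absorption of the lower-order terms\<close>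

context alikhanov_mesh
begin

lemma D_exp_nonneg:
  assumes n: "n \<in> {1..N}" and \<mu>: "0 < \<mu>"
  shows "0 \<le> D (\<lambda>k. exp (\<mu> * t k)) n"
proof -
  have "exp (\<mu> * t (k - 1)) \<le> exp (\<mu> * t k)" if "k \<in> {1..n}" for k
    using that n \<mu> t_incr[of k] by auto
  from D_nondecreasing_ge[OF n, of 0 "\<lambda>k. exp (\<mu> * t k)", OF _ this]
  have "g n 1 * (exp (\<mu> * t n) - 1) \<le> D (\<lambda>k. exp (\<mu> * t k)) n"
    using n by simp
  moreover have "0 \<le> g n 1 * (exp (\<mu> * t n) - 1)"
    using g_pos[OF n, of 1] n \<mu> t_pos[of n] by (intro mult_nonneg_nonneg) auto
  ultimately show ?thesis by linarith
qed

text \<open>Over a time lag between \<open>1 / \<mu>\<close> and \<open>2 / \<mu>\<close>, available because the steps are small, the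
exponential at least doubles, and the coefficient belonging to that lag is of order \<open>\<mu> powr \<beta>\<close>.\<close>

lemma D_exp_ge:
  assumes n: "n \<in> {1..N}" and \<mu>: "0 < \<mu>" and late: "1 / \<mu> < t n"
    and fine: "\<And>k. k \<in> {1..N} \<Longrightarrow> step k \<le> 1 / \<mu>"
  shows "\<mu> powr \<beta> / (8 * Gamma (1 - \<beta>)) * exp (\<mu> * t n) \<le> D (\<lambda>k. exp (\<mu> * t k)) n"
proof -
  define E where "E k = exp (\<mu> * t k)" for k
  obtain m where m: "m < n" "t m \<le> t n - 1 / \<mu>" "\<And>q. m < q \<Longrightarrow> q \<le> N \<Longrightarrow> t n - 1 / \<mu> < t q"
    using last_index_before_time[OF n, of "t n - 1 / \<mu>"] late \<mu> by auto
  have lag: "t n - t m \<le> 2 / \<mu>"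
  proof -
    have "t n - 1 / \<mu> < t (m + 1)"
      using m n by auto
    moreover have "t (m + 1) - t m \<le> 1 / \<mu>"
      using fine[of "m + 1"] m n by auto
    ultimately show ?thesis
      by (simp add: field_simps)
  qed
  have "\<mu> powr \<beta> / 2 \<le> (2 / \<mu>) powr (-\<beta>)"
  proof -
    have "(2 / \<mu>) powr (-\<beta>) = \<mu> powr \<beta> * 2 powr (-\<beta>)"
      using \<mu> powr_divide[of 2 \<mu> "-\<beta>"] powr_minus_divide[of \<mu> \<beta>] by simp
    moreover have "(2::real) powr (-1) \<le> 2 powr (-\<beta>)"
      using \<beta>_less_1 by (intro powr_mono) auto
    hence "1 / 2 \<le> (2::real) powr (-\<beta>)"
      by (simp add: powr_minus_divide)
    hence "\<mu> powr \<beta> * (1 / 2) \<le> \<mu> powr \<beta> * 2 powr (-\<beta>)"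
      by (intro mult_left_mono) auto
    ultimately show ?thesis by simp
  qed
  also have "\<dots> \<le> (t n - t m) powr (-\<beta>)"
    using lag t_less[OF m(1)] n \<beta>_pos by (intro powr_mono2') auto
  finally have "\<mu> powr \<beta> / 2 / (2 * Gamma (1 - \<beta>)) \<le> (t n - t m) powr (-\<beta>) / (2 * Gamma (1 - \<beta>))"
    using Gamma_pos by (intro divide_right_mono) auto
  also have "\<dots> \<le> g n (m + 1)"
    using g_ge[OF n, of "m + 1"] m by simp
  finally have gm: "\<mu> powr \<beta> / (4 * Gamma (1 - \<beta>)) \<le> g n (m + 1)"
    by simp
  have En: "E n / 2 \<le> E n - E m"
  proof -
    have "\<mu> * t m \<le> \<mu> * (t n - 1 / \<mu>)"
      using m(2) \<mu> by (intro mult_left_mono) auto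
    hence "\<mu> * t m + 1 \<le> \<mu> * t n"
      using \<mu> by (simp add: right_diff_distrib)
    hence "exp (\<mu> * t m + 1) \<le> E n"
      by (simp add: E_def)
    moreover have "exp (\<mu> * t m + 1) = E m * exp 1"
      by (simp add: E_def exp_add)
    moreover have "E m * 2 \<le> E m * exp 1"
      using exp_ge_add_one_self[of 1] by (intro mult_left_mono) (auto simp: E_def)
    ultimately show ?thesis
      by simp
  qed
  have "\<mu> powr \<beta> / (8 * Gamma (1 - \<beta>)) * E n = \<mu> powr \<beta> / (4 * Gamma (1 - \<beta>)) * (E n / 2)"
    by simp
  also have "\<dots> \<le> g n (m + 1) * (E n - E m)"
    using gm En g_pos[OF n, of "m + 1"] m(1) by (intro mult_mono) (auto simp: E_def)
  also have "\<dots> \<le> D E n"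
  proof (rule D_nondecreasing_ge[OF n m(1)])
    fix k assume "k \<in> {1..n}"
    thus "E (k - 1) \<le> E k"
      using n \<mu> t_incr[of k] by (auto simp: E_def)
  qed
  finally show ?thesis
    unfolding E_def .
qed

end

context graded_mesh
begin

lemma green_const_pos: "0 < green_const"
proof -
  have "0 < K * real first_index"
    using K_ge first_index(1) by (intro mult_pos_pos) auto
  thus ?thesis
    using Gamma_pos \<beta>_less_1 K_ge first_index(1) unfolding green_const_def
    by (intro divide_pos_pos mult_pos_pos) auto
qed

lemma green_const_nonneg: "0 \<le> green_const"
  using green_const_pos by simp

lemma superposition_le:
  assumes Q: "Q \<subseteq> {1..N}" and f: "\<And>q. q \<in> Q \<Longrightarrow> 0 \<le> f q" and j: "j \<in> {1..N}"
  shows "(\<Sum>q\<in>Q. step q * f q * green q j) \<le> green_const * (\<Sum>q\<in>Q. step q * f q) * t j powr (\<beta> - 1)"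
proof -
  have "(\<Sum>q\<in>Q. step q * f q * green q j) \<le> (\<Sum>q\<in>Q. step q * f q * (green_const * t j powr (\<beta> - 1)))"
  proof (rule sum_mono)
    fix q assume q: "q \<in> Q"
    hence "q \<in> {1..N}"
      using Q by auto
    thus "step q * f q * green q j \<le> step q * f q * (green_const * t j powr (\<beta> - 1))"
      using f[OF q] step_pos[of q] by (intro mult_left_mono green_le j mult_nonneg_nonneg) auto
  qed
  also have "\<dots> = green_const * (\<Sum>q\<in>Q. step q * f q) * t j powr (\<beta> - 1)"
    unfolding sum_distrib_right[symmetric] by simp
  finally show ?thesis .
qed

text \<open>The weight in which the lower-order terms are absorbed. The factor \<open>\<mu> powr (1 - \<beta>)\<close> makes both
summands comparable at time \<open>1 / \<mu>\<close>.\<close>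

definition growth :: "real \<Rightarrow> nat \<Rightarrow> real" where
  "growth \<mu> k = t k powr (\<beta> - 1) + \<mu> powr (1 - \<beta>) * exp (\<mu> * t k)"

definition early_power :: "real \<Rightarrow> nat \<Rightarrow> real" where
  "early_power \<mu> k = (if t k \<le> 1 / \<mu> then t k powr (\<beta> - 1) else 0)"

text \<open>The two summands dominate \<open>growth \<mu>\<close> before and after time \<open>1 / \<mu>\<close>.\<close>

definition growth_barrier :: "real \<Rightarrow> nat \<Rightarrow> real" where
  "growth_barrier \<mu> k = 4 * (1 + exp 1) * (\<Sum>q\<in>{1..N}. step q * early_power \<mu> q * green q k)
     + 16 * Gamma (1 - \<beta>) * \<mu> powr (- \<beta>) * \<mu> powr (1 - \<beta>) * exp (\<mu> * t k)"

definition growth_const :: real where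
  "growth_const = 4 * (1 + exp 1) * green_const / \<beta> + 16 * Gamma (1 - \<beta>)"

lemma growth_pos: "j \<in> {1..N} \<Longrightarrow> 0 < \<mu> \<Longrightarrow> 0 < growth \<mu> j"
  unfolding growth_def by (intro add_nonneg_pos) auto

lemma early_power_nonneg: "0 \<le> early_power \<mu> k"
  by (simp add: early_power_def)

text \<open>A lower Riemann sum for the integral of \<open>s powr (\<beta> - 1)\<close> over \<open>[0, 1 / \<mu>]\<close>.\<close>

lemma sum_early_power_le:
  assumes \<mu>: "0 < \<mu>"
  shows "(\<Sum>q\<in>{1..N}. step q * early_power \<mu> q) \<le> \<mu> powr (-\<beta>) / \<beta>"
proof -
  define h where "h q = (min (t q) (1 / \<mu>)) powr \<beta> / \<beta>" for q
  have "(\<Sum>q=0+1..N. step q * early_power \<mu> q) \<le> h N - h 0"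
  proof (rule sum_le_telescope)
    fix q assume q: "q \<in> {0+1..N}"
    have tq: "0 \<le> t (q - 1)" "t (q - 1) < t q"
      using q t_le[of 0 "q - 1"] by (auto intro!: t_less)
    show "step q * early_power \<mu> q \<le> h q - h (q - 1)"
    proof (cases "t q \<le> 1 / \<mu>")
      case True
      have "\<beta> * t q powr (\<beta> - 1) * step q \<le> t q powr \<beta> - t (q - 1) powr \<beta>"
        using tq \<beta>_pos \<beta>_less_1 by (intro powr_diff_ge) auto
      moreover have "min (t q) (1 / \<mu>) = t q" "min (t (q - 1)) (1 / \<mu>) = t (q - 1)"
        using True tq by auto
      ultimately show ?thesis
        using True \<beta>_pos
        by (simp add: h_def early_power_def diff_divide_distrib[symmetric] pos_le_divide_eq mult_ac)
    next
      case False
      have "h (q - 1) \<le> h q"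
        unfolding h_def using tq \<beta>_pos \<mu> by (intro divide_right_mono powr_mono2) auto
      thus ?thesis
        using False by (simp add: early_power_def)
    qed
  qed auto
  also have "\<dots> \<le> h N"
    using \<beta>_pos by (simp add: h_def)
  also have "\<dots> \<le> (1 / \<mu>) powr \<beta> / \<beta>"
    unfolding h_def using \<beta>_pos \<mu> t_le[of 0 N] by (intro divide_right_mono powr_mono2) auto
  also have "\<dots> = \<mu> powr (-\<beta>) / \<beta>"
    using \<mu> by (simp add: powr_divide powr_minus_divide)
  finally show ?thesis by simp
qed

lemma D_growth_barrier_ge:
  assumes n: "n \<in> {1..N}" and \<mu>: "0 < \<mu>" and fine: "\<And>k. k \<in> {1..N} \<Longrightarrow> step k \<le> 1 / \<mu>"
  shows "growth \<mu> n \<le> D (growth_barrier \<mu>) n"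
proof -
  have tn: "0 < t n"
    using n t_pos by auto
  have inv: "(1 / \<mu>) powr (\<beta> - 1) = \<mu> powr (1 - \<beta>)"
    using \<mu> powr_divide[of 1 \<mu> "\<beta> - 1"] powr_minus_divide[of \<mu> "1 - \<beta>"] by simp
  define S where "S = D (\<lambda>k. \<Sum>q\<in>{1..N}. step q * early_power \<mu> q * green q k) n"
  define X where "X = D (\<lambda>k. exp (\<mu> * t k)) n"
  have eq: "D (growth_barrier \<mu>) n
      = 4 * (1 + exp 1) * S + 16 * Gamma (1 - \<beta>) * \<mu> powr (- \<beta>) * \<mu> powr (1 - \<beta>) * X"
    unfolding growth_barrier_def S_def X_def using n by (simp only: D_add D_cmult)
  have "early_power \<mu> n / (4 * 1) \<le> S"
    unfolding S_def
  proof (rule D_superposition_ge[OF n])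
    fix q assume q: "1 \<le> q" "q \<le> n"
    have "0 < t q" "t q \<le> t n"
      using q n by (auto intro!: t_pos t_le)
    hence "early_power \<mu> n \<le> early_power \<mu> q"
      using \<beta>_less_1 by (auto simp: early_power_def intro!: powr_mono2')
    thus "q \<in> {1..N} \<and> early_power \<mu> n \<le> 1 * early_power \<mu> q"
      using q n by auto
  qed (auto simp: early_power_nonneg)
  hence "(1 + exp 1) * early_power \<mu> n \<le> (1 + exp 1) * (4 * S)"
    by (intro mult_left_mono) (auto intro: add_nonneg_nonneg)
  hence S: "(1 + exp 1) * early_power \<mu> n \<le> 4 * (1 + exp 1) * S"
    by (simp add: mult_ac)
  show ?thesis
  proof (cases "t n \<le> 1 / \<mu>")
    case True
    have "\<mu> powr (1 - \<beta>) \<le> t n powr (\<beta> - 1)"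
      unfolding inv[symmetric] using True tn \<beta>_less_1 by (intro powr_mono2') auto
    moreover have "exp (\<mu> * t n) \<le> exp 1"
      using True \<mu> by (simp add: field_simps)
    ultimately have "\<mu> powr (1 - \<beta>) * exp (\<mu> * t n) \<le> t n powr (\<beta> - 1) * exp 1"
      by (intro mult_mono) auto
    hence "growth \<mu> n \<le> (1 + exp 1) * early_power \<mu> n"
      using True by (simp add: growth_def early_power_def algebra_simps)
    moreover have "0 \<le> 16 * Gamma (1 - \<beta>) * \<mu> powr (- \<beta>) * \<mu> powr (1 - \<beta>) * X"
      using D_exp_nonneg[OF n \<mu>] Gamma_pos unfolding X_def by (intro mult_nonneg_nonneg) auto
    ultimately show ?thesis
      unfolding eq using S by linarith
  next
    case False
    hence late: "1 / \<mu> < t n"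
      by simp
    have "t n powr (\<beta> - 1) \<le> \<mu> powr (1 - \<beta>) * 1"
      unfolding inv[symmetric] using late \<mu> \<beta>_less_1 by (simp add: powr_mono2')
    also have "\<dots> \<le> \<mu> powr (1 - \<beta>) * exp (\<mu> * t n)"
      using \<mu> tn by (intro mult_left_mono) auto
    finally have "growth \<mu> n \<le> 2 * (\<mu> powr (1 - \<beta>) * exp (\<mu> * t n))"
      by (simp add: growth_def mult.commute)
    also have "\<dots> = 16 * Gamma (1 - \<beta>) * \<mu> powr (- \<beta>) * \<mu> powr (1 - \<beta>)
        * (\<mu> powr \<beta> / (8 * Gamma (1 - \<beta>)) * exp (\<mu> * t n))"
      using Gamma_pos \<mu> by (simp add: powr_minus_divide)
    also have "\<dots> \<le> 16 * Gamma (1 - \<beta>) * \<mu> powr (- \<beta>) * \<mu> powr (1 - \<beta>) * X"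
      unfolding X_def using D_exp_ge[OF n \<mu> late fine] Gamma_pos by (intro mult_left_mono) auto
    finally have "growth \<mu> n \<le> 16 * Gamma (1 - \<beta>) * \<mu> powr (- \<beta>) * \<mu> powr (1 - \<beta>) * X" .
    moreover have "0 \<le> (1 + exp 1) * early_power \<mu> n"
      using early_power_nonneg by (intro mult_nonneg_nonneg add_nonneg_nonneg) auto
    ultimately show ?thesis
      unfolding eq using S by linarith
  qed
qed

lemma growth_barrier_le:
  assumes j: "j \<in> {1..N}" and \<mu>: "0 < \<mu>"
  shows "growth_barrier \<mu> j \<le> growth_const * \<mu> powr (-\<beta>) * growth \<mu> j"
proof -
  define c where "c = 4 * (1 + exp 1 :: real)"
  have c0: "0 \<le> c"
    by (simp add: c_def add_nonneg_nonneg)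
  define E where "E = \<mu> powr (1 - \<beta>) * exp (\<mu> * t j)"
  define P where "P = t j powr (\<beta> - 1)"
  have "(\<Sum>q\<in>{1..N}. step q * early_power \<mu> q * green q j)
      \<le> green_const * (\<Sum>q\<in>{1..N}. step q * early_power \<mu> q) * P"
    unfolding P_def by (intro superposition_le j early_power_nonneg) auto
  also have "\<dots> \<le> green_const * (\<mu> powr (-\<beta>) / \<beta>) * P"
    using sum_early_power_le[OF \<mu>] green_const_nonneg by (intro mult_right_mono mult_left_mono) (auto simp: P_def)
  finally have "c * (\<Sum>q\<in>{1..N}. step q * early_power \<mu> q * green q j) \<le> c * (green_const * (\<mu> powr (-\<beta>) / \<beta>) * P)"
    using c0 by (rule mult_left_mono)
  also have "\<dots> = c * green_const / \<beta> * \<mu> powr (-\<beta>) * P"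
    by simp
  also have "\<dots> \<le> growth_const * \<mu> powr (-\<beta>) * P"
    using Gamma_pos by (intro mult_right_mono) (auto simp: growth_const_def c_def P_def)
  finally have "c * (\<Sum>q\<in>{1..N}. step q * early_power \<mu> q * green q j) \<le> growth_const * \<mu> powr (-\<beta>) * P" .
  moreover have "16 * Gamma (1 - \<beta>) * \<mu> powr (- \<beta>) * E \<le> growth_const * \<mu> powr (-\<beta>) * E"
    using c0 green_const_nonneg \<beta>_pos by (intro mult_right_mono) (auto simp: growth_const_def c_def E_def)
  ultimately show ?thesis
    unfolding growth_barrier_def growth_def c_def[symmetric] P_def[symmetric]
    by (simp add: E_def distrib_left mult.assoc)
qed

lemma growth_barrier_0_nonneg: "0 \<le> growth_barrier \<mu> 0"
  using Gamma_pos by (simp add: growth_barrier_def)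

lemma growth_prev_le:
  assumes n: "n \<in> {2..N}" and \<mu>: "0 < \<mu>"
  shows "growth \<mu> (n - 1) \<le> K * growth \<mu> n"
proof -
  have tn: "0 < t n" "0 < t (n - 1)" "t (n - 1) \<le> t n"
    using n by (auto intro!: t_pos t_le)
  have "t (n - 1) powr (\<beta> - 1) \<le> (t n / K) powr (\<beta> - 1)"
    using t_le_prev[OF n] K_ge tn \<beta>_less_1 by (intro powr_mono2') (auto simp: pos_divide_le_eq mult.commute)
  also have "\<dots> = K powr (1 - \<beta>) * t n powr (\<beta> - 1)"
    using tn K_ge powr_divide[of "t n" K "\<beta> - 1"] powr_minus_divide[of K "1 - \<beta>"] by simp
  also have "\<dots> \<le> K powr 1 * t n powr (\<beta> - 1)"
    using K_ge \<beta>_pos by (intro mult_right_mono powr_mono) auto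
  finally have "t (n - 1) powr (\<beta> - 1) \<le> K * t n powr (\<beta> - 1)"
    using K_ge by simp
  moreover have "\<mu> powr (1 - \<beta>) * exp (\<mu> * t (n - 1)) \<le> K * (\<mu> powr (1 - \<beta>) * exp (\<mu> * t n))"
  proof -
    have "\<mu> powr (1 - \<beta>) * exp (\<mu> * t (n - 1)) \<le> 1 * (\<mu> powr (1 - \<beta>) * exp (\<mu> * t n))"
      using tn \<mu> by (auto intro!: mult_left_mono)
    also have "\<dots> \<le> K * (\<mu> powr (1 - \<beta>) * exp (\<mu> * t n))"
      using K_ge by (intro mult_right_mono) auto
    finally show ?thesis .
  qed
  ultimately show ?thesis
    by (simp add: growth_def distrib_left)
qed

text \<open>With \<open>R\<close> the maximum of \<open>max 0 (v k) / growth \<mu> k\<close> over \<open>k \<le> j\<close>, the lower-order terms are at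
most \<open>R * (lam1 + K * lam2) * growth \<mu>\<close>, hence comparison bounds \<open>v\<close> by the contribution of \<open>f\<close>
plus \<open>R / 2 * growth \<mu>\<close>. Evaluation at the maximizing index bounds \<open>R\<close>. Only the values \<open>f q\<close> with
\<open>q \<le> j\<close> enter, since the superposition is cut off at \<open>j\<close>.\<close>

theorem stability:
  fixes v f :: "nat \<Rightarrow> real"
  assumes lam: "0 \<le> lam1" "0 \<le> lam2" and \<mu>: "0 < \<mu>"
    and absorb: "growth_const * \<mu> powr (-\<beta>) * (lam1 + K * lam2) \<le> 1 / 2"
    and fine: "\<And>k. k \<in> {1..N} \<Longrightarrow> step k \<le> 1 / \<mu>"
    and f: "\<And>q. q \<in> {1..N} \<Longrightarrow> 0 \<le> f q" and L: "0 < L"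
    and slow: "\<And>n q. 1 \<le> q \<Longrightarrow> q \<le> n \<Longrightarrow> n \<le> N \<Longrightarrow> t n < 2 * t q \<Longrightarrow> f n \<le> L * f q"
    and v0: "v 0 = 0"
    and v: "\<And>n. n \<in> {1..N} \<Longrightarrow> D v n - lam1 * v n - lam2 * v (n - 1) \<le> f n"
    and j: "j \<in> {1..N}"
  shows "v j \<le> 8 * L * green_const * (\<Sum>q=1..j. step q * f q) * growth \<mu> j"
proof -
  define \<Lambda> where "\<Lambda> = lam1 + K * lam2"
  define S where "S = 4 * L * green_const * (\<Sum>q=1..j. step q * f q)"
  define U where "U k = 4 * L * (\<Sum>q\<in>{1..j}. step q * f q * green q k)" for k
  define h where "h k = max 0 (v k) / growth \<mu> k" for k
  define R where "R = Max (h ` {1..j})"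
  have \<Lambda>0: "0 \<le> \<Lambda>"
    using lam K_ge by (simp add: \<Lambda>_def)
  have gr: "0 < growth \<mu> k" if "k \<in> {1..j}" for k
    using that j \<mu> by (intro growth_pos) auto
  have R_ge: "max 0 (v k) \<le> R * growth \<mu> k" if k: "k \<in> {1..j}" for k
  proof -
    have "h k \<le> R"
      unfolding R_def using k by (intro Max_ge) auto
    thus ?thesis
      using gr[OF k] by (simp add: h_def pos_divide_le_eq)
  qed
  have R0: "0 \<le> R"
  proof -
    have "0 \<le> R * growth \<mu> j"
      using R_ge[of j] j by auto
    thus ?thesis
      using gr[of j] j by (auto simp: zero_le_mult_iff)
  qed
  have U_le: "U k \<le> S * growth \<mu> k" if k: "k \<in> {1..j}" for k
  proof -
    have S0: "0 \<le> S"
      unfolding S_def using L green_const_nonneg f j step_pos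
      by (intro mult_nonneg_nonneg sum_nonneg) (auto intro: less_imp_le)
    have "(\<Sum>q\<in>{1..j}. step q * f q * green q k) \<le> green_const * (\<Sum>q\<in>{1..j}. step q * f q) * t k powr (\<beta> - 1)"
      using k j f by (intro superposition_le) auto
    hence "U k \<le> 4 * L * (green_const * (\<Sum>q\<in>{1..j}. step q * f q) * t k powr (\<beta> - 1))"
      unfolding U_def using L by (intro mult_left_mono) auto
    also have "\<dots> = S * t k powr (\<beta> - 1)"
      by (simp add: S_def)
    also have "\<dots> \<le> S * growth \<mu> k"
      using S0 by (intro mult_left_mono) (auto simp: growth_def)
    finally show ?thesis .
  qed
  have v_le: "v k \<le> U k + R * \<Lambda> * growth_barrier \<mu> k" if "k \<le> j" for k
  proof (rule comparison[of j])
    fix n assume n: "n \<in> {1..j}"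
    have nN: "n \<in> {1..N}"
      using n j by auto
    have "f n / (4 * L) \<le> D (\<lambda>k. \<Sum>q\<in>{1..j}. step q * f q * green q k) n"
    proof (rule D_superposition_ge[OF nN])
      fix q assume "1 \<le> q" "q \<le> n" "t n < 2 * t q"
      thus "q \<in> {1..j} \<and> f n \<le> L * f q"
        using n slow[of q n] nN by auto
    qed (use f j nN L in auto)
    hence DU: "f n \<le> D U n"
      unfolding U_def D_cmult[OF nN] using L by (simp add: pos_divide_le_eq mult_ac)
    have v1: "lam1 * v n \<le> lam1 * (R * growth \<mu> n)"
      using R_ge[OF n] lam by (intro mult_left_mono) auto
    have v2: "lam2 * v (n - 1) \<le> lam2 * (R * (K * growth \<mu> n))"
    proof (rule mult_left_mono[OF _ lam(2)])
      show "v (n - 1) \<le> R * (K * growth \<mu> n)"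
      proof (cases "n = 1")
        case True
        have "0 \<le> R * (K * growth \<mu> n)"
          using R0 K_ge gr[OF n] by (intro mult_nonneg_nonneg) auto
        thus ?thesis
          using True v0 by simp
      next
        case False
        hence n': "n - 1 \<in> {1..j}" "n \<in> {2..N}"
          using n nN by auto
        have "v (n - 1) \<le> R * growth \<mu> (n - 1)"
          using R_ge[OF n'(1)] by simp
        also have "\<dots> \<le> R * (K * growth \<mu> n)"
          using growth_prev_le[OF n'(2) \<mu>] R0 by (rule mult_left_mono)
        finally show ?thesis .
      qed
    qed
    have "R * \<Lambda> * growth \<mu> n \<le> R * \<Lambda> * D (growth_barrier \<mu>) n"
      using D_growth_barrier_ge[OF nN \<mu> fine] R0 \<Lambda>0 by (intro mult_left_mono) auto
    moreover have "R * \<Lambda> * growth \<mu> n = lam1 * (R * growth \<mu> n) + lam2 * (R * (K * growth \<mu> n))"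
      by (simp add: \<Lambda>_def algebra_simps)
    ultimately have "D v n \<le> D U n + R * \<Lambda> * D (growth_barrier \<mu>) n"
      using v[OF nN] v1 v2 DU by linarith
    thus "D v n \<le> D (\<lambda>k. U k + R * \<Lambda> * growth_barrier \<mu> k) n"
      by (simp only: D_add[OF nN] D_cmult[OF nN])
  next
    show "v 0 \<le> U 0 + R * \<Lambda> * growth_barrier \<mu> 0"
      using v0 R0 \<Lambda>0 growth_barrier_0_nonneg by (simp add: U_def)
  qed (use that j in auto)
  have v_le': "v k \<le> (S + R / 2) * growth \<mu> k" if k: "k \<in> {1..j}" for k
  proof -
    have "R * \<Lambda> * growth_barrier \<mu> k \<le> R * \<Lambda> * (growth_const * \<mu> powr (-\<beta>) * growth \<mu> k)"
      using growth_barrier_le[of k \<mu>] k j \<mu> R0 \<Lambda>0 by (intro mult_left_mono) auto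
    also have "\<dots> = (growth_const * \<mu> powr (-\<beta>) * \<Lambda>) * (R * growth \<mu> k)"
      by simp
    also have "\<dots> \<le> 1 / 2 * (R * growth \<mu> k)"
      using absorb R0 gr[OF k] unfolding \<Lambda>_def by (intro mult_right_mono) auto
    finally have "R * \<Lambda> * growth_barrier \<mu> k \<le> 1 / 2 * (R * growth \<mu> k)" .
    thus ?thesis
      using v_le[of k] U_le[OF k] k by (simp add: distrib_right)
  qed
  have S0: "0 \<le> S"
    unfolding S_def using L green_const_nonneg f j step_pos
    by (intro mult_nonneg_nonneg sum_nonneg) (auto intro: less_imp_le)
  have "R \<in> h ` {1..j}"
    unfolding R_def using j by (intro Max_in) auto
  then obtain k where k: "k \<in> {1..j}" "R = h k"
    by auto
  have "max 0 (v k) \<le> (S + R / 2) * growth \<mu> k"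
    using v_le'[OF k(1)] S0 R0 gr[OF k(1)] by auto
  hence "R \<le> S + R / 2"
    unfolding k(2) h_def using gr[OF k(1)] by (simp add: pos_divide_le_eq)
  hence "R \<le> 2 * S"
    by simp
  hence "R * growth \<mu> j \<le> 2 * S * growth \<mu> j"
    using gr[of j] j by (intro mult_right_mono) auto
  thus ?thesis
    using R_ge[of j] j by (simp add: S_def)
qed

end

section \<open>Power-type right-hand sides\<close>

context alikhanov_mesh
begin

text \<open>A Riemann sum with right endpoints for the integral of \<open>(t 1 / s) powr (\<gamma> + 1)\<close> over
\<open>[0, t j]\<close>, in which the first step contributes \<open>t 1\<close>. For \<open>\<gamma> > 0\<close> the first steps dominate, for \<open>\<gamma> = 0\<close> all
scales contribute equally and give the logarithm, for \<open>\<gamma> < 0\<close> the last steps dominate. For \<open>\<gamma> = 0\<close>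
the constant is \<open>1\<close>, as \<open>1 / 0 = 0\<close>.\<close>

lemma sum_source_le:
  assumes j: "j \<in> {1..N}"
  shows "(\<Sum>q=1..j. step q * (t 1 / t q) powr (\<gamma> + 1))
    \<le> (1 + 1 / \<bar>\<gamma>\<bar>) * (M_fac \<gamma> (t 1) (t j) * t 1 * (t 1 / t j) powr min 0 \<gamma>)"
proof -
  have t1: "0 < t 1" and tj: "0 < t j" and t1j: "t 1 \<le> t j"
    using j by (auto intro!: t_pos t_le)
  have pos: "0 < t q" if "q \<in> {1..j}" for q
    using that j by (auto intro!: t_pos)
  have eq: "step q * (t 1 / t q) powr (\<gamma> + 1) = t 1 powr (\<gamma> + 1) * (t q powr (-\<gamma> - 1) * step q)"
    if "q \<in> {1..j}" for q
  proof -
    have "- \<gamma> - 1 = - (\<gamma> + 1)"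
      by simp
    hence "t q powr (-\<gamma> - 1) = 1 / t q powr (\<gamma> + 1)"
      by (simp only: powr_minus_divide)
    thus ?thesis
      using t1 pos[OF that] by (simp add: powr_divide)
  qed
  have split: "(\<Sum>q=1..j. step q * (t 1 / t q) powr (\<gamma> + 1))
      = t 1 + (\<Sum>q=1+1..j. step q * (t 1 / t q) powr (\<gamma> + 1))"
    using j t1 by (subst sum.atLeast_Suc_atMost) auto
  consider "\<gamma> > 0" | "\<gamma> = 0" | "\<gamma> < 0"
    by linarith
  thus ?thesis
  proof cases
    case 1
    have "(\<Sum>q=1+1..j. step q * (t 1 / t q) powr (\<gamma> + 1))
        \<le> - (t 1 powr (\<gamma> + 1) * t j powr (-\<gamma>) / \<gamma>) - - (t 1 powr (\<gamma> + 1) * t 1 powr (-\<gamma>) / \<gamma>)"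
    proof (rule sum_le_telescope)
      fix q assume q: "q \<in> {1+1..j}"
      have tq: "0 < t (q - 1)" "t (q - 1) < t q"
        using q j by (auto intro!: t_pos t_less)
      have "step q * (t 1 / t q) powr (\<gamma> + 1) = t 1 powr (\<gamma> + 1) * (\<gamma> * t q powr (-\<gamma> - 1) * step q) / \<gamma>"
        using q 1 by (subst eq) auto
      also have "\<dots> \<le> t 1 powr (\<gamma> + 1) * (t (q - 1) powr (-\<gamma>) - t q powr (-\<gamma>)) / \<gamma>"
        using tq 1 powr_diff_neg_ge[of "t (q - 1)" "t q" \<gamma>] by (intro divide_right_mono mult_left_mono) auto
      also have "\<dots> = - (t 1 powr (\<gamma> + 1) * t q powr (-\<gamma>) / \<gamma>) - - (t 1 powr (\<gamma> + 1) * t (q - 1) powr (-\<gamma>) / \<gamma>)"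
        by (simp add: right_diff_distrib diff_divide_distrib)
      finally show "step q * (t 1 / t q) powr (\<gamma> + 1) \<le> \<dots>" .
    qed (use j in auto)
    also have "\<dots> \<le> t 1 powr (\<gamma> + 1) * t 1 powr (-\<gamma>) / \<gamma>"
      using 1 by simp
    also have "t 1 powr (\<gamma> + 1) * t 1 powr (-\<gamma>) = t 1"
      using t1 powr_add[of "t 1" "\<gamma> + 1" "-\<gamma>"] by simp
    finally show ?thesis
      unfolding split using 1 t1 tj by (simp add: M_fac_def min_def distrib_right)
  next
    case 2
    have "(\<Sum>q=1+1..j. step q * (t 1 / t q) powr (\<gamma> + 1)) \<le> t 1 * ln (t j) - t 1 * ln (t 1)"
    proof (rule sum_le_telescope)
      fix q assume q: "q \<in> {1+1..j}"
      have tq: "0 < t (q - 1)" "t (q - 1) < t q"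
        using q j by (auto intro!: t_pos t_less)
      have "step q * (t 1 / t q) powr (\<gamma> + 1) = t 1 * (step q / t q)"
        using 2 t1 tq by simp
      also have "\<dots> \<le> t 1 * (ln (t q) - ln (t (q - 1)))"
        using diff_div_le_ln[OF tq] t1 by (intro mult_left_mono) auto
      finally show "step q * (t 1 / t q) powr (\<gamma> + 1) \<le> t 1 * ln (t q) - t 1 * ln (t (q - 1))"
        by (simp add: right_diff_distrib)
    qed (use j in auto)
    also have "\<dots> = t 1 * ln (t j / t 1)"
      using t1 tj by (simp add: ln_div right_diff_distrib)
    finally have "t 1 + (\<Sum>q=1+1..j. step q * (t 1 / t q) powr (\<gamma> + 1)) \<le> t 1 + t 1 * ln (t j / t 1)"
      by (rule add_left_mono)
    also have "\<dots> = (1 + 1 / \<bar>\<gamma>\<bar>) * (M_fac \<gamma> (t 1) (t j) * t 1 * (t 1 / t j) powr min 0 \<gamma>)"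
      using 2 t1 tj by (simp add: M_fac_def algebra_simps)
    finally show ?thesis
      unfolding split .
  next
    case 3
    have "(\<Sum>q=1..j. t q powr (-\<gamma> - 1) * step q) \<le> (1 + 1 / \<bar>\<gamma>\<bar>) * t j powr (-\<gamma>)"
    proof (cases "-\<gamma> \<le> 1")
      case True
      have "(\<Sum>q=0+1..j. t q powr (-\<gamma> - 1) * step q) \<le> t j powr (-\<gamma>) / (-\<gamma>) - t 0 powr (-\<gamma>) / (-\<gamma>)"
      proof (rule sum_le_telescope)
        fix q assume q: "q \<in> {0+1..j}"
        have tq: "0 \<le> t (q - 1)" "t (q - 1) < t q"
          using q j t_le[of 0 "q - 1"] by (auto intro!: t_less)
        have "(-\<gamma>) * t q powr (-\<gamma> - 1) * step q \<le> t q powr (-\<gamma>) - t (q - 1) powr (-\<gamma>)"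
          using tq 3 True by (intro powr_diff_ge) auto
        hence "(-\<gamma>) * t q powr (-\<gamma> - 1) * step q / (-\<gamma>) \<le> (t q powr (-\<gamma>) - t (q - 1) powr (-\<gamma>)) / (-\<gamma>)"
          using 3 by (intro divide_right_mono) auto
        thus "t q powr (-\<gamma> - 1) * step q \<le> t q powr (-\<gamma>) / (-\<gamma>) - t (q - 1) powr (-\<gamma>) / (-\<gamma>)"
          using 3 by (simp add: diff_divide_distrib)
      qed auto
      also have "\<dots> = 1 / \<bar>\<gamma>\<bar> * t j powr (-\<gamma>)"
        using 3 by simp
      also have "\<dots> \<le> (1 + 1 / \<bar>\<gamma>\<bar>) * t j powr (-\<gamma>)"
        by (intro mult_right_mono) auto
      finally show ?thesis by simp
    next
      case False
      have "(\<Sum>q=0+1..j. t q powr (-\<gamma> - 1) * step q) \<le> (\<Sum>q=0+1..j. t j powr (-\<gamma> - 1) * step q)"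
      proof (intro sum_mono mult_right_mono powr_mono2)
        fix q assume q: "q \<in> {0+1..j}"
        show "0 \<le> t q" "t q \<le> t j" "0 \<le> step q"
          using q j t_le[of 0 q] t_le[of q j] step_pos[of q] by auto
      qed (use False in auto)
      also have "\<dots> = t j powr (-\<gamma> - 1) * t j"
        unfolding sum_distrib_left[symmetric] using sum_step[of 0 j] by simp
      also have "\<dots> = t j powr (-\<gamma>)"
        using tj powr_add[of "t j" "-\<gamma> - 1" 1] by simp
      also have "\<dots> \<le> (1 + 1 / \<bar>\<gamma>\<bar>) * t j powr (-\<gamma>)"
        using mult_right_mono[of 1 "1 + 1 / \<bar>\<gamma>\<bar>" "t j powr (-\<gamma>)"] by simp
      finally show ?thesis by simp
    qed
    hence "t 1 powr (\<gamma> + 1) * (\<Sum>q=1..j. t q powr (-\<gamma> - 1) * step q)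
        \<le> t 1 powr (\<gamma> + 1) * ((1 + 1 / \<bar>\<gamma>\<bar>) * t j powr (-\<gamma>))"
      by (intro mult_left_mono) auto
    moreover have "(\<Sum>q=1..j. step q * (t 1 / t q) powr (\<gamma> + 1))
        = t 1 powr (\<gamma> + 1) * (\<Sum>q=1..j. t q powr (-\<gamma> - 1) * step q)"
      unfolding sum_distrib_left by (intro sum.cong refl eq)
    moreover have "t 1 powr (\<gamma> + 1) * t j powr (-\<gamma>) = t 1 * (t 1 / t j) powr \<gamma>"
      using t1 tj powr_add[of "t 1" \<gamma> 1] by (simp add: powr_divide powr_minus_divide)
    hence "t 1 powr (\<gamma> + 1) * ((1 + 1 / \<bar>\<gamma>\<bar>) * t j powr (-\<gamma>)) = (1 + 1 / \<bar>\<gamma>\<bar>) * (t 1 * (t 1 / t j) powr \<gamma>)"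
      by (metis mult.left_commute)
    ultimately have "(\<Sum>q=1..j. step q * (t 1 / t q) powr (\<gamma> + 1))
        \<le> (1 + 1 / \<bar>\<gamma>\<bar>) * (t 1 * (t 1 / t j) powr \<gamma>)"
      by metis
    thus ?thesis
      using 3 by (simp add: M_fac_def min_def)
  qed
qed

lemma source_slowly_varying:
  assumes "1 \<le> q" "q \<le> n" "n \<le> N" "t n < 2 * t q"
  shows "(t 1 / t n) powr (\<gamma> + 1) \<le> 2 powr \<bar>\<gamma> + 1\<bar> * (t 1 / t q) powr (\<gamma> + 1)"
proof -
  have t1: "0 < t 1" and tq: "0 < t q" and tn: "0 < t n" and tqn: "t q \<le> t n"
    using assms by (auto intro!: t_pos t_le)
  show ?thesis
  proof (cases "0 \<le> \<gamma> + 1")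
    case True
    have "(t 1 / t n) powr (\<gamma> + 1) \<le> 1 * (t 1 / t q) powr (\<gamma> + 1)"
      using True t1 tq tqn by (auto intro!: powr_mono2 divide_left_mono)
    also have "\<dots> \<le> 2 powr \<bar>\<gamma> + 1\<bar> * (t 1 / t q) powr (\<gamma> + 1)"
      using ge_one_powr_ge_zero[of 2 "\<bar>\<gamma> + 1\<bar>"] by (intro mult_right_mono) auto
    finally show ?thesis .
  next
    case False
    have "(t 1 / t n) powr (\<gamma> + 1) \<le> (t 1 / t q / 2) powr (\<gamma> + 1)"
      using False t1 tq tn assms(4) by (intro powr_mono2') (auto simp: field_simps)
    also have "\<dots> = 2 powr \<bar>\<gamma> + 1\<bar> * (t 1 / t q) powr (\<gamma> + 1)"
    proof -
      have "(t 1 / t q / 2) powr (\<gamma> + 1) = (t 1 / t q) powr (\<gamma> + 1) / 2 powr (\<gamma> + 1)"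
        by (rule powr_divide)
      moreover have "(2::real) powr - (\<gamma> + 1) = 1 / 2 powr (\<gamma> + 1)"
        by (rule powr_minus_divide)
      moreover have "\<bar>\<gamma> + 1\<bar> = - (\<gamma> + 1)"
        using False by simp
      ultimately show ?thesis
        by simp
    qed
    finally show ?thesis .
  qed
qed

end

context graded_mesh
begin

text \<open>On a bounded time interval \<open>t j powr (\<beta> - 1)\<close> is bounded below, so the exponential part of the
weight is at most a multiple of it.\<close>

lemma growth_le:
  assumes j: "j \<in> {1..N}" and \<mu>: "0 < \<mu>"
  shows "growth \<mu> j \<le> (1 + (\<mu> * t N) powr (1 - \<beta>) * exp (\<mu> * t N)) * t j powr (\<beta> - 1)"
proof -
  have tj: "0 < t j" and tjN: "t j \<le> t N"
    using j by (auto intro!: t_pos t_le)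
  have "1 = t j powr (1 - \<beta>) * t j powr (\<beta> - 1)"
    using tj powr_add[of "t j" "1 - \<beta>" "\<beta> - 1"] by simp
  also have "\<dots> \<le> t N powr (1 - \<beta>) * t j powr (\<beta> - 1)"
    using tj tjN \<beta>_less_1 by (intro mult_right_mono powr_mono2) auto
  finally have one: "1 \<le> t N powr (1 - \<beta>) * t j powr (\<beta> - 1)" .
  have "\<mu> powr (1 - \<beta>) * exp (\<mu> * t j) * 1
      \<le> \<mu> powr (1 - \<beta>) * exp (\<mu> * t N) * (t N powr (1 - \<beta>) * t j powr (\<beta> - 1))"
    using one tjN \<mu> by (intro mult_mono mult_left_mono) auto
  also have "\<dots> = (\<mu> * t N) powr (1 - \<beta>) * exp (\<mu> * t N) * t j powr (\<beta> - 1)"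
    using \<mu> tj tjN by (simp add: powr_mult)
  finally show ?thesis
    by (simp add: growth_def distrib_right)
qed

lemma source_stability:
  assumes lam: "0 \<le> lam1" "0 \<le> lam2" and \<mu>: "0 < \<mu>"
    and absorb: "growth_const * \<mu> powr (-\<beta>) * (lam1 + K * lam2) \<le> 1 / 2"
    and fine: "\<And>k. k \<in> {1..N} \<Longrightarrow> step k \<le> 1 / \<mu>"
    and C: "0 < C" and v0: "v 0 = 0"
    and v: "\<And>n. n \<in> {1..N} \<Longrightarrow>
      D v n - lam1 * v n - lam2 * v (n - 1) \<le> C * (t 1 / t n) powr (\<gamma> + 1)"
    and j: "j \<in> {1..N}"
  shows "v j \<le> 8 * 2 powr \<bar>\<gamma> + 1\<bar> * green_const * (C * (1 + 1 / \<bar>\<gamma>\<bar>))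
     * (1 + (\<mu> * t N) powr (1 - \<beta>) * exp (\<mu> * t N)) * V_bound \<beta> t j \<gamma>"
proof -
  define c where "c = 8 * 2 powr \<bar>\<gamma> + 1\<bar> * green_const"
  define G where "G = 1 + (\<mu> * t N) powr (1 - \<beta>) * exp (\<mu> * t N)"
  define B where "B = (1 + 1 / \<bar>\<gamma>\<bar>) * (M_fac \<gamma> (t 1) (t j) * t 1 * (t 1 / t j) powr min 0 \<gamma>)"
  define S where "S = (\<Sum>q=1..j. step q * (C * (t 1 / t q) powr (\<gamma> + 1)))"
  have c0: "0 \<le> c"
    using green_const_nonneg by (simp add: c_def)
  have S0: "0 \<le> S"
    unfolding S_def
  proof (intro sum_nonneg mult_nonneg_nonneg)
    fix q assume "q \<in> {1..j}"
    thus "0 \<le> step q"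
      using j step_pos[of q] by auto
  qed (use C in auto)
  have "S = C * (\<Sum>q=1..j. step q * (t 1 / t q) powr (\<gamma> + 1))"
    by (simp add: S_def sum_distrib_left mult.left_commute)
  also have "\<dots> \<le> C * B"
    unfolding B_def using sum_source_le[OF j] C by (intro mult_left_mono) auto
  finally have S: "S \<le> C * B" .
  have "v j \<le> c * S * growth \<mu> j"
    unfolding c_def S_def
  proof (rule stability[OF lam \<mu> absorb fine _ _ _ v0 v j])
    fix n q assume "1 \<le> q" "q \<le> n" "n \<le> N" "t n < 2 * t q"
    from mult_left_mono[OF source_slowly_varying[OF this], of C \<gamma>] C
    show "C * (t 1 / t n) powr (\<gamma> + 1) \<le> 2 powr \<bar>\<gamma> + 1\<bar> * (C * (t 1 / t q) powr (\<gamma> + 1))"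
      by (simp add: mult.left_commute)
  qed (use C in auto)
  also have "\<dots> \<le> c * S * (G * t j powr (\<beta> - 1))"
    unfolding G_def using growth_le[OF j \<mu>] c0 S0 by (intro mult_left_mono) auto
  also have "\<dots> \<le> c * (C * B) * (G * t j powr (\<beta> - 1))"
    using S c0 by (intro mult_right_mono mult_left_mono mult_nonneg_nonneg) (auto simp: G_def)
  also have "\<dots> = c * (C * (1 + 1 / \<bar>\<gamma>\<bar>)) * G * V_bound \<beta> t j \<gamma>"
    by (simp add: B_def V_bound_def Let_def mult_ac)
  finally show ?thesis
    unfolding c_def G_def .
qed

end

section \<open>Quasi-graded meshes and the discrete Gronwall-type bound\<close>

text \<open>By quasi-grading, \<open>t n\<close> is comparable to \<open>\<tau> * n powr r\<close> with the first step \<open>\<tau>\<close>, so that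
\<open>(\<tau> / t n) powr (1 / r)\<close> is comparable to \<open>1 / n\<close>, and the condition on the steps becomes
\<open>step n\<close> comparable to \<open>t n / n\<close>. Any \<open>\<kappa> > 0\<close> with \<open>\<kappa> \<le> 1 / r\<close>
and \<open>\<kappa> < \<beta>\<close> would do.\<close>

lemma graded_mesh_of_quasi_graded:
  fixes t :: "nat \<Rightarrow> nat \<Rightarrow> real"
  assumes \<beta>: "0 < \<beta>" "\<beta> < 1" and \<sigma>: "1 / 2 \<le> \<sigma>" "\<sigma> \<le> 1" and r: "1 \<le> r"
    and mesh: "mesh_family T t" and graded: "quasi_graded r t"
    and coeffs: "\<And>N. N \<ge> 1 \<Longrightarrow> alikhanov_coeffs \<beta> \<sigma> (t N) N (g N)"
    and P1: "\<And>N. N \<ge> 1 \<Longrightarrow> property_P1 N (g N)"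
  obtains K \<kappa> where "\<And>N. 1 \<le> N \<Longrightarrow> graded_mesh \<beta> \<sigma> N (t N) (g N) K \<kappa>"
proof -
  define \<kappa> where "\<kappa> = min (1 / r) (\<beta> / 2)"
  obtain c C where c: "0 < c" "0 < C" and growth: "\<And>N n. 1 \<le> N \<Longrightarrow> n \<in> {1..N} \<Longrightarrow>
      c \<le> t N n / ((t N 1 - t N 0) * real n powr r) \<and> t N n / ((t N 1 - t N 0) * real n powr r) \<le> C"
    using graded unfolding quasi_graded_def unif_equiv_def Let_def by (auto simp: Ball_def)
  obtain c' C' where c': "0 < c'" "0 < C'" and steps: "\<And>N n. 1 \<le> N \<Longrightarrow> n \<in> {1..N} \<Longrightarrow>
      c' \<le> (t N n - t N (n - 1)) / ((t N 1 - t N 0) powr (1 / r) * t N n powr (1 - 1 / r)) \<and>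
      (t N n - t N (n - 1)) / ((t N 1 - t N 0) powr (1 / r) * t N n powr (1 - 1 / r)) \<le> C'"
    using graded unfolding quasi_graded_def unif_equiv_def Let_def by (auto simp: Ball_def)
  define K1 where "K1 = C' * c powr (- (1 / r))"
  define K2 where "K2 = C powr (1 / r) / c'"
  define K3 where "K3 = (C / c) powr (1 / r)"
  define K4 where "K4 = (4 * C / c) powr (1 / r)"
  define K5 where "K5 = C / c * 2 powr r"
  define K where "K = Max {1, K1, K2, K3, K4, K5}"
  have K: "1 \<le> K" "K1 \<le> K" "K2 \<le> K" "K3 \<le> K" "K4 \<le> K" "K5 \<le> K"
    by (auto simp: K_def)
  have "graded_mesh \<beta> \<sigma> N (t N) (g N) K \<kappa>" if N: "1 \<le> N" for N
  proof -
    interpret alikhanov_mesh \<beta> \<sigma> N "t N" "g N"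
      using \<beta> \<sigma> mesh coeffs P1 N by unfold_locales (auto simp: mesh_family_def)
    define \<tau> where "\<tau> = t N 1"
    have \<tau>: "0 < \<tau>"
      unfolding \<tau>_def using N by (intro t_pos) auto
    define \<rho> where "\<rho> n = t N n / (\<tau> * real n powr r)" for n
    have \<rho>: "c \<le> \<rho> n" "\<rho> n \<le> C" "t N n = \<rho> n * (\<tau> * real n powr r)" if "n \<in> {1..N}" for n
      using growth[OF N that] \<tau> that by (auto simp: \<rho>_def \<tau>_def)
    have root: "t N n powr (1 / r) = \<rho> n powr (1 / r) * \<tau> powr (1 / r) * real n" if n: "n \<in> {1..N}" for n
    proof -
      have "(real n powr r) powr (1 / r) = real n"
        using n r by (simp add: powr_powr)
      moreover have "0 \<le> \<rho> n"
        using \<rho>(1)[OF n] c by simp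
      ultimately show ?thesis
        unfolding \<rho>(3)[OF n] using \<tau> by (simp add: powr_mult)
    qed
    have ratio: "c / C * (real p / real k) powr r \<le> t N p / t N k"
        "t N p / t N k \<le> C / c * (real p / real k) powr r"
      if "p \<in> {1..N}" "k \<in> {1..N}" for p k
    proof -
      have "t N p / t N k = (\<rho> p / \<rho> k) * (real p / real k) powr r"
        unfolding \<rho>(3)[OF that(1)] \<rho>(3)[OF that(2)] using \<tau> that by (simp add: powr_divide)
      moreover have "c / C \<le> \<rho> p / \<rho> k" "\<rho> p / \<rho> k \<le> C / c"
        using \<rho>[OF that(1)] \<rho>[OF that(2)] c by (auto intro!: frac_le)
      ultimately show "c / C * (real p / real k) powr r \<le> t N p / t N k"
        "t N p / t N k \<le> C / c * (real p / real k) powr r"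
        by (simp_all only: mult_right_mono powr_ge_zero)
    qed
    have step_eq: "\<tau> powr (1 / r) * t N n powr (1 - 1 / r) = t N n / (\<rho> n powr (1 / r) * real n)"
      if n: "n \<in> {1..N}" for n
    proof -
      have tn: "0 < t N n"
        using n t_pos by auto
      have "t N n powr (1 - 1 / r) = t N n / t N n powr (1 / r)"
        using tn by (simp add: powr_diff)
      thus ?thesis
        unfolding root[OF n] using \<tau> by simp
    qed
    show ?thesis
    proof
      show "0 < \<kappa>" "\<kappa> < \<beta>" "1 \<le> K"
        using \<beta> r K by (auto simp: \<kappa>_def min_def)
    next
      fix n assume n: "n \<in> {1..N}"
      have tn: "0 < t N n"
        using n t_pos by auto
      have rp: "0 < \<rho> n powr (1 / r)"
        using \<rho>(1)[OF n] c by simp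
      define den where "den = t N n / (\<rho> n powr (1 / r) * real n)"
      have den: "0 < den"
        using tn rp n by (simp add: den_def)
      have den_eq: "(t N 1 - t N 0) powr (1 / r) * t N n powr (1 - 1 / r) = den"
        using step_eq[OF n] by (simp add: \<tau>_def den_def)
      have st: "c' * (t N n / (\<rho> n powr (1 / r) * real n)) \<le> t N n - t N (n - 1)"
        "t N n - t N (n - 1) \<le> C' * (t N n / (\<rho> n powr (1 / r) * real n))"
        using steps[OF N n] den unfolding den_eq den_def[symmetric]
        by (simp_all add: pos_le_divide_eq pos_divide_le_eq)
      have "real n * (t N n - t N (n - 1)) \<le> real n * (C' * (t N n / (\<rho> n powr (1 / r) * real n)))"
        using st(2) by (intro mult_left_mono) auto
      also have "\<dots> = C' * (1 / \<rho> n powr (1 / r)) * t N n"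
        using n by simp
      also have "1 / \<rho> n powr (1 / r) = \<rho> n powr (- (1 / r))"
        by (simp add: powr_minus_divide)
      also have "C' * \<rho> n powr (- (1 / r)) * t N n \<le> K1 * t N n"
        unfolding K1_def using \<rho>(1)[OF n] c c' tn r by (intro mult_right_mono mult_left_mono powr_mono2') auto
      also have "\<dots> \<le> K * t N n"
        using K tn by (intro mult_right_mono) auto
      finally show "real n * (t N n - t N (n - 1)) \<le> K * t N n" .
      have "t N n = \<rho> n powr (1 / r) / c' * (real n * (c' * (t N n / (\<rho> n powr (1 / r) * real n))))"
        using rp c' n by simp
      also have "\<dots> \<le> \<rho> n powr (1 / r) / c' * (real n * (t N n - t N (n - 1)))"
        using st(1) rp c' by (intro mult_left_mono) auto
      also have "\<dots> \<le> K2 * (real n * (t N n - t N (n - 1)))"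
        unfolding K2_def using \<rho>[OF n] c c' r step_pos[OF n]
        by (intro mult_right_mono divide_right_mono powr_mono2) auto
      also have "\<dots> \<le> K * (real n * (t N n - t N (n - 1)))"
        using K step_pos[OF n] by (intro mult_right_mono) auto
      finally show "t N n \<le> K * (real n * (t N n - t N (n - 1)))" .
    next
      fix p k :: nat assume pk: "1 \<le> p" "p \<le> k" "k \<le> N"
      have pN: "p \<in> {1..N}" and kN: "k \<in> {1..N}"
        using pk by auto
      have tp: "0 < t N p" and tk: "0 < t N k" and tpk: "t N p \<le> t N k"
        using pk by (auto intro!: t_pos t_le)
      have unroot: "((real p / real k) powr r) powr (1 / r) = real p / real k"
        using r by (simp add: powr_powr)
      have "(real p / real k) powr r \<le> C / c * (t N p / t N k)"
      proof -
        have "C / c * (c / C * (real p / real k) powr r) \<le> C / c * (t N p / t N k)"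
          using ratio(1)[OF pN kN] c by (intro mult_left_mono) auto
        thus ?thesis
          using c by simp
      qed
      hence le: "real p / real k \<le> (C / c * (t N p / t N k)) powr (1 / r)"
        using powr_mono2[of "1 / r" "(real p / real k) powr r"] r unfolding unroot by simp
      also have "\<dots> = K3 * (t N p / t N k) powr (1 / r)"
        unfolding K3_def by (rule powr_mult)
      also have "\<dots> \<le> K * (t N p / t N k) powr \<kappa>"
        using K tp tk tpk by (intro mult_mono powr_mono') (auto simp: \<kappa>_def)
      finally show "real p / real k \<le> K * (t N p / t N k) powr \<kappa>" .
      assume near: "t N k \<le> 4 * t N p"
      have "1 / 4 \<le> C / c * (real p / real k) powr r"
      proof -
        have "1 / 4 \<le> t N p / t N k"
          using near tk by (simp add: pos_le_divide_eq)
        thus ?thesis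
          using ratio(2)[OF pN kN] by (rule order_trans)
      qed
      hence "1 \<le> 4 * C / c * (real p / real k) powr r"
        by (simp add: mult_ac)
      hence "1 powr (1 / r) \<le> (4 * C / c * (real p / real k) powr r) powr (1 / r)"
        using r by (intro powr_mono2) auto
      also have "\<dots> = K4 * (real p / real k)"
        unfolding K4_def using c by (subst powr_mult) (auto simp: unroot[simplified])
      finally have "real k \<le> K4 * real p"
        using pk by (simp add: field_simps)
      also have "\<dots> \<le> K * real p"
        using K by (intro mult_right_mono) auto
      finally show "real k \<le> K * real p" .
    next
      fix n assume n: "n \<in> {2..N}"
      have nN: "n \<in> {1..N}" "n - 1 \<in> {1..N}"
        using n by auto
      have tn: "0 < t N (n - 1)"
        using nN t_pos by auto
      have "t N n / t N (n - 1) \<le> C / c * (real n / real (n - 1)) powr r"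
        by (rule ratio(2)[OF nN])
      also have "\<dots> \<le> K5"
        unfolding K5_def using n c r by (intro mult_left_mono powr_mono2) (auto simp: field_simps of_nat_diff)
      also have "\<dots> \<le> K"
        using K by simp
      finally show "t N n \<le> K * t N (n - 1)"
        using tn by (simp add: pos_divide_le_eq)
    qed
  qed
  thus ?thesis
    using that by blast
qed

theorem lemma4p3:
  fixes T \<beta> \<sigma> r \<gamma> lam1 lam2 :: real
    and t :: "nat \<Rightarrow> nat \<Rightarrow> real"
    and g :: "nat \<Rightarrow> nat \<Rightarrow> nat \<Rightarrow> real"
  assumes "T > 0"
    and "0 < \<beta>" and "\<beta> < 1"
    and "\<sigma> = 1 - \<beta> / 2"
    and "r \<ge> 1"
    and "lam1 \<ge> 0" and "lam2 \<ge> 0" and "lam1 > 0 \<or> lam2 > 0"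
    and "mesh_family T t"
    and "quasi_graded r t"
    and "\<And>N. N \<ge> 1 \<Longrightarrow> alikhanov_coeffs \<beta> \<sigma> (t N) N (g N)"
    and "\<And>N. N \<ge> 1 \<Longrightarrow> property_P1 N (g N)"
  shows "\<exists>\<tau>\<^sub>0>0. \<forall>C>0. \<exists>C'>0. \<forall>N\<ge>1. max_step (t N) N \<le> \<tau>\<^sub>0 \<longrightarrow>
           (\<forall>v :: nat \<Rightarrow> real.
              (\<forall>j\<in>{1..N}. (alikhanov_deriv \<beta> \<sigma> (t N) v j - lam1 * v j) - lam2 * v (j - 1)
                   \<le> C * ((t N 1 - t N 0) / t N j) powr (\<gamma> + 1))
              \<and> v 0 = 0
              \<longrightarrow> (\<forall>j\<in>{1..N}. v j \<le> C' * V_bound \<beta> (t N) j \<gamma>))"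
proof -
  have \<sigma>: "1 / 2 \<le> \<sigma>" "\<sigma> \<le> 1"
    using assms(2-4) by auto
  obtain K \<kappa> where mesh: "\<And>N. 1 \<le> N \<Longrightarrow> graded_mesh \<beta> \<sigma> N (t N) (g N) K \<kappa>"
    using graded_mesh_of_quasi_graded[OF assms(2,3) \<sigma> assms(5,9,10,11,12)] by blast
  \<comment> \<open>The constants depend only on \<open>\<beta>\<close>, \<open>K\<close> and \<open>\<kappa>\<close>; the mesh with one step serves to name them.\<close>
  interpret one: graded_mesh \<beta> \<sigma> 1 "t 1" "g 1" K \<kappa>
    by (rule mesh) simp
  \<comment> \<open>The parameter \<open>\<mu>\<close> is chosen such that \<open>\<mu> powr \<beta> = X\<close>, which gives the absorption condition.\<close>
  define X where "X = 2 * (one.growth_const * (lam1 + K * lam2)) + 1"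
  have \<Lambda>: "0 \<le> lam1 + K * lam2"
    using assms(6,7) one.K_ge by simp
  have growth_const: "0 \<le> one.growth_const"
    unfolding one.growth_const_def using one.green_const_nonneg one.Gamma_pos assms(2)
    by (intro add_nonneg_nonneg mult_nonneg_nonneg divide_nonneg_nonneg) auto
  have X: "1 \<le> X"
    unfolding X_def using \<Lambda> growth_const by simp
  define \<mu> where "\<mu> = X powr (1 / \<beta>)"
  have \<mu>: "0 < \<mu>"
    using X by (simp add: \<mu>_def)
  have \<mu>X: "\<mu> powr (-\<beta>) = 1 / X"
    using X assms(2) by (simp add: \<mu>_def powr_powr powr_minus_divide)
  have absorb: "one.growth_const * \<mu> powr (-\<beta>) * (lam1 + K * lam2) \<le> 1 / 2"
  proof -
    define Y where "Y = one.growth_const * (lam1 + K * lam2)"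
    have "Y / X \<le> 1 / 2"
      using X by (simp add: X_def Y_def[symmetric] pos_divide_le_eq)
    thus ?thesis
      using \<mu>X by (simp add: Y_def)
  qed
  define A where "A = 8 * 2 powr \<bar>\<gamma> + 1\<bar> * one.green_const"
  define G where "G = 1 + (\<mu> * T) powr (1 - \<beta>) * exp (\<mu> * T)"
  have G: "0 < G"
    by (simp add: G_def add_pos_nonneg)
  have A0: "0 < A"
    unfolding A_def using one.green_const_pos by (intro mult_pos_pos) auto
  show ?thesis
  proof (rule exI[of _ "1 / \<mu>"], intro conjI allI impI)
    show "0 < 1 / \<mu>"
      using \<mu> by simp
  next
    fix C :: real assume C: "0 < C"
    define C' where "C' = A * (C * (1 + 1 / \<bar>\<gamma>\<bar>)) * G"
    have "0 < C'"
      unfolding C'_def using A0 C G by (intro mult_pos_pos add_pos_nonneg) auto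
    moreover have "v j \<le> C' * V_bound \<beta> (t N) j \<gamma>"
      if N: "1 \<le> N" and fine: "max_step (t N) N \<le> 1 / \<mu>" and v0: "v 0 = 0"
        and v: "\<forall>j\<in>{1..N}. (alikhanov_deriv \<beta> \<sigma> (t N) v j - lam1 * v j) - lam2 * v (j - 1)
                   \<le> C * ((t N 1 - t N 0) / t N j) powr (\<gamma> + 1)"
        and j: "j \<in> {1..N}" for N v j
    proof -
      interpret graded_mesh \<beta> \<sigma> N "t N" "g N" K \<kappa>
        by (rule mesh) fact
      have tN: "t N N = T"
        using assms(9) N by (simp add: mesh_family_def)
      have "v j \<le> A * (C * (1 + 1 / \<bar>\<gamma>\<bar>)) * (1 + (\<mu> * t N N) powr (1 - \<beta>) * exp (\<mu> * t N N)) * V_bound \<beta> (t N) j \<gamma>"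
        unfolding A_def
      proof (rule source_stability[OF assms(6,7) \<mu> absorb])
        fix k assume "k \<in> {1..N}"
        hence "t N k - t N (k - 1) \<le> max_step (t N) N"
          unfolding max_step_def by (intro Max_ge) auto
        thus "t N k - t N (k - 1) \<le> 1 / \<mu>"
          using fine by simp
      qed (use v v0 C j in auto)
      thus ?thesis
        by (simp add: C'_def G_def tN)
    qed
    ultimately show "\<exists>C'>0. \<forall>N\<ge>1. max_step (t N) N \<le> 1 / \<mu> \<longrightarrow>
           (\<forall>v :: nat \<Rightarrow> real.
              (\<forall>j\<in>{1..N}. (alikhanov_deriv \<beta> \<sigma> (t N) v j - lam1 * v j) - lam2 * v (j - 1)
                   \<le> C * ((t N 1 - t N 0) / t N j) powr (\<gamma> + 1))
              \<and> v 0 = 0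
              \<longrightarrow> (\<forall>j\<in>{1..N}. v j \<le> C' * V_bound \<beta> (t N) j \<gamma>))"
      by blast
  qed
qed

end
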